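(* Let $N\in\mathbb N$, $N>1$, let $V$ satisfy the Half-line Assumption of the context with this $N$, let $n:=N-1$, let $\lambda=a+ib$ with $a=a(b)\in\mathbb R$ satisfying the Admissibility Condition of the context, and let $f=\xi g$ be the function defined in the context with index $n$. Then there is $c>0$ such that, as $b\to+\infty$, $$\begin{aligned}\frac{\|(H_V-\lambda)f\|_{L^2(\mathbb R_+)}}{\|f\|_{L^2(\mathbb R_+)}}=\mathcal O\Bigg(&\exp(-c\,x_b^{\nu+1+2\varepsilon_1})+x_b^{N\nu}\sup_{x\in\mathcal J_b}\frac{b+|\operatorname{Re}V(x)|}{(a-\operatorname{Re}V(x))^{\frac N2}}\\&+\sum_{k=0}^{N-2}\sum_{l=2}^{N+k}x_b^{(N+k)\nu}\sup_{x\in\mathcal J_b}\frac{(b+|\operatorname{Re}V(x)|)^l}{(a-\operatorname{Re}V(x))^{\frac{N-2+k}{2}+l}}\Bigg).\end{aligned}$$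
   Context: Notation: $\mathbb R_+=(0,\infty)$, $\langle x\rangle=(1+x^2)^{1/2}$, $[[m,n]]=[m,n]\cap\mathbb Z$. $A\lesssim B$ means $A\le CB$ with $C>0$ independent of $\lambda$ (i.e. of $a,b$) and $x$; "for all $x\gtrsim1$" means for all sufficiently large $x$. Complex square roots and powers are principal branches. $H_Vf=-f''+Vf$ acting in $L^2(\mathbb R_+)$ (only applied to functions $f$ compactly supported in $\mathbb R_+$). Half-line Assumption (with $N\in\mathbb N$, $N>1$): $V\in W^{N,\infty}_{\rm loc}(\overline{\mathbb R_+})$ is complex-valued, $\lim_{x\to+\infty}\operatorname{Im}V(x)=+\infty$, and there are $\nu\in\mathbb R$ and $\varepsilon_1>0$ such that (i) for all $m\in[[1,N]]$, $|\operatorname{Im}V^{(m)}(x)|=\mathcal O(|\operatorname{Im}V(x)|\langle x\rangle^{m\nu})$ and $|V^{(m)}(x)|=\mathcal O(|V(x)|\langle x\rangle^{m\nu})$ as $x\to+\infty$; (ii) $\langle x\rangle^{4(\nu+\varepsilon_1)+2}\big(\langle x\rangle^{4\nu+2}+|\operatorname{Re}V(x)|\big)=\mathcal O(|\operatorname{Im}V(x)|^2)$ as $x\to+\infty$; (iii) $\operatorname{Im}V'(x)\gtrsim\operatorname{Im}V(x)\langle x\rangle^{\nu}$ for all $x\gtrsim1$. Turning point and cut-off: write $\lambda=a+ib$, $a\in\mathbb R$, $b>0$. For large $b$, $x_b$ is the point with $\operatorname{Im}V(x_b)=b$ (unique for large $b$). Put $\delta:=\frac12x_b^{-\nu}$,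 $\Delta:=\frac\delta4$, $\mathcal J_b:=(x_b-\delta,x_b+\delta)$, $\mathcal J_b':=(x_b-\delta+\Delta,x_b+\delta-\Delta)$. The cut-off $\xi\in C_0^\infty(\mathbb R_+)$ satisfies $0\le\xi\le1$, $\xi=1$ on $\mathcal J_b'$, $\xi=0$ outside $\mathcal J_b$, and $\|\xi^{(j)}\|_{L^\infty}\lesssim\Delta^{-j}$, $j=1,2$. Admissibility Condition on $a$: for all $x\in\mathcal J_b$, $$b^{\frac23}x_b^{\frac{2\nu}3}\lesssim|a|\lesssim a-\operatorname{Re}V(x)\lesssim b^2x_b^{-4\nu-4\varepsilon_1-2}.$$ Pseudomode with index $n$: $\psi_{-1}':=i\lambda^{-1/2}(\lambda-V)^{1/2}$ and, recursively for $k\in[[-1,n-2]]$, $\psi_{k+1}':=\frac1{2\psi_{-1}'}\Big(\psi_k''-\sum_{\alpha+\beta=k,\ \alpha,\beta\ne-1}\psi_\alpha'\psi_\beta'\Big)$ (with $\psi_\alpha=0$ for $\alpha\ge n$ or $\alpha\le-2$); $g(x):=\exp\big(-\sum_{k=-1}^{n-1}\lambda^{-k/2}\int_{x_b}^x\psi_k'(t)\,dt\big)$ and $f:=\xi g$. *)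

theory Defs
  imports "HOL-Analysis.Analysis" "HOL-Library.Landau_Symbols"
begin

text \<open>The bracket \<open>(1 + x\<^sup>2)\<^sup>1\<^sup>/\<^sup>2\<close>.\<close>

definition jap :: "real \<Rightarrow> real" where
  "jap x = sqrt (1 + x\<^sup>2)"

subsection \<open>Weak derivatives, Sobolev spaces and \<open>L\<^sup>2\<close>\<close>

definition test_function :: "real set \<Rightarrow> (real \<Rightarrow> real) \<Rightarrow> bool" where
  "test_function S \<phi> \<longleftrightarrow>
     (\<forall>k x. ((deriv ^^ k) \<phi>) field_differentiable (at x)) \<and>
     (\<exists>K. compact K \<and> K \<subseteq> S \<and> (\<forall>x. x \<notin> K \<longrightarrow> \<phi> x = 0))"

definition locally_integrable :: "real set \<Rightarrow> (real \<Rightarrow> complex) \<Rightarrow> bool" where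
  "locally_integrable S f \<longleftrightarrow> (\<forall>K. compact K \<and> K \<subseteq> S \<longrightarrow> set_integrable lebesgue K f)"

definition has_weak_deriv ::
    "real set \<Rightarrow> nat \<Rightarrow> (real \<Rightarrow> complex) \<Rightarrow> (real \<Rightarrow> complex) \<Rightarrow> bool" where
  "has_weak_deriv S k f h \<longleftrightarrow>
     locally_integrable S f \<and> locally_integrable S h \<and>
     (\<forall>\<phi>. test_function S \<phi> \<longrightarrow>
        (LINT x:S|lebesgue. (deriv ^^ k) \<phi> x *\<^sub>R f x) =
        (-1) ^ k * (LINT x:S|lebesgue. \<phi> x *\<^sub>R h x))"

text \<open>The \<open>k\<close>-th weak derivative on the open half-line; it is determined only up to a
  null set, so it may only be used in statements insensitive to null sets.\<close>

definition weak_deriv :: "nat \<Rightarrow> (real \<Rightarrow> complex) \<Rightarrow> real \<Rightarrow> complex" where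
  "weak_deriv k f = (SOME h. has_weak_deriv {0<..} k f h)"

text \<open>\<open>W\<^sup>N\<^sup>,\<^sup>\<infinity>\<close>, locally on the \<^emph>\<open>closed\<close> half-line: the essential bounds
  hold on every \<open>(0, R)\<close>, up to the end point \<open>0\<close>.\<close>

definition sobolev_inf_loc :: "nat \<Rightarrow> (real \<Rightarrow> complex) \<Rightarrow> bool" where
  "sobolev_inf_loc N f \<longleftrightarrow>
     (\<forall>m\<le>N. \<exists>h. has_weak_deriv {0<..} m f h \<and>
        (\<forall>R>0. \<exists>C. AE x in lebesgue. x \<in> {0<..<R} \<longrightarrow> cmod (h x) \<le> C))"

definition in_L2 :: "(real \<Rightarrow> complex) \<Rightarrow> bool" where
  "in_L2 f \<longleftrightarrow> set_borel_measurable lebesgue {0<..} f \<and>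
     set_integrable lebesgue {0<..} (\<lambda>x. (cmod (f x))\<^sup>2)"

text \<open>Meaningful only together with \<^const>\<open>in_L2\<close>: the integral of a non-integrable
  function is \<open>0\<close> by convention.\<close>

definition L2_norm_half :: "(real \<Rightarrow> complex) \<Rightarrow> real" where
  "L2_norm_half f = sqrt (LINT x:{0<..}|lebesgue. (cmod (f x))\<^sup>2)"

definition schroedinger_op :: "(real \<Rightarrow> complex) \<Rightarrow> (real \<Rightarrow> complex) \<Rightarrow> real \<Rightarrow> complex" where
  "schroedinger_op V f = (\<lambda>x. - weak_deriv 2 f x + V x * f x)"

subsection \<open>The potential\<close>

text \<open>\<open>O\<close> at \<open>+\<infinity>\<close> outside a null set, for functions such as weak derivatives
  that are only defined almost everywhere.\<close>

definition ess_bigo :: "(real \<Rightarrow> real) \<Rightarrow> (real \<Rightarrow> real) \<Rightarrow> bool" where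
  "ess_bigo u w \<longleftrightarrow> (\<exists>C x0. AE x in lebesgue. x \<ge> x0 \<longrightarrow> \<bar>u x\<bar> \<le> C * \<bar>w x\<bar>)"

text \<open>Continuity selects the continuous representative of \<open>V\<close> (it exists as soon as
  \<open>N \<ge> 1\<close>), which is needed for pointwise values of \<open>V\<close> to make sense.\<close>

definition half_line_assumption :: "nat \<Rightarrow> (real \<Rightarrow> complex) \<Rightarrow> real \<Rightarrow> real \<Rightarrow> bool" where
  "half_line_assumption N V \<nu> \<epsilon>1 \<longleftrightarrow>
     continuous_on {0<..} V \<and>
     sobolev_inf_loc N V \<and>
     filterlim (\<lambda>x. Im (V x)) at_top at_top \<and>
     \<epsilon>1 > 0 \<and>
     (\<forall>m\<in>{1..N}.
        ess_bigo (\<lambda>x. Im (weak_deriv m V x)) (\<lambda>x. \<bar>Im (V x)\<bar> * jap x powr (real m * \<nu>)) \<and>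
        ess_bigo (\<lambda>x. cmod (weak_deriv m V x)) (\<lambda>x. cmod (V x) * jap x powr (real m * \<nu>))) \<and>
     (\<lambda>x. jap x powr (4 * (\<nu> + \<epsilon>1) + 2) * (jap x powr (4 * \<nu> + 2) + \<bar>Re (V x)\<bar>))
        \<in> O[at_top](\<lambda>x. \<bar>Im (V x)\<bar>\<^sup>2) \<and>
     (\<exists>c>0. \<exists>x0. AE x in lebesgue.
        x \<ge> x0 \<longrightarrow> Im (weak_deriv 1 V x) \<ge> c * (Im (V x) * jap x powr \<nu>))"

subsection \<open>Turning point, cut-off and admissible \<open>a\<close>\<close>

definition turning_point :: "(real \<Rightarrow> complex) \<Rightarrow> real \<Rightarrow> real" where
  "turning_point V b = (THE x. x > 0 \<and> Im (V x) = b)"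

definition width :: "(real \<Rightarrow> complex) \<Rightarrow> real \<Rightarrow> real \<Rightarrow> real" where
  "width V \<nu> b = 1/2 * turning_point V b powr (- \<nu>)"

definition margin :: "(real \<Rightarrow> complex) \<Rightarrow> real \<Rightarrow> real \<Rightarrow> real" where
  "margin V \<nu> b = width V \<nu> b / 4"

definition nbhd :: "(real \<Rightarrow> complex) \<Rightarrow> real \<Rightarrow> real \<Rightarrow> real set" where
  "nbhd V \<nu> b =
     {turning_point V b - width V \<nu> b <..< turning_point V b + width V \<nu> b}"

definition inner_nbhd :: "(real \<Rightarrow> complex) \<Rightarrow> real \<Rightarrow> real \<Rightarrow> real set" where
  "inner_nbhd V \<nu> b =
     {turning_point V b - width V \<nu> b + margin V \<nu> b <..<
      turning_point V b + width V \<nu> b - margin V \<nu> b}"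

text \<open>A family of cut-offs indexed by \<open>b\<close>; the constant in the derivative bounds is
  uniform in \<open>b\<close>.\<close>

definition cutoff_family ::
    "(real \<Rightarrow> complex) \<Rightarrow> real \<Rightarrow> (real \<Rightarrow> real \<Rightarrow> real) \<Rightarrow> bool" where
  "cutoff_family V \<nu> \<xi> \<longleftrightarrow>
     (\<exists>C>0. \<forall>\<^sub>F b in at_top.
        test_function {0<..} (\<xi> b) \<and>
        (\<forall>x. 0 \<le> \<xi> b x \<and> \<xi> b x \<le> 1) \<and>
        (\<forall>x\<in>inner_nbhd V \<nu> b. \<xi> b x = 1) \<and>
        (\<forall>x. x \<notin> nbhd V \<nu> b \<longrightarrow> \<xi> b x = 0) \<and>
        (\<forall>j\<in>{1, 2}. \<forall>x. \<bar>(deriv ^^ j) (\<xi> b) x\<bar> \<le> C * margin V \<nu> b powr (- real j)))"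

definition admissible ::
    "(real \<Rightarrow> complex) \<Rightarrow> real \<Rightarrow> real \<Rightarrow> (real \<Rightarrow> real) \<Rightarrow> bool" where
  "admissible V \<nu> \<epsilon>1 a \<longleftrightarrow>
     (\<exists>C1>0. \<exists>C2>0. \<exists>C3>0. \<forall>\<^sub>F b in at_top. \<forall>x\<in>nbhd V \<nu> b.
        b powr (2/3) * turning_point V b powr (2 * \<nu> / 3) \<le> C1 * \<bar>a b\<bar> \<and>
        \<bar>a b\<bar> \<le> C2 * (a b - Re (V x)) \<and>
        a b - Re (V x) \<le> C3 * (b\<^sup>2 * turning_point V b powr (- 4 * \<nu> - 4 * \<epsilon>1 - 2)))"

subsection \<open>The pseudomode\<close>

text \<open>Indices are shifted by one: \<open>dpsi V z j\<close> is \<open>\<psi>'\<close> with index \<open>j - 1\<close> at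
  spectral parameter \<open>z\<close>. In the recursion both factors of the quadratic term have index
  at least \<open>0\<close>, because index \<open>-1\<close> is excluded and lower ones vanish. The derivatives are
  classical: for indices below \<open>N - 1\<close> and potentials of class \<open>W\<^sup>N\<^sup>,\<^sup>\<infinity>\<close>
  all derivatives taken here are continuous wherever \<open>z - V\<close> avoids the branch cut.\<close>

fun dpsi :: "(real \<Rightarrow> complex) \<Rightarrow> complex \<Rightarrow> nat \<Rightarrow> real \<Rightarrow> complex" where
  "dpsi V z 0 = (\<lambda>x. \<i> * z powr (- 1 / 2) * csqrt (z - V x))"
| "dpsi V z (Suc j) = (\<lambda>x. 1 / (2 * dpsi V z 0 x) *
     (vector_derivative (dpsi V z j) (at x)
      - (\<Sum>i<j. dpsi V z (Suc i) x * dpsi V z (j - i) x)))"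

text \<open>The summand with index \<open>j\<close> is the one with index \<open>k = j - 1\<close>, \<open>-1 \<le> k \<le> n - 1\<close>.\<close>

definition wkb :: "nat \<Rightarrow> (real \<Rightarrow> complex) \<Rightarrow> complex \<Rightarrow> real \<Rightarrow> complex" where
  "wkb n V z x =
     exp (- (\<Sum>j=0..n. z powr (- (of_nat j - 1) / 2) *
        (LBINT t=ereal (turning_point V (Im z))..ereal x. dpsi V z j t)))"

definition pseudomode ::
    "nat \<Rightarrow> (real \<Rightarrow> complex) \<Rightarrow> (real \<Rightarrow> real \<Rightarrow> real) \<Rightarrow> complex \<Rightarrow> real \<Rightarrow> complex" where
  "pseudomode n V \<xi> z x = of_real (\<xi> (Im z) x) * wkb n V z x"

definition residual :: "(real \<Rightarrow> complex) \<Rightarrow> complex \<Rightarrow> (real \<Rightarrow> complex) \<Rightarrow> real \<Rightarrow> complex" where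
  "residual V z f = (\<lambda>x. schroedinger_op V f x - z * f x)"

end

theory Submission
  imports Defs
begin

text \<open>
  Write \<open>z = a + i b\<close>, \<open>X\<close> for the turning point, \<open>\<kappa> = X\<^sup>\<nu>\<close> and \<open>P\<^sub>j = z^((1-j)/2) \<psi>'_(j-1)\<close>
  (\<open>wkb_rate\<close>). Then \<open>g' = - S g\<close> with \<open>S = P\<^sub>0 + \<dots> + P_(N-1)\<close>, and applying \<open>H\<^sub>V - z\<close> to \<open>\<xi> g\<close> gives
  \<open>(S' - S\<^sup>2 + V - z) \<xi> g\<close> plus terms with a derivative of \<open>\<xi>\<close>.

  The recursion defining the \<open>\<psi>\<close>'s says that \<open>P\<^sub>0\<^sup>2 = V - z\<close> and that \<open>P\<^sub>j'\<close> is the sum of all products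
  \<open>P\<^sub>i P\<^sub>k\<close> with \<open>i + k = j + 1\<close>. So in the Riccati expression \<open>S' - S\<^sup>2 + V - z\<close> everything cancels except
  \<open>P'_(N-1)\<close> and the products \<open>P\<^sub>i P\<^sub>k\<close> with \<open>i + k \<ge> N\<close> (\<open>riccati_truncation\<close>). For \<open>j \<ge> 1\<close> each \<open>P\<^sub>j\<close> is a
  universal polynomial in \<open>R = (z - V)^(-1/2)\<close> and the derivatives of \<open>V\<close>: with \<open>l\<close> factors that are derivatives
  of \<open>V\<close>, of total order \<open>j\<close>, it carries \<open>R\<close> to the power \<open>j - 1 + 2 l\<close> (\<open>wkb_rate_is_jet\<close>). Since the \<open>m\<close>-th
  derivative of \<open>V\<close> is at most a constant times \<open>(b + |Re V|) \<kappa>\<^sup>m\<close> near \<open>X\<close>, the surviving terms are bounded by the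
  powers of \<open>b + |Re V|\<close>, \<open>a - Re V\<close> and \<open>\<kappa>\<close> that occur in the claim (\<open>wkb_remainder_bound\<close>).

  The terms with a derivative of \<open>\<xi>\<close> live where \<open>|x - X|\<close> is at least three quarters of the half-width of the
  window. The modulus of \<open>g\<close> is governed by \<open>Re S\<close>, whose main part \<open>- Im (z - V)^(1/2)\<close> changes sign at \<open>X\<close> and makes
  \<open>|g|\<close> decrease in both directions; the corrections \<open>P\<^sub>1, P\<^sub>2, \<dots>\<close> integrate to at most a logarithm, because the
  lower bound on \<open>a\<close> keeps the expansion parameter bounded (\<open>expansion_parameter_bound\<close>). Hence \<open>|g|\<close> is at most a
  power of \<open>b X\<close> times \<open>exp (- X^(\<nu>+1+\<epsilon>) / const)\<close> there, and at least the inverse of a power near \<open>X\<close>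
  (\<open>wkb_amplitude_bounds\<close>, \<open>residual_ratio_bound\<close>). As \<open>Im V\<close> grows at most like \<open>exp (const X^(\<nu>+1+\<epsilon>/2))\<close> while the
  second term of the claimed bound is at least a negative power of \<open>b X\<close>, this exponentially small contribution is
  absorbed by the second term (\<open>edge_terms_bound\<close>, \<open>decay_beats_polynomials\<close>), and \<open>c = 1\<close> is a possible choice.

  A potential with bounded weak derivatives has a locally Lipschitz derivative of order \<open>N - 1\<close>, so
  \<open>P_(N-1)\<close> is differentiable only almost everywhere. All differentiation is therefore expressed by the relation
  \<open>is_primitive\<close> between a locally Lipschitz function and a locally bounded function, which satisfies the product rule
  (\<open>is_primitive_mult\<close>) and is linked to weak derivatives by the lemma of du Bois-Reymond
  (\<open>du_bois_reymond_constant\<close>, \<open>sobolev_derivatives\<close>).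
\<close>

section \<open>Smooth bump functions\<close>

text \<open>Test functions are described by the iterates of \<^const>\<open>deriv\<close>; this recursive form of
  \<open>k + 1\<close>-fold differentiability is the one that passes through sums and products by induction.\<close>

fun times_differentiable :: "nat \<Rightarrow> (real \<Rightarrow> real) \<Rightarrow> bool" where
  "times_differentiable 0 f \<longleftrightarrow> (\<forall>x. f field_differentiable at x)"
| "times_differentiable (Suc k) f \<longleftrightarrow>
     (\<forall>x. f field_differentiable at x) \<and> times_differentiable k (deriv f)"

lemma times_differentiable_iff:
  "times_differentiable k f \<longleftrightarrow> (\<forall>j\<le>k. \<forall>x. (deriv ^^ j) f field_differentiable at x)"
proof (induction k arbitrary: f)
  case (Suc k)
  have "(\<forall>j\<le>Suc k. \<forall>x. (deriv ^^ j) f field_differentiable at x) \<longleftrightarrow>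
    (\<forall>x. f field_differentiable at x) \<and> (\<forall>j\<le>k. \<forall>x. (deriv ^^ Suc j) f field_differentiable at x)"
    unfolding less_Suc_eq_le[symmetric] All_less_Suc2 by (simp del: funpow.simps(2))
  then show ?case using Suc[of "deriv f"] by (simp add: funpow_Suc_right del: funpow.simps)
qed simp

lemma smooth_iff_times_differentiable:
  "(\<forall>k x. (deriv ^^ k) f field_differentiable at x) \<longleftrightarrow> (\<forall>k. times_differentiable k f)"
  by (auto simp: times_differentiable_iff)

lemma times_differentiable_mono:
  "times_differentiable k f \<Longrightarrow> j \<le> k \<Longrightarrow> times_differentiable j f"
  by (auto simp: times_differentiable_iff)

lemma times_differentiable_DERIV:
  "times_differentiable k f \<Longrightarrow> (f has_field_derivative deriv f x) (at x)"
  by (cases k) (auto simp: DERIV_deriv_iff_field_differentiable)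

lemma times_differentiable_SucI:
  assumes "\<And>x. (f has_field_derivative f' x) (at x)" "times_differentiable k f'"
  shows "times_differentiable (Suc k) f"
proof -
  have "deriv f = f'" using assms(1) by (auto intro!: ext DERIV_imp_deriv)
  then show ?thesis using assms by (auto simp: field_differentiable_def)
qed

lemma times_differentiable_const: "times_differentiable k (\<lambda>x. c)"
  by (induction k arbitrary: c) auto

lemma times_differentiable_add:
  "times_differentiable k f \<Longrightarrow> times_differentiable k g \<Longrightarrow> times_differentiable k (\<lambda>x. f x + g x)"
proof (induction k arbitrary: f g)
  case 0 then show ?case by (auto intro: field_differentiable_add)
next
  case (Suc k)
  show ?case
    by (rule times_differentiable_SucI[where f' = "\<lambda>x. deriv f x + deriv g x"])
      (use Suc times_differentiable_DERIV[OF Suc.prems(1)] times_differentiable_DERIV[OF Suc.prems(2)]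
        in \<open>auto intro!: derivative_intros\<close>)
qed

lemma times_differentiable_mult:
  "times_differentiable k f \<Longrightarrow> times_differentiable k g \<Longrightarrow> times_differentiable k (\<lambda>x. f x * g x)"
proof (induction k arbitrary: f g)
  case 0 then show ?case by (auto intro: field_differentiable_mult)
next
  case (Suc k)
  have 1: "times_differentiable k f" "times_differentiable k g"
    using Suc.prems times_differentiable_mono le_SucI by blast+
  show ?case
    by (rule times_differentiable_SucI[where f' = "\<lambda>x. f x * deriv g x + deriv f x * g x"])
      (use Suc 1 times_differentiable_DERIV[OF Suc.prems(1)] times_differentiable_DERIV[OF Suc.prems(2)]
        in \<open>auto intro!: derivative_eq_intros times_differentiable_add\<close>)
qed

lemma DERIV_affine_arg:
  fixes f :: "real \<Rightarrow> real"
  assumes "(f has_field_derivative f') (at (c * x + d))"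
  shows "((\<lambda>x. f (c * x + d)) has_field_derivative c * f') (at x)"
proof -
  have "((\<lambda>x. c * x + d) has_field_derivative c) (at x)" by (auto intro!: derivative_eq_intros)
  from DERIV_chain'[OF this assms] show ?thesis by (simp only: mult.commute)
qed

lemma times_differentiable_affine:
  "times_differentiable k f \<Longrightarrow> times_differentiable k (\<lambda>x. f (c * x + d))"
proof (induction k arbitrary: f)
  case 0
  then show ?case using DERIV_affine_arg[OF times_differentiable_DERIV[OF 0]]
    unfolding times_differentiable.simps field_differentiable_def by blast
next
  case (Suc k)
  show ?case
  proof (rule times_differentiable_SucI[OF DERIV_affine_arg[OF times_differentiable_DERIV[OF Suc.prems]]])
    show "times_differentiable k (\<lambda>x. c * deriv f (c * x + d))"
      using Suc by (intro times_differentiable_mult times_differentiable_const) auto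
  qed
qed

text \<open>The derivative of a member of this family is a combination of two others, also at the origin, where all
  of them are flat; this closure is what makes every member smooth.\<close>

definition flat_exp :: "nat \<Rightarrow> real \<Rightarrow> real" where
  "flat_exp k x = (if x > 0 then (1 / x) ^ k * exp (- (1 / x)) else 0)"

lemma flat_exp_tendsto_0: "flat_exp k \<midarrow>0\<rightarrow> 0"
proof -
  have "((\<lambda>x. (inverse x) ^ k / exp (inverse x)) \<longlongrightarrow> (0::real)) (at_right 0)"
    by (rule filterlim_compose[OF tendsto_power_div_exp_0 filterlim_inverse_at_top_right])
  then have "(flat_exp k \<longlongrightarrow> 0) (at_right 0)"
    by (rule Lim_transform_eventually)
      (auto simp: eventually_at_filter flat_exp_def exp_minus field_simps intro!: always_eventually)
  moreover have "(flat_exp k \<longlongrightarrow> 0) (at_left 0)"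
    by (rule Lim_transform_eventually[where f="\<lambda>_. 0"])
      (auto simp: eventually_at_filter flat_exp_def intro!: always_eventually)
  ultimately show ?thesis by (simp add: filterlim_split_at)
qed

lemma DERIV_flat_exp:
  "(flat_exp k has_field_derivative flat_exp (k + 2) x - real k * flat_exp (Suc k) x) (at x)"
proof -
  consider "x > 0" | "x < 0" | "x = 0" by linarith
  then show ?thesis
  proof cases
    case 1
    have inv: "((\<lambda>x. 1 / x) has_field_derivative - (1 / x)\<^sup>2) (at x)"
      using 1 by (auto intro!: derivative_eq_intros simp: power2_eq_square)
    have "((\<lambda>x. (1 / x) ^ k * exp (- (1 / x))) has_field_derivative
        (1 / x) ^ k * (exp (- (1 / x)) * (1 / x)\<^sup>2)
        + real k * (- (1 / x)\<^sup>2 * (1 / x) ^ (k - 1)) * exp (- (1 / x))) (at x)"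
      by (rule derivative_eq_intros inv refl | simp)+
    moreover have "(1 / x) ^ k * (exp (- (1 / x)) * (1 / x)\<^sup>2)
        + real k * (- (1 / x)\<^sup>2 * (1 / x) ^ (k - 1)) * exp (- (1 / x))
      = flat_exp (k + 2) x - real k * flat_exp (Suc k) x"
      using 1 by (cases k) (simp_all add: flat_exp_def power2_eq_square algebra_simps)
    ultimately have "((\<lambda>x. (1 / x) ^ k * exp (- (1 / x))) has_field_derivative
        flat_exp (k + 2) x - real k * flat_exp (Suc k) x) (at x)" by simp
    then show ?thesis
      by (rule has_field_derivative_transform_within_open[where S="{0<..}"])
        (use 1 in \<open>auto simp: flat_exp_def\<close>)
  next
    case 2
    have "((\<lambda>x. 0) has_field_derivative flat_exp (k + 2) x - real k * flat_exp (Suc k) x) (at x)"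
      using 2 by (auto simp: flat_exp_def)
    then show ?thesis
      by (rule has_field_derivative_transform_within_open[where S="{..<0}"])
        (use 2 in \<open>auto simp: flat_exp_def\<close>)
  next
    case 3
    have "(\<lambda>h. (flat_exp k (0 + h) - flat_exp k 0) / h) = flat_exp (Suc k)"
      by (auto simp: flat_exp_def fun_eq_iff)
    then show ?thesis
      using flat_exp_tendsto_0[of "Suc k"] 3 by (simp add: DERIV_def flat_exp_def)
  qed
qed

lemma times_differentiable_flat_exp: "times_differentiable n (flat_exp k)"
proof (induction n arbitrary: k)
  case 0 then show ?case using DERIV_flat_exp by (auto simp: field_differentiable_def)
next
  case (Suc n)
  show ?case
  proof (rule times_differentiable_SucI[OF DERIV_flat_exp])
    have "times_differentiable n (\<lambda>x. flat_exp (k + 2) x + (- real k) * flat_exp (Suc k) x)"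
      by (intro times_differentiable_add times_differentiable_mult times_differentiable_const Suc)
    then show "times_differentiable n (\<lambda>x. flat_exp (k + 2) x - real k * flat_exp (Suc k) x)" by simp
  qed
qed

text \<open>The scale \<open>s\<close> steepens the flanks: for \<open>s\<close> tending to infinity the bumps increase to the indicator
  function of the interval.\<close>

definition bump :: "real \<Rightarrow> real \<Rightarrow> real \<Rightarrow> real \<Rightarrow> real" where
  "bump p q s x = flat_exp 0 (s * (x - p)) * flat_exp 0 (s * (q - x))"

lemma bump_range: "0 \<le> bump p q s x" "bump p q s x \<le> 1"
  by (auto simp: bump_def flat_exp_def intro!: mult_le_one)

lemma bump_pos: "p < x \<Longrightarrow> x < q \<Longrightarrow> s > 0 \<Longrightarrow> bump p q s x > 0"
  by (auto simp: bump_def flat_exp_def)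

lemma bump_eq_0: "x \<notin> {p<..<q} \<Longrightarrow> s > 0 \<Longrightarrow> bump p q s x = 0"
  by (auto simp: bump_def flat_exp_def zero_less_mult_iff)

lemma times_differentiable_bump: "times_differentiable k (bump p q s)"
proof -
  have "times_differentiable k (\<lambda>x. flat_exp 0 (s * x + (- s * p)) * flat_exp 0 ((- s) * x + s * q))"
    by (intro times_differentiable_mult times_differentiable_affine times_differentiable_flat_exp)
  moreover have "(\<lambda>x. flat_exp 0 (s * x + (- s * p)) * flat_exp 0 ((- s) * x + s * q)) = bump p q s"
    by (auto simp: bump_def fun_eq_iff algebra_simps)
  ultimately show ?thesis by simp
qed

lemma bump_tendsto_indicator: "(\<lambda>n. bump p q (real (Suc n)) x) \<longlonglongrightarrow> indicator {p<..<q} x"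
proof (cases "x \<in> {p<..<q}")
  case True
  have 1: "(\<lambda>n. flat_exp 0 (real (Suc n) * d)) \<longlonglongrightarrow> 1" if "d > 0" for d :: real
  proof -
    have "(\<lambda>n. exp (- ((1 / d) * inverse (real (Suc n))))) \<longlonglongrightarrow> exp (- ((1/d) * 0))"
      by (intro tendsto_intros LIMSEQ_inverse_real_of_nat)
    moreover have "flat_exp 0 (real (Suc n) * d) = exp (- ((1 / d) * inverse (real (Suc n))))" for n
      using that by (auto simp add: flat_exp_def zero_less_mult_iff divide_inverse mult.commute)
    ultimately show ?thesis by simp
  qed
  have "(\<lambda>n. flat_exp 0 (real (Suc n) * (x - p)) * flat_exp 0 (real (Suc n) * (q - x))) \<longlonglongrightarrow> 1 * 1"
    by (rule tendsto_mult; rule 1) (use True in auto)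
  then show ?thesis using True by (simp add: bump_def)
next
  case False
  then have "(\<lambda>n. bump p q (real (Suc n)) x) = (\<lambda>n. indicator {p<..<q} x)"
    using bump_eq_0[OF False] by auto
  then show ?thesis by simp
qed

lemma test_functionI:
  assumes "\<And>k. times_differentiable k \<phi>" "0 < p" "\<And>x. x \<notin> {p..q} \<Longrightarrow> \<phi> x = 0"
  shows "test_function {0<..} \<phi>"
  unfolding test_function_def smooth_iff_times_differentiable
  using assms by (auto intro!: exI[of _ "{p..q}"])

lemma test_function_bump: "0 < p \<Longrightarrow> s > 0 \<Longrightarrow> test_function {0<..} (bump p q s)"
  by (rule test_functionI[where p=p and q=q])
    (auto intro: times_differentiable_bump bump_eq_0)

text \<open>The compact support in the open half-line is enclosed in an interval bounded away from \<open>0\<close>, outside of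
  which all derivatives vanish as well.\<close>

lemma test_functionD:
  assumes "test_function {0<..} \<phi>"
  shows "times_differentiable k \<phi>"
    and "\<exists>p q. 0 < p \<and> p < q \<and> (\<forall>k x. x \<notin> {p<..<q} \<longrightarrow> (deriv ^^ k) \<phi> x = 0)"
proof -
  show "times_differentiable k \<phi>"
    using assms unfolding test_function_def smooth_iff_times_differentiable by blast
  obtain K where K: "compact K" "K \<subseteq> {0<..}" "\<And>x. x \<notin> K \<Longrightarrow> \<phi> x = 0"
    using assms unfolding test_function_def by blast
  have "\<exists>p q. 0 < p \<and> p < q \<and> K \<subseteq> {p<..<q}"
  proof (cases "K = {}")
    case True then show ?thesis by (intro exI[of _ 1] exI[of _ 2]) auto
  next
    case False
    obtain m M where m: "m \<in> K" "\<And>t. t \<in> K \<Longrightarrow> m \<le> t" and M: "M \<in> K" "\<And>t. t \<in> K \<Longrightarrow> t \<le> M"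
      using compact_attains_inf[OF K(1) False] compact_attains_sup[OF K(1) False] by blast
    then have "0 < m" "m \<le> M" using K(2) by auto
    moreover have "K \<subseteq> {m/2<..<M+1}" using m M \<open>0 < m\<close> by fastforce
    ultimately show ?thesis by (intro exI[of _ "m/2"] exI[of _ "M+1"]) auto
  qed
  then obtain p q where pq: "0 < p" "p < q" "K \<subseteq> {p<..<q}" by blast
  have "\<forall>x. x \<notin> K \<longrightarrow> (deriv ^^ k) \<phi> x = 0" for k
  proof (induction k)
    case 0 then show ?case using K by simp
  next
    case (Suc k)
    show ?case
    proof (intro allI impI)
      fix x assume "x \<notin> K"
      have "((\<lambda>_. 0) has_field_derivative 0) (at x)" by simp
      then have "((deriv ^^ k) \<phi> has_field_derivative 0) (at x)"
        by (rule has_field_derivative_transform_within_open[where S="-K"])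
          (use Suc \<open>x \<notin> K\<close> K(1) in \<open>auto intro: compact_imp_closed\<close>)
      then show "(deriv ^^ Suc k) \<phi> x = 0" by (simp add: DERIV_imp_deriv)
    qed
  qed
  then show "\<exists>p q. 0 < p \<and> p < q \<and> (\<forall>k x. x \<notin> {p<..<q} \<longrightarrow> (deriv ^^ k) \<phi> x = 0)"
    using pq by blast
qed

lemma test_function_deriv:
  assumes "test_function {0<..} \<phi>"
  shows "test_function {0<..} (deriv \<phi>)"
proof -
  note D = test_functionD[OF assms]
  obtain p q where pq: "0 < p" "p < q" "\<And>k x. x \<notin> {p<..<q} \<Longrightarrow> (deriv ^^ k) \<phi> x = 0"
    using D(2) by blast
  have "times_differentiable k (deriv \<phi>)" for k using D(1)[of "Suc k"] by simp
  then show ?thesis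
    by (rule test_functionI[where p=p and q=q]) (use pq(1) pq(3)[where k=1] in auto)
qed

section \<open>Lipschitz functions as primitives of bounded functions\<close>

text \<open>On \<open>[p, q]\<close> the function \<open>u\<close> is Lipschitz with almost everywhere derivative \<open>h\<close>. Bounds on \<open>h\<close> are required
  everywhere, which is harmless because \<open>h\<close> may be changed on null sets.\<close>

definition is_primitive :: "real \<Rightarrow> real \<Rightarrow> (real \<Rightarrow> complex) \<Rightarrow> (real \<Rightarrow> complex) \<Rightarrow> bool" where
  "is_primitive p q u h \<longleftrightarrow>
     h \<in> borel_measurable (lebesgue_on {p..q}) \<and> (\<exists>B. \<forall>t\<in>{p..q}. norm (h t) \<le> B) \<and>
     (\<forall>x y. p \<le> x \<longrightarrow> x \<le> y \<longrightarrow> y \<le> q \<longrightarrow> (h has_integral (u y - u x)) {x..y})"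

lemma abs_integrable_bounded_measurable:
  fixes h :: "real \<Rightarrow> complex"
  assumes "h \<in> borel_measurable (lebesgue_on {p..q})" "\<And>t. t \<in> {p..q} \<Longrightarrow> norm (h t) \<le> B"
  shows "h absolutely_integrable_on {p..q}"
  by (rule measurable_bounded_by_integrable_imp_absolutely_integrable[where g="\<lambda>_. B"])
    (use assms in auto)

lemma is_primitive_abs_integrable:
  "is_primitive p q u h \<Longrightarrow> h absolutely_integrable_on {p..q}"
  unfolding is_primitive_def by (auto intro: abs_integrable_bounded_measurable)

lemma is_primitive_lipschitz:
  assumes "is_primitive p q u h"
  obtains B where "B \<ge> 0" "\<And>t. t \<in> {p..q} \<Longrightarrow> norm (h t) \<le> B"
    "\<And>x y. p \<le> x \<Longrightarrow> x \<le> y \<Longrightarrow> y \<le> q \<Longrightarrow> norm (u y - u x) \<le> B * (y - x)"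
proof -
  obtain B where B: "\<And>t. t \<in> {p..q} \<Longrightarrow> norm (h t) \<le> B"
    using assms unfolding is_primitive_def by blast
  have B': "\<And>t. t \<in> {p..q} \<Longrightarrow> norm (h t) \<le> max B 0" using B by fastforce
  show ?thesis
  proof (rule that[of "max B 0"])
    fix x y assume xy: "p \<le> x" "x \<le> y" "y \<le> q"
    have "(h has_integral (u y - u x)) {x..y}" using assms xy unfolding is_primitive_def by blast
    then have "norm (u y - u x) \<le> max B 0 * Henstock_Kurzweil_Integration.content {x..y}"
      using B' xy by (intro has_integral_bound_real[where S="{}" and f=h]) auto
    then show "norm (u y - u x) \<le> max B 0 * (y - x)" using xy by simp
  qed (use B' in auto)
qed

lemma is_primitive_continuous_on:
  assumes "is_primitive p q u h"
  shows "continuous_on {p..q} u"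
proof -
  obtain B where B: "B \<ge> 0" "\<And>x y. p \<le> x \<Longrightarrow> x \<le> y \<Longrightarrow> y \<le> q \<Longrightarrow> norm (u y - u x) \<le> B * (y - x)"
    using is_primitive_lipschitz[OF assms] by metis
  have "B-lipschitz_on {p..q} u"
  proof (rule lipschitz_onI[OF _ B(1)])
    fix x y assume "x \<in> {p..q}" "y \<in> {p..q}"
    then show "dist (u x) (u y) \<le> B * dist x y"
      using B(2)[of x y] B(2)[of y x] by (cases "x \<le> y") (auto simp: dist_norm norm_minus_commute)
  qed
  then show ?thesis by (rule lipschitz_on_continuous_on)
qed

lemma is_primitive_cong:
  assumes "is_primitive p q u h" "\<And>t. t \<in> {p..q} \<Longrightarrow> u t = u' t" "\<And>t. t \<in> {p..q} \<Longrightarrow> h t = h' t"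
  shows "is_primitive p q u' h'"
proof -
  have "h' \<in> borel_measurable (lebesgue_on {p..q})"
    using assms unfolding is_primitive_def by (subst measurable_cong[where g=h]) auto
  moreover have "(h' has_integral (u' y - u' x)) {x..y}" if "p \<le> x" "x \<le> y" "y \<le> q" for x y
  proof -
    have "(h has_integral (u' y - u' x)) {x..y}"
      using assms that unfolding is_primitive_def by (metis atLeastAtMost_iff order_trans)
    then show ?thesis by (rule has_integral_eq[rotated]) (use assms that in auto)
  qed
  ultimately show ?thesis using assms unfolding is_primitive_def by force
qed

text \<open>The derivative matters only up to null sets, so it may be replaced by any bounded representative.\<close>

lemma is_primitive_spike:
  assumes "is_primitive p q u h" "negligible S" "\<And>t. t \<in> {p..q} - S \<Longrightarrow> h t = h' t"
    and "\<And>t. t \<in> {p..q} \<Longrightarrow> norm (h' t) \<le> B"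
  shows "is_primitive p q u h'"
proof -
  have 1: "h' absolutely_integrable_on {p..q}"
    by (rule absolutely_integrable_spike[OF is_primitive_abs_integrable[OF assms(1)] assms(2)])
      (use assms in auto)
  have "(h' has_integral (u y - u x)) {x..y}" if "p \<le> x" "x \<le> y" "y \<le> q" for x y
  proof -
    have "(h has_integral (u y - u x)) {x..y}"
      using assms that unfolding is_primitive_def by blast
    then show ?thesis by (rule has_integral_spike[OF assms(2), rotated]) (use assms that in auto)
  qed
  moreover have "h' \<in> borel_measurable (lebesgue_on {p..q})"
    by (rule absolutely_integrable_imp_borel_measurable[OF 1]) auto
  ultimately show ?thesis using assms(4) unfolding is_primitive_def by blast
qed

lemma is_primitive_classical:
  assumes "\<And>t. t \<in> {p..q} \<Longrightarrow> (u has_vector_derivative h t) (at t within {p..q})"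
    and "continuous_on {p..q} h"
  shows "is_primitive p q u h"
proof -
  have "bounded (h ` {p..q})"
    using assms(2) by (intro compact_imp_bounded compact_continuous_image) auto
  moreover have "h \<in> borel_measurable (lebesgue_on {p..q})"
    by (rule continuous_imp_measurable_on_sets_lebesgue[OF assms(2)]) auto
  moreover have "(h has_integral (u y - u x)) {x..y}" if "p \<le> x" "x \<le> y" "y \<le> q" for x y
    by (rule fundamental_theorem_of_calculus)
      (use that assms in \<open>auto intro!: has_vector_derivative_within_subset[OF assms(1)]\<close>)
  ultimately show ?thesis unfolding is_primitive_def by (auto simp: bounded_iff)
qed

lemma is_primitive_has_vector_derivative:
  assumes "is_primitive p q u h" "continuous_on {p..q} h" "x \<in> {p..q}"
  shows "(u has_vector_derivative h x) (at x within {p..q})"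
proof -
  have *: "((\<lambda>y. u p + integral {p..y} h) has_vector_derivative h x) (at x within {p..q})"
    using integral_has_vector_derivative[OF assms(2,3)] by (auto intro!: derivative_eq_intros)
  have eq: "u y = u p + integral {p..y} h" if "y \<in> {p..q}" for y
  proof -
    have "(h has_integral (u y - u p)) {p..y}" using assms(1) that unfolding is_primitive_def by auto
    then show ?thesis by (simp add: integral_unique)
  qed
  show ?thesis by (rule has_vector_derivative_transform[OF assms(3) eq *])
qed

lemma is_primitive_has_vector_derivative_at:
  assumes "is_primitive p q u h" "continuous_on {p..q} h" "x \<in> {p<..<q}"
  shows "(u has_vector_derivative h x) (at x)"
proof -
  have "(u has_vector_derivative h x) (at x within {p..q})"
    using assms by (intro is_primitive_has_vector_derivative) auto
  then have "(u has_vector_derivative h x) (at x within {p<..<q})"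
    by (rule has_vector_derivative_within_subset) auto
  then show ?thesis using has_vector_derivative_within_open[OF assms(3) open_greaterThanLessThan] by blast
qed

lemma is_primitive_const: "is_primitive p q (\<lambda>_. c) (\<lambda>_. 0)"
  by (rule is_primitive_classical) auto

lemma is_primitive_add:
  assumes "is_primitive p q u h" "is_primitive p q v k"
  shows "is_primitive p q (\<lambda>t. u t + v t) (\<lambda>t. h t + k t)"
proof -
  obtain B1 B2 where B: "\<And>t. t \<in> {p..q} \<Longrightarrow> norm (h t) \<le> B1" "\<And>t. t \<in> {p..q} \<Longrightarrow> norm (k t) \<le> B2"
    using assms unfolding is_primitive_def by meson
  have "\<forall>t\<in>{p..q}. norm (h t + k t) \<le> B1 + B2" using B by (meson norm_triangle_mono)
  moreover have "((\<lambda>t. h t + k t) has_integral (u y + v y - (u x + v x))) {x..y}"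
    if "p \<le> x" "x \<le> y" "y \<le> q" for x y
  proof -
    have "((\<lambda>t. h t + k t) has_integral ((u y - u x) + (v y - v x))) {x..y}"
      using assms that unfolding is_primitive_def by (intro has_integral_add) auto
    then show ?thesis by (simp add: algebra_simps)
  qed
  moreover have "(\<lambda>t. h t + k t) \<in> borel_measurable (lebesgue_on {p..q})"
    using assms unfolding is_primitive_def by (intro borel_measurable_add) blast+
  ultimately show ?thesis unfolding is_primitive_def by blast
qed

text \<open>Quadratically small increments force a vanishing derivative. This replaces differentiation almost
  everywhere in the product rule below.\<close>

lemma constant_if_quadratic_increments:
  fixes F :: "real \<Rightarrow> complex"
  assumes "\<And>x y. p \<le> x \<Longrightarrow> x \<le> y \<Longrightarrow> y \<le> q \<Longrightarrow> norm (F y - F x) \<le> C * (y - x)\<^sup>2"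
    and "x \<in> {p..q}" "y \<in> {p..q}"
  shows "F x = F y"
proof -
  have "(F has_derivative (\<lambda>h. 0)) (at x within {p..q})" if x: "x \<in> {p..q}" for x
    unfolding has_derivative_within
  proof (intro conjI)
    have *: "norm (F y - F x) \<le> C * (y - x)\<^sup>2" if "y \<in> {p..q}" for y
      using assms(1)[of x y] assms(1)[of y x] x that
      by (cases "x \<le> y") (auto simp: norm_minus_commute power2_commute)
    have "((\<lambda>y. C * \<bar>y - x\<bar>) \<longlongrightarrow> C * \<bar>x - x\<bar>) (at x within {p..q})"
      by (intro tendsto_intros)
    then have lim: "((\<lambda>y. C * \<bar>y - x\<bar>) \<longlongrightarrow> 0) (at x within {p..q})" by simp
    show "((\<lambda>y. (1 / norm (y - x)) *\<^sub>R (F y - (F x + 0))) \<longlongrightarrow> 0) (at x within {p..q})"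
    proof (rule Lim_null_comparison[OF _ lim])
      show "\<forall>\<^sub>F y in at x within {p..q}. norm ((1 / norm (y - x)) *\<^sub>R (F y - (F x + 0))) \<le> C * \<bar>y - x\<bar>"
        unfolding eventually_at_filter
      proof (intro always_eventually allI impI)
        fix y assume "y \<noteq> x" "y \<in> {p..q}"
        then have "norm (F y - F x) \<le> C * (y - x)\<^sup>2" by (intro *)
        then have "norm (F y - F x) \<le> C * \<bar>y - x\<bar> * \<bar>y - x\<bar>"
          by (simp only: power2_eq_square mult.assoc abs_mult_self_eq)
        then have "norm (F y - F x) / \<bar>y - x\<bar> \<le> C * \<bar>y - x\<bar>"
          using \<open>y \<noteq> x\<close> by (subst pos_divide_le_eq) auto
        then show "norm ((1 / norm (y - x)) *\<^sub>R (F y - (F x + 0))) \<le> C * \<bar>y - x\<bar>"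
          by (simp add: divide_inverse mult.commute del: scaleR_right_diff_distrib)
      qed
    qed
  qed auto
  then obtain c where "\<And>x. x \<in> {p..q} \<Longrightarrow> F x = c"
    using has_derivative_zero_constant[of "{p..q}" F] by auto
  then show ?thesis using assms by simp
qed

text \<open>The increments of \<open>u v\<close> and of the integral of the candidate derivative differ by a quadratic error, since
  \<open>u\<close> and \<open>v\<close> are Lipschitz; as both are additive over adjacent intervals, they coincide.\<close>

lemma is_primitive_mult:
  assumes "is_primitive p q u h" "is_primitive p q v k"
  shows "is_primitive p q (\<lambda>t. u t * v t) (\<lambda>t. h t * v t + u t * k t)"
proof (cases "p \<le> q")
  case False
  then have "{p..q} = {}" by simp
  then show ?thesis unfolding is_primitive_def using False by (auto simp: measurable_def space_restrict_space)
next
  case True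
  let ?w = "\<lambda>t. h t * v t + u t * k t"
  obtain B1 where B1: "B1 \<ge> 0" "\<And>t. t \<in> {p..q} \<Longrightarrow> norm (h t) \<le> B1"
    "\<And>x y. p \<le> x \<Longrightarrow> x \<le> y \<Longrightarrow> y \<le> q \<Longrightarrow> norm (u y - u x) \<le> B1 * (y - x)"
    using is_primitive_lipschitz[OF assms(1)] by metis
  obtain B2 where B2: "B2 \<ge> 0" "\<And>t. t \<in> {p..q} \<Longrightarrow> norm (k t) \<le> B2"
    "\<And>x y. p \<le> x \<Longrightarrow> x \<le> y \<Longrightarrow> y \<le> q \<Longrightarrow> norm (v y - v x) \<le> B2 * (y - x)"
    using is_primitive_lipschitz[OF assms(2)] by metis
  have cu: "continuous_on {p..q} u" and cv: "continuous_on {p..q} v"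
    using assms is_primitive_continuous_on by blast+
  obtain U where U: "\<And>t. t \<in> {p..q} \<Longrightarrow> norm (u t) \<le> U"
    using compact_imp_bounded[OF compact_continuous_image[OF cu compact_Icc]] by (meson bounded_iff imageI)
  obtain W where W: "\<And>t. t \<in> {p..q} \<Longrightarrow> norm (v t) \<le> W"
    using compact_imp_bounded[OF compact_continuous_image[OF cv compact_Icc]] by (meson bounded_iff imageI)
  have mu: "u \<in> borel_measurable (lebesgue_on {p..q})" "v \<in> borel_measurable (lebesgue_on {p..q})"
    using cu cv by (auto intro: continuous_imp_measurable_on_sets_lebesgue)
  have mw: "?w \<in> borel_measurable (lebesgue_on {p..q})"
    using assms mu unfolding is_primitive_def by (intro borel_measurable_add borel_measurable_times) blast+
  have bw: "norm (?w t) \<le> B1 * W + U * B2" if "t \<in> {p..q}" for t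
  proof (intro norm_triangle_mono)
    show "norm (h t * v t) \<le> B1 * W"
      unfolding norm_mult by (intro mult_mono B1 W that norm_ge_zero)
    have "0 \<le> U" using order_trans[OF norm_ge_zero U[OF that]] .
    then show "norm (u t * k t) \<le> U * B2"
      unfolding norm_mult by (intro mult_mono B2 U that norm_ge_zero)
  qed
  have iw: "?w integrable_on {x..y}" if "p \<le> x" "y \<le> q" for x y
  proof -
    have "?w integrable_on {p..q}"
      using abs_integrable_bounded_measurable[OF mw bw] unfolding absolutely_integrable_on_def by blast
    then show ?thesis by (rule integrable_subinterval_real) (use that in auto)
  qed
  \<comment> \<open>The difference is the integral of \<open>h t (v y - v t) + (u x - u t) k t\<close>, small of second order.\<close>
  have inc: "norm ((u y * v y - u x * v x) - integral {x..y} ?w) \<le> (2 * B1 * B2) * (y - x)\<^sup>2"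
    if "p \<le> x" "x \<le> y" "y \<le> q" for x y
  proof -
    have ih: "(h has_integral (u y - u x)) {x..y}" and ik: "(k has_integral (v y - v x)) {x..y}"
      using assms that unfolding is_primitive_def by auto
    have "((\<lambda>t. (h t * v y + u x * k t) - ?w t) has_integral
       (((u y - u x) * v y + u x * (v y - v x)) - integral {x..y} ?w)) {x..y}"
      by (intro has_integral_diff has_integral_add has_integral_mult_left has_integral_mult_right ih ik
          integrable_integral iw that)
    then have I: "((\<lambda>t. h t * (v y - v t) + (u x - u t) * k t) has_integral
       ((u y * v y - u x * v x) - integral {x..y} ?w)) {x..y}"
      by (simp add: algebra_simps)
    have "norm ((u y * v y - u x * v x) - integral {x..y} ?w) \<le> (2 * B1 * B2 * (y - x)) * Henstock_Kurzweil_Integration.content {x..y}"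
    proof (rule has_integral_bound_real[where S="{}", OF _ _ I])
      fix t assume "t \<in> {x..y} - {}"
      then have t: "t \<in> {x..y}" by simp
      have "norm (h t * (v y - v t) + (u x - u t) * k t) \<le> B1 * (B2 * (y - x)) + (B1 * (y - x)) * B2"
      proof (intro norm_triangle_mono)
        have "B2 * (y - t) \<le> B2 * (y - x)" using B2(1) t by (intro mult_left_mono) auto
        then have "norm (v y - v t) \<le> B2 * (y - x)" using B2(3)[of t y] t that by force
        then show "norm (h t * (v y - v t)) \<le> B1 * (B2 * (y - x))"
          unfolding norm_mult using B1 t that by (intro mult_mono) auto
        have "B1 * (t - x) \<le> B1 * (y - x)" using B1(1) t by (intro mult_left_mono) auto
        then have "norm (u x - u t) \<le> B1 * (y - x)"
          using B1(3)[of x t] t that by (force simp: norm_minus_commute)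
        then show "norm ((u x - u t) * k t) \<le> B1 * (y - x) * B2"
          unfolding norm_mult using B2 B1(1) t that by (intro mult_mono) auto
      qed
      then show "norm (h t * (v y - v t) + (u x - u t) * k t) \<le> 2 * B1 * B2 * (y - x)"
        by (simp add: algebra_simps)
    qed (use B1(1) B2(1) that in auto)
    then show ?thesis using that by (simp add: power2_eq_square)
  qed
  define F where "F = (\<lambda>y. u y * v y - integral {p..y} ?w)"
  have F: "F y - F x = (u y * v y - u x * v x) - integral {x..y} ?w"
    if "p \<le> x" "x \<le> y" "y \<le> q" for x y
    using Henstock_Kurzweil_Integration.integral_combine[OF that(1,2), of ?w] iw[of p y] that
    by (simp add: F_def algebra_simps)
  have "F x = F y" if "x \<in> {p..q}" "y \<in> {p..q}" for x y
    by (rule constant_if_quadratic_increments[OF _ that, where C="2 * B1 * B2"]) (simp add: F inc)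
  then have eq: "u y * v y - u x * v x = integral {x..y} ?w" if "p \<le> x" "x \<le> y" "y \<le> q" for x y
  proof -
    have "F x = F y" using that by (intro \<open>\<And>y x. \<lbrakk>x \<in> {p..q}; y \<in> {p..q}\<rbrakk> \<Longrightarrow> F x = F y\<close>) auto
    then show ?thesis using F[OF that] by simp
  qed
  show ?thesis unfolding is_primitive_def
  proof (intro conjI allI impI mw)
    show "\<exists>B. \<forall>t\<in>{p..q}. norm (?w t) \<le> B" using bw by blast
    show "(?w has_integral (u y * v y - u x * v x)) {x..y}" if "p \<le> x" "x \<le> y" "y \<le> q" for x y
      unfolding has_integral_iff using eq[OF that] iw[of x y] that by simp
  qed
qed

lemma is_primitive_sum:
  assumes "\<And>i. i \<in> I \<Longrightarrow> is_primitive p q (u i) (h i)"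
  shows "is_primitive p q (\<lambda>t. \<Sum>i\<in>I. u i t) (\<lambda>t. \<Sum>i\<in>I. h i t)"
  using assms by (induction I rule: infinite_finite_induct)
    (auto intro: is_primitive_const is_primitive_add)

section \<open>The fundamental lemma and the lemma of du Bois-Reymond\<close>

lemma continuous_support_times_locally_integrable:
  fixes \<phi> :: "real \<Rightarrow> real" and u :: "real \<Rightarrow> complex"
  assumes "continuous_on UNIV \<phi>" "0 < p" "\<forall>x. x \<notin> {p..q} \<longrightarrow> \<phi> x = 0" "locally_integrable {0<..} u"
  shows "set_integrable lebesgue {0<..} (\<lambda>x. \<phi> x *\<^sub>R u x)"
    and "(LINT x:{0<..}|lebesgue. \<phi> x *\<^sub>R u x) = (LINT x:{p..q}|lebesgue. \<phi> x *\<^sub>R u x)"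
proof -
  have eq: "(\<lambda>x. indicator {0<..} x *\<^sub>R \<phi> x *\<^sub>R u x) = (\<lambda>x. \<phi> x *\<^sub>R (indicator {p..q} x *\<^sub>R u x))"
    using assms(2,3) by (auto simp: fun_eq_iff indicator_def)
  have iu: "integrable lebesgue (\<lambda>x. indicator {p..q} x *\<^sub>R u x)"
    using assms(2,4) unfolding locally_integrable_def set_integrable_def
    by (elim allE[of _ "{p..q}"]) auto
  have "bounded (\<phi> ` {p..q})"
    by (intro compact_imp_bounded compact_continuous_image continuous_on_subset[OF assms(1)]) auto
  then obtain B where B: "\<And>x. x \<in> {p..q} \<Longrightarrow> \<bar>\<phi> x\<bar> \<le> B"
    unfolding bounded_iff real_norm_def by blast
  have \<phi>m: "\<phi> \<in> borel_measurable lebesgue"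
    using borel_measurable_continuous_onI[OF assms(1)] by (simp add: measurable_completion)
  have "integrable lebesgue (\<lambda>x. \<phi> x *\<^sub>R (indicator {p..q} x *\<^sub>R u x))"
  proof (rule Bochner_Integration.integrable_bound[where f="\<lambda>x. B *\<^sub>R (indicator {p..q} x *\<^sub>R u x)"])
    show "AE x in lebesgue. norm (\<phi> x *\<^sub>R indicat_real {p..q} x *\<^sub>R u x)
        \<le> norm (B *\<^sub>R indicat_real {p..q} x *\<^sub>R u x)"
      using B by (intro AE_I2) (force simp: indicator_def intro!: mult_right_mono)
  qed (use iu \<phi>m in \<open>auto simp del: scaleR_scaleR
      intro!: borel_measurable_scaleR borel_measurable_integrable integrable_scaleR_right\<close>)
  then show "set_integrable lebesgue {0<..} (\<lambda>x. \<phi> x *\<^sub>R u x)"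
    unfolding set_integrable_def eq .
  show "(LINT x:{0<..}|lebesgue. \<phi> x *\<^sub>R u x) = (LINT x:{p..q}|lebesgue. \<phi> x *\<^sub>R u x)"
    unfolding set_lebesgue_integral_def eq by (intro Bochner_Integration.integral_cong) auto
qed

lemma times_differentiable_continuous_on:
  "times_differentiable k f \<Longrightarrow> continuous_on S f"
  by (intro continuous_at_imp_continuous_on ballI DERIV_isCont[OF times_differentiable_DERIV])

lemma sigma_finite_lebesgue: "sigma_finite_measure (lebesgue :: 'a::euclidean_space measure)"
proof
  let ?A = "range (\<lambda>n. cball (0::'a) (real n))"
  have "\<exists>n. x \<in> cball (0::'a) (real n)" for x
    using real_arch_simple[of "norm x"] by (auto simp: dist_norm)
  then have "\<Union>?A = UNIV" by blast
  moreover have "cball (0::'a) (real n) \<in> lmeasurable" for n by simp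
  then have "emeasure lebesgue (cball (0::'a) (real n)) \<noteq> \<infinity>" for n
    unfolding fmeasurable_def by (metis (no_types, lifting) mem_Collect_eq order_less_irrefl infinity_ennreal_def)
  ultimately show "\<exists>A. countable A \<and> A \<subseteq> sets lebesgue \<and> \<Union>A = space (lebesgue :: 'a measure)
      \<and> (\<forall>a\<in>A. emeasure lebesgue a \<noteq> \<infinity>)"
    by (intro exI[of _ ?A]) auto
qed

text \<open>Open intervals generate the Borel sets and are stable under intersection, so the integral of \<open>v\<close> vanishes
  over all Borel sets, and then over all Lebesgue sets, which differ from Borel sets by null sets.\<close>

lemma AE_zero_if_interval_integrals_zero:
  fixes v :: "real \<Rightarrow> complex"
  assumes v: "integrable lebesgue v"
    and zero: "\<And>a b. a < b \<Longrightarrow> (LINT x:{a<..<b}|lebesgue. v x) = 0" and z0: "(LINT x|lebesgue. v x) = 0"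
  shows "AE x in lebesgue. v x = 0"
proof (rule sigma_finite_measure.density_zero[OF sigma_finite_lebesgue v])
  have si: "set_integrable lebesgue A v" if "A \<in> sets lebesgue" for A
    unfolding set_integrable_def using v that by (rule integrable_mult_indicator[rotated])
  have borel_zero: "(LINT x:A|lebesgue. v x) = 0" if "A \<in> sets borel" for A
  proof -
    let ?G = "range (\<lambda>(a, b). {a<..<b::real})"
    have gen: "sets borel = sigma_sets UNIV ?G"
      using borel_eq_box[where 'a=real] by (simp add: box_real) (metis sets_measure_of subset_UNIV Pow_UNIV)
    have "Int_stable ?G"
      unfolding Int_stable_def by (auto simp: image_iff split: prod.splits)
    moreover have "?G \<subseteq> Pow UNIV" by simp
    moreover have "A \<in> sigma_sets UNIV ?G" using that gen by simp
    ultimately show ?thesis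
    proof (induction rule: sigma_sets_induct_disjoint)
      case (basic A)
      then obtain a b where "A = {a<..<b}" by auto
      then show ?case using zero[of a b] by (cases "a < b") (auto simp: set_lebesgue_integral_def)
    next
      case empty
      then show ?case by (simp add: set_lebesgue_integral_def)
    next
      case (compl A)
      have A: "A \<in> sets lebesgue" using compl(1) gen by auto
      have A': "UNIV - A \<in> sets lebesgue" using sets.compl_sets[OF A] by simp
      have "(LINT x|lebesgue. v x) = (LINT x:UNIV - A|lebesgue. v x) + (LINT x:A|lebesgue. v x)"
      proof -
        have "(LINT x:(UNIV - A) \<union> A|lebesgue. v x)
            = (LINT x:UNIV - A|lebesgue. v x) + (LINT x:A|lebesgue. v x)"
          by (rule set_integral_Un) (use si[OF A] si[OF A'] in auto)
        moreover have "(UNIV - A) \<union> A = UNIV" by auto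
        ultimately show ?thesis by (simp add: set_lebesgue_integral_def)
      qed
      then show ?case using compl z0 by simp
    next
      case (union A)
      have "A i \<in> sets borel" for i using union(2) gen by blast
      then have A: "A i \<in> sets lebesgue" for i by simp
      have "(LINT x:(\<Union>i. A i)|lebesgue. v x) = (\<Sum>i. (LINT x:(A i)|lebesgue. v x))"
        by (rule lebesgue_integral_countable_add)
          (use A union(1) in \<open>auto simp: disjoint_family_on_def intro!: si\<close>)
      then show ?case using union by simp
    qed
  qed
  fix A assume "A \<in> sets (lebesgue :: real measure)"
  then obtain S N N' where SN: "A = S \<union> N" "N \<subseteq> N'" "N' \<in> null_sets lborel" "S \<in> sets lborel"
    by (auto elim: sets_completionE)
  have "AE x in lebesgue. x \<notin> N'"
    using SN(3) by (intro AE_not_in) (auto intro: null_sets_completionI)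
  then have ae: "AE x in lebesgue. indicator A x *\<^sub>R v x = indicator S x *\<^sub>R v x"
    by (rule AE_mp) (use SN in \<open>auto intro!: AE_I2 simp: indicator_def\<close>)
  have "S \<in> sets lebesgue" using SN(4) by (rule sets_completionI_sets)
  then have "(LINT x:A|lebesgue. v x) = (LINT x:S|lebesgue. v x)"
    unfolding set_lebesgue_integral_def
    using si[OF \<open>A \<in> sets lebesgue\<close>] si[of S] unfolding set_integrable_def
    by (intro integral_cong_AE ae borel_measurable_integrable)
  then show "(LINT x:A|lebesgue. v x) = 0" using borel_zero SN(4) by simp
qed

text \<open>The fundamental lemma of the calculus of variations: bumps converge boundedly to indicators of intervals, so
  the integrals of \<open>u\<close> over all compactly contained intervals vanish.\<close>

lemma AE_zero_if_test_integrals_zero: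
  assumes u: "locally_integrable {0<..} u"
    and zero: "\<And>\<phi>. test_function {0<..} \<phi> \<Longrightarrow> (LINT x:{0<..}|lebesgue. \<phi> x *\<^sub>R u x) = 0"
  shows "AE x in lebesgue. x > 0 \<longrightarrow> u x = 0"
proof -
  have iu: "integrable lebesgue (\<lambda>x. indicator {p..q} x *\<^sub>R u x)" if "0 < p" for p q
    using u that unfolding locally_integrable_def set_integrable_def
    by (elim allE[of _ "{p..q}"]) auto
  have zero': "(LINT x:{p<..<q}|lebesgue. u x) = 0" if p: "0 < p" for p q
  proof -
    let ?v = "\<lambda>x. indicator {p..q} x *\<^sub>R u x"
    let ?b = "\<lambda>n. bump p q (real (Suc n))"
    have bm: "?b n \<in> borel_measurable lebesgue" for n
      using borel_measurable_continuous_onI[OF times_differentiable_continuous_on[OF times_differentiable_bump]]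
      by (simp add: measurable_completion)
    have iv: "integrable lebesgue ?v" using p by (rule iu)
    have "(\<lambda>n. LINT x|lebesgue. ?b n x *\<^sub>R ?v x) \<longlonglongrightarrow> (LINT x|lebesgue. indicator {p<..<q} x *\<^sub>R ?v x)"
    proof (rule integral_dominated_convergence[where w="\<lambda>x. norm (?v x)"])
      show "AE x in lebesgue. (\<lambda>n. ?b n x *\<^sub>R ?v x) \<longlonglongrightarrow> indicator {p<..<q} x *\<^sub>R ?v x"
        by (intro AE_I2 tendsto_intros bump_tendsto_indicator)
      show "AE x in lebesgue. norm (?b n x *\<^sub>R ?v x) \<le> norm (?v x)" for n
        using bump_range[of p q "real (Suc n)"]
        by (intro AE_I2) (simp add: mult_left_le_one_le mult.assoc del: of_nat_Suc)
      show "integrable lebesgue (\<lambda>x. norm (?v x))" using iv by (rule integrable_norm)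
      show "(\<lambda>x. indicator {p<..<q} x *\<^sub>R ?v x) \<in> borel_measurable lebesgue"
        by (rule borel_measurable_scaleR[OF borel_measurable_indicator borel_measurable_integrable[OF iv]]) simp
      show "(\<lambda>x. ?b n x *\<^sub>R ?v x) \<in> borel_measurable lebesgue" for n
        by (rule borel_measurable_scaleR[OF bm borel_measurable_integrable[OF iv]])
    qed
    moreover have "(LINT x|lebesgue. ?b n x *\<^sub>R ?v x) = 0" for n
    proof -
      have "(LINT x:{0<..}|lebesgue. ?b n x *\<^sub>R u x) = 0"
        by (rule zero[OF test_function_bump]) (use p in auto)
      moreover have "(\<lambda>x. ?b n x *\<^sub>R ?v x) = (\<lambda>x. indicator {0<..} x *\<^sub>R ?b n x *\<^sub>R u x)"
      proof (rule ext)
        fix x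
        show "?b n x *\<^sub>R ?v x = indicator {0<..} x *\<^sub>R ?b n x *\<^sub>R u x"
          using p bump_eq_0[of x p q "real (Suc n)"] by (cases "x \<in> {p<..<q}") (auto simp: indicator_def)
      qed
      ultimately show ?thesis by (simp add: set_lebesgue_integral_def)
    qed
    moreover have "(\<lambda>x. indicator {p<..<q} x *\<^sub>R ?v x) = (\<lambda>x. indicator {p<..<q} x *\<^sub>R u x)"
      by (auto simp: indicator_def)
    ultimately show ?thesis by (simp add: set_lebesgue_integral_def LIMSEQ_const_iff)
  qed
  have "AE x in lebesgue. indicator {1 / real (Suc k)<..<real (Suc k)} x *\<^sub>R u x = 0" for k
  proof -
    let ?P = "1 / real (Suc k)" let ?Q = "real (Suc k)"
    let ?v = "\<lambda>x. indicator {?P<..<?Q} x *\<^sub>R u x"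
    have "integrable lebesgue (\<lambda>x. indicator {?P<..<?Q} x *\<^sub>R (indicator {?P..?Q} x *\<^sub>R u x))"
      by (rule integrable_mult_indicator[OF _ iu]) auto
    moreover have "(\<lambda>x. indicator {?P<..<?Q} x *\<^sub>R (indicator {?P..?Q} x *\<^sub>R u x)) = ?v"
      by (auto simp: indicator_def)
    ultimately have "integrable lebesgue ?v" by simp
    then show ?thesis
    proof (rule AE_zero_if_interval_integrals_zero)
      fix a b :: real
      have "(\<lambda>x. indicator {a<..<b} x *\<^sub>R ?v x) = (\<lambda>x. indicator {max a ?P<..<min b ?Q} x *\<^sub>R u x)"
        by (auto simp: indicator_def)
      then show "(LINT x:{a<..<b}|lebesgue. ?v x) = 0"
        using zero'[of "max a ?P" "min b ?Q"] by (simp add: set_lebesgue_integral_def less_max_iff_disj)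
    next
      show "(LINT x|lebesgue. ?v x) = 0" using zero'[of ?P ?Q] by (simp add: set_lebesgue_integral_def)
    qed
  qed
  then have "AE x in lebesgue. \<forall>k. indicator {1 / real (Suc k)<..<real (Suc k)} x *\<^sub>R u x = 0"
    unfolding AE_all_countable by blast
  then show ?thesis
  proof (rule AE_mp, intro AE_I2 impI)
    fix x :: real assume *: "\<forall>k. indicator {1 / real (Suc k)<..<real (Suc k)} x *\<^sub>R u x = 0" and x: "x > 0"
    obtain k :: nat where k: "real k > max x (1 / x)" using reals_Archimedean2 by blast
    then have "1 < real k * x" using x by (auto simp: field_simps)
    also have "\<dots> \<le> real (Suc k) * x" using x by (simp add: mult_right_mono)
    finally have "x \<in> {1 / real (Suc k)<..<real (Suc k)}" using k x by (auto simp: field_simps)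
    then show "u x = 0" using spec[OF *, of k] by simp
  qed
qed

lemma is_primitive_imp_locally_integrable:
  assumes "\<And>p q. 0 < p \<Longrightarrow> is_primitive p q H h"
  shows "locally_integrable {0<..} H" "locally_integrable {0<..} h"
proof -
  have *: "\<exists>p q. 0 < p \<and> K \<subseteq> {p..q}" if K: "compact K" "K \<subseteq> {0<..}" for K :: "real set"
  proof (cases "K = {}")
    case False
    obtain m M where "m \<in> K" "\<And>t. t \<in> K \<Longrightarrow> m \<le> t" "\<And>t. t \<in> K \<Longrightarrow> t \<le> M"
      using compact_attains_inf[OF K(1) False] compact_attains_sup[OF K(1) False] by blast
    then show ?thesis using K(2) by (intro exI[of _ m] exI[of _ M]) auto
  qed (auto intro: exI[of _ 1])
  have "set_integrable lebesgue {p..q} h" if "0 < p" for p q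
    using is_primitive_abs_integrable[OF assms[OF that]] .
  then show "locally_integrable {0<..} h"
    unfolding locally_integrable_def using *
    by (meson fmeasurableD lmeasurable_compact set_integrable_subset)
  have "set_integrable lebesgue {p..q} H" if "0 < p" for p q
    by (rule absolutely_integrable_continuous_real[OF is_primitive_continuous_on[OF assms[OF that]]])
  then show "locally_integrable {0<..} H"
    unfolding locally_integrable_def using *
    by (meson fmeasurableD lmeasurable_compact set_integrable_subset)
qed

lemma is_primitive_of_real_test:
  assumes "test_function {0<..} \<phi>"
  shows "is_primitive p q (\<lambda>x. of_real (\<phi> x)) (\<lambda>x. of_real (deriv \<phi> x))"
proof (rule is_primitive_classical)
  note D = test_functionD(1)[OF assms]
  show "((\<lambda>x. complex_of_real (\<phi> x)) has_vector_derivative of_real (deriv \<phi> t)) (at t within {p..q})" for t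
  proof -
    have "(\<phi> has_field_derivative deriv \<phi> t) (at t within {p..q})"
      using has_field_derivative_at_within times_differentiable_DERIV[OF D[of 0], of t] by blast
    then show ?thesis by (rule has_vector_derivative_of_real)
  qed
  have "times_differentiable 0 (deriv \<phi>)" using D[of 1] by simp
  then show "continuous_on {p..q} (\<lambda>x. complex_of_real (deriv \<phi> x))"
    by (intro continuous_on_of_real times_differentiable_continuous_on)
qed

lemma is_primitive_integral:
  assumes "is_primitive p q u h" "p \<le> q"
  shows "(LINT x:{p..q}|lebesgue. h x) = u q - u p"
proof -
  have "(h has_integral (u q - u p)) {p..q}" using assms unfolding is_primitive_def by blast
  then show ?thesis
    using set_lebesgue_integral_eq_integral(2)[OF is_primitive_abs_integrable[OF assms(1)]]
    by (simp add: integral_unique)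
qed

text \<open>The product rule applied to \<open>\<phi> H\<close>, which vanishes at both ends of the support of \<open>\<phi>\<close>.\<close>

lemma integration_by_parts_test_function:
  assumes H: "\<And>p q. 0 < p \<Longrightarrow> is_primitive p q H h" and \<phi>: "test_function {0<..} \<phi>"
  shows "(LINT x:{0<..}|lebesgue. deriv \<phi> x *\<^sub>R H x) = - (LINT x:{0<..}|lebesgue. \<phi> x *\<^sub>R h x)"
proof -
  note D = test_functionD[OF \<phi>]
  obtain p q where pq: "0 < p" "p < q" "\<And>k x. x \<notin> {p<..<q} \<Longrightarrow> (deriv ^^ k) \<phi> x = 0"
    using D(2) by blast
  have z: "\<phi> x = 0" "deriv \<phi> x = 0" if "x \<notin> {p<..<q}" for x
    using pq(3)[OF that, of 0] pq(3)[OF that, of 1] by auto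
  have z': "\<forall>x. x \<notin> {p..q} \<longrightarrow> \<phi> x = 0" "\<forall>x. x \<notin> {p..q} \<longrightarrow> deriv \<phi> x = 0"
    by (auto intro!: z)
  have cont: "continuous_on UNIV \<phi>" "continuous_on UNIV (deriv \<phi>)"
    using times_differentiable_continuous_on[OF D(1)[of 0]]
      times_differentiable_continuous_on[of 0 "deriv \<phi>"] D(1)[of 1] by auto
  have li: "locally_integrable {0<..} H" "locally_integrable {0<..} h"
    using is_primitive_imp_locally_integrable H by blast+
  note i1 = continuous_support_times_locally_integrable[OF cont(2) pq(1) z'(2) li(1)]
  note i2 = continuous_support_times_locally_integrable[OF cont(1) pq(1) z'(1) li(2)]
  have "(LINT x:{p..q}|lebesgue. of_real (deriv \<phi> x) * H x + of_real (\<phi> x) * h x) = 0"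
    using is_primitive_integral[OF is_primitive_mult[OF is_primitive_of_real_test[OF \<phi>] H[OF pq(1)]], of q] pq z
    by simp
  moreover have "set_integrable lebesgue {p..q} (\<lambda>x. deriv \<phi> x *\<^sub>R H x)"
    "set_integrable lebesgue {p..q} (\<lambda>x. \<phi> x *\<^sub>R h x)"
    by (rule set_integrable_subset[OF i1(1)] set_integrable_subset[OF i2(1)]; use pq in auto)+
  ultimately have "(LINT x:{p..q}|lebesgue. deriv \<phi> x *\<^sub>R H x) + (LINT x:{p..q}|lebesgue. \<phi> x *\<^sub>R h x) = 0"
    by (subst set_integral_add(2)[symmetric]) (auto simp: scaleR_conv_of_real)
  then show ?thesis unfolding i1(2) i2(2) by (simp add: eq_neg_iff_add_eq_0)
qed

text \<open>A smooth function of compact support and total integral zero has an antiderivative of compact support.\<close>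

lemma test_function_antiderivative:
  assumes \<eta>: "\<And>k. times_differentiable k \<eta>" and pq: "0 < p" "p < q" "\<forall>x. x \<notin> {p<..<q} \<longrightarrow> \<eta> x = 0"
    and zero: "(LINT x:{p..q}|lebesgue. \<eta> x) = 0"
  obtains \<phi> where "test_function {0<..} \<phi>" "deriv \<phi> = \<eta>"
proof -
  define \<phi> where "\<phi> = (\<lambda>x. LBINT t=ereal p..ereal x. \<eta> t)"
  have cont: "continuous_on S \<eta>" for S by (rule times_differentiable_continuous_on[OF \<eta>])
  have der: "(\<phi> has_field_derivative \<eta> x) (at x)" for x
  proof -
    have "(\<phi> has_vector_derivative \<eta> x) (at x within {min p x - 1..max p x + 1})"
      unfolding \<phi>_def by (rule interval_integral_FTC2[OF _ _ cont]) auto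
    then have "(\<phi> has_vector_derivative \<eta> x) (at x within {min p x - 1<..<max p x + 1})"
      by (rule has_vector_derivative_within_subset) auto
    then have "(\<phi> has_vector_derivative \<eta> x) (at x)"
      by (subst (asm) has_vector_derivative_within_open) auto
    then show ?thesis by (simp add: has_real_derivative_iff_has_vector_derivative)
  qed
  have d: "deriv \<phi> = \<eta>" using der by (auto intro!: ext DERIV_imp_deriv)
  have zout: "\<phi> x = 0" if "x \<notin> {p..q}" for x
  proof (cases "x < p")
    case True
    have "\<phi> x = - (LBINT t=ereal x..ereal p. \<eta> t)"
      unfolding \<phi>_def by (rule interval_integral_endpoints_reverse)
    also have "(LBINT t=ereal x..ereal p. \<eta> t) = (LBINT t=ereal x..ereal p. 0)"
      using True pq by (intro interval_integral_cong) (auto simp: einterval_def)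
    finally show ?thesis by simp
  next
    case False
    then have x: "x > q" using that by auto
    have "\<phi> x = (LBINT t=ereal p..ereal q. \<eta> t) + (LBINT t=ereal q..ereal x. \<eta> t)"
      unfolding \<phi>_def by (rule interval_integral_sum[symmetric])
        (use pq x in \<open>auto simp: min_def max_def intro!: interval_integrable_continuous_on cont\<close>)
    also have "(LBINT t=ereal q..ereal x. \<eta> t) = (LBINT t=ereal q..ereal x. 0)"
      using x pq by (intro interval_integral_cong) (auto simp: einterval_def)
    also have "(LBINT t=ereal p..ereal q. \<eta> t) = integral {p..q} \<eta>"
      using pq by (intro interval_integral_eq_integral borel_integrable_atLeastAtMost' cont) auto
    also have "integral {p..q} \<eta> = (LINT x:{p..q}|lebesgue. \<eta> x)"
      by (rule set_lebesgue_integral_eq_integral(2)[symmetric])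
        (rule absolutely_integrable_continuous_real[OF cont])
    finally show ?thesis using zero by simp
  qed
  have "test_function {0<..} \<phi>"
  proof (rule test_functionI[OF _ pq(1) zout])
    fix k
    show "times_differentiable k \<phi>"
      using times_differentiable_mono[OF times_differentiable_SucI[OF der \<eta>[of k]], of k] by simp
  qed
  then show ?thesis using d that by blast
qed

text \<open>Subtracting from a test function the multiple of a fixed bump that has the same integral leaves a function
  of integral zero, hence the derivative of a test function. So \<open>w\<close> acts on every test function like the constant
  \<open>c\<close> that is its weighted mean against the bump.\<close>

lemma du_bois_reymond_constant:
  assumes w: "locally_integrable {0<..} w"
    and zero: "\<And>\<phi>. test_function {0<..} \<phi> \<Longrightarrow> (LINT x:{0<..}|lebesgue. deriv \<phi> x *\<^sub>R w x) = 0"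
  obtains c where "AE x in lebesgue. x > 0 \<longrightarrow> w x = c"
proof -
  let ?\<beta> = "bump 1 2 1"
  have \<beta>k: "times_differentiable k ?\<beta>" for k by (rule times_differentiable_bump)
  have \<beta>c: "continuous_on S ?\<beta>" for S by (rule times_differentiable_continuous_on[OF \<beta>k])
  have \<beta>0: "?\<beta> x = 0" if "x \<notin> {1<..<2}" for x using bump_eq_0[OF that] by simp
  define I where "I = (LINT x:{0<..}|lebesgue. ?\<beta> x)"
  have Ieq: "I = (LINT x:{p..q}|lebesgue. ?\<beta> x)" if "0 < p" "p \<le> 1" "2 \<le> q" for p q
    unfolding I_def set_lebesgue_integral_def
    by (intro Bochner_Integration.integral_cong) (use that \<beta>0 in \<open>force simp: indicator_def\<close>)+
  have "I \<noteq> 0"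
  proof
    assume "I = 0"
    have "I = integral {1..2} ?\<beta>"
      unfolding Ieq[of 1 2, simplified]
      by (rule set_lebesgue_integral_eq_integral(2)) (rule absolutely_integrable_continuous_real[OF \<beta>c])
    then have "(?\<beta> has_integral 0) (cbox 1 2)"
      using \<open>I = 0\<close> integrable_integral[OF integrable_continuous_real[OF \<beta>c], of 1 2] by simp
    then have "?\<beta> (3/2) = 0"
      by (rule has_integral_0_cbox_imp_0[rotated 2]) (use \<beta>c bump_range in auto)
    then show False using bump_pos[of 1 "3/2" 2 1] by simp
  qed
  define c where "c = (LINT x:{0<..}|lebesgue. ?\<beta> x *\<^sub>R w x) / of_real I"
  have lic: "locally_integrable {0<..} (\<lambda>x. w x - c)"
    using w unfolding locally_integrable_def
    by (auto intro!: set_integral_diff(1) absolutely_integrable_on_const lmeasurable_compact)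
  have "AE x in lebesgue. x > 0 \<longrightarrow> w x - c = 0"
  proof (rule AE_zero_if_test_integrals_zero[OF lic])
    fix \<psi> assume \<psi>: "test_function {0<..} \<psi>"
    note D = test_functionD[OF \<psi>]
    obtain p' q' where pq': "0 < p'" "p' < q'" "\<And>k x. x \<notin> {p'<..<q'} \<Longrightarrow> (deriv ^^ k) \<psi> x = 0"
      using D(2) by blast
    define p where "p = min p' 1" define q where "q = max q' 2"
    have pq: "0 < p" "p < q" "p \<le> 1" "2 \<le> q" using pq' by (auto simp: p_def q_def)
    have \<psi>0: "\<psi> x = 0" if "x \<notin> {p<..<q}" for x
    proof -
      have "x \<notin> {p'<..<q'}" using that by (auto simp: p_def q_def)
      then show ?thesis using pq'(3)[of x 0] by simp
    qed
    have \<psi>c: "continuous_on S \<psi>" for S by (rule times_differentiable_continuous_on[OF D(1)[of 0]])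
    define s where "s = (LINT x:{p..q}|lebesgue. \<psi> x)"
    \<comment> \<open>The multiple of the bump is chosen so that \<open>\<eta>\<close> has integral zero.\<close>
    define \<eta> where "\<eta> = (\<lambda>x. \<psi> x + (- s / I) * ?\<beta> x)"
    have \<eta>k: "times_differentiable k \<eta>" for k
      unfolding \<eta>_def by (intro times_differentiable_add times_differentiable_mult times_differentiable_const D(1) \<beta>k)
    have \<beta>0': "?\<beta> x = 0" if "x \<notin> {p<..<q}" for x using that pq by (intro \<beta>0) auto
    have ai: "set_integrable lebesgue {p..q} \<psi>" "set_integrable lebesgue {p..q} ?\<beta>"
      using absolutely_integrable_continuous_real[OF \<beta>c] absolutely_integrable_continuous_real[OF \<psi>c] by auto
    have "(LINT x:{p..q}|lebesgue. \<eta> x) = s + (- s / I) * I"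
      unfolding \<eta>_def
      by (subst set_integral_add(2), rule ai, rule set_integrable_mult_right, rule ai)
        (simp only: set_integral_mult_right s_def Ieq[OF pq(1,3,4)])
    then have \<eta>z: "(LINT x:{p..q}|lebesgue. \<eta> x) = 0" using \<open>I \<noteq> 0\<close> by simp
    have "\<forall>x. x \<notin> {p<..<q} \<longrightarrow> \<eta> x = 0" by (auto simp: \<eta>_def \<psi>0 \<beta>0')
    then obtain \<phi> where \<phi>: "test_function {0<..} \<phi>" "deriv \<phi> = \<eta>"
      using test_function_antiderivative[OF \<eta>k pq(1,2) _ \<eta>z] by blast
    have \<psi>0i: "\<forall>x. x \<notin> {p..q} \<longrightarrow> \<psi> x = 0" "\<forall>x. x \<notin> {p..q} \<longrightarrow> ?\<beta> x = 0"
      by (auto intro!: \<psi>0 \<beta>0')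
    note i1 = continuous_support_times_locally_integrable[OF \<psi>c pq(1) \<psi>0i(1) w]
    note i2 = continuous_support_times_locally_integrable[OF \<beta>c pq(1) \<psi>0i(2) w]
    have "0 = (LINT x:{0<..}|lebesgue. \<psi> x *\<^sub>R w x + (- s / I) *\<^sub>R (?\<beta> x *\<^sub>R w x))"
      using zero[OF \<phi>(1)] unfolding \<phi>(2) \<eta>_def by (simp add: scaleR_add_left scaleR_diff_left)
    also have "\<dots> = (LINT x:{0<..}|lebesgue. \<psi> x *\<^sub>R w x) + (- s / I) *\<^sub>R (LINT x:{0<..}|lebesgue. ?\<beta> x *\<^sub>R w x)"
      by (subst set_integral_add(2), rule i1(1), rule set_integrable_scaleR_right, rule i2(1))
        (simp only: set_integral_scaleR_right)
    also have "(- s / I) *\<^sub>R (LINT x:{0<..}|lebesgue. ?\<beta> x *\<^sub>R w x) = - of_real s * c"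
      by (simp add: c_def scaleR_conv_of_real)
    finally have 1: "(LINT x:{0<..}|lebesgue. \<psi> x *\<^sub>R w x) = of_real s * c" by simp
    have lc: "locally_integrable {0<..} (\<lambda>x. c)"
      unfolding locally_integrable_def by (auto intro!: absolutely_integrable_on_const lmeasurable_compact)
    note i3 = continuous_support_times_locally_integrable[OF \<psi>c pq(1) \<psi>0i(1) lc]
    have "(LINT x:{0<..}|lebesgue. \<psi> x *\<^sub>R c) = of_real s * c"
    proof -
      have "(LINT x|lebesgue. (indicator {p..q} x *\<^sub>R \<psi> x) *\<^sub>R c) = s *\<^sub>R c"
        unfolding s_def set_lebesgue_integral_def
        using ai(1) unfolding set_integrable_def by (intro integral_scaleR_left) auto
      then have "(LINT x:{p..q}|lebesgue. \<psi> x *\<^sub>R c) = s *\<^sub>R c"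
        unfolding set_lebesgue_integral_def scaleR_scaleR real_scaleR_def .
      then show ?thesis using i3(2) by (metis scaleR_conv_of_real)
    qed
    then show "(LINT x:{0<..}|lebesgue. \<psi> x *\<^sub>R (w x - c)) = 0"
      unfolding scaleR_diff_right by (subst set_integral_diff(2)) (use i1 i3 1 in auto)
  qed
  then show ?thesis using that[of c] by simp
qed

section \<open>Weak derivatives on the half-line\<close>

lemma locally_integrable_Icc:
  "locally_integrable {0<..} f \<Longrightarrow> 0 < p \<Longrightarrow> set_integrable lebesgue {p..q} f"
  unfolding locally_integrable_def by (elim allE[of _ "{p..q}"]) auto

lemma weak_deriv_unique:
  assumes "has_weak_deriv {0<..} k f h" "has_weak_deriv {0<..} k f h'"
  shows "AE x in lebesgue. x > 0 \<longrightarrow> h x = h' x"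
proof -
  have li: "locally_integrable {0<..} h" "locally_integrable {0<..} h'"
    using assms unfolding has_weak_deriv_def by auto
  have "AE x in lebesgue. x > 0 \<longrightarrow> h x - h' x = 0"
  proof (rule AE_zero_if_test_integrals_zero)
    show "locally_integrable {0<..} (\<lambda>x. h x - h' x)"
      using li unfolding locally_integrable_def by (auto intro!: set_integral_diff(1))
    fix \<phi> assume \<phi>: "test_function {0<..} \<phi>"
    note D = test_functionD[OF \<phi>]
    obtain p q where pq: "0 < p" "p < q" "\<And>k x. x \<notin> {p<..<q} \<Longrightarrow> (deriv ^^ k) \<phi> x = 0"
      using D(2) by blast
    have z: "\<forall>x. x \<notin> {p..q} \<longrightarrow> \<phi> x = 0" using pq(3)[of _ 0] by auto
    have c: "continuous_on UNIV \<phi>" by (rule times_differentiable_continuous_on[OF D(1)[of 0]])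
    note i = continuous_support_times_locally_integrable(1)[OF c pq(1) z]
    have 1: "(LINT x:{0<..}|lebesgue. (deriv ^^ k) \<phi> x *\<^sub>R f x) = (-1) ^ k * (LINT x:{0<..}|lebesgue. \<phi> x *\<^sub>R h x)"
      using assms(1) \<phi> unfolding has_weak_deriv_def by blast
    have 2: "(LINT x:{0<..}|lebesgue. (deriv ^^ k) \<phi> x *\<^sub>R f x) = (-1) ^ k * (LINT x:{0<..}|lebesgue. \<phi> x *\<^sub>R h' x)"
      using assms(2) \<phi> unfolding has_weak_deriv_def by blast
    from 1[unfolded 2] have "(LINT x:{0<..}|lebesgue. \<phi> x *\<^sub>R h x) = (LINT x:{0<..}|lebesgue. \<phi> x *\<^sub>R h' x)" by simp
    then show "(LINT x:{0<..}|lebesgue. \<phi> x *\<^sub>R (h x - h' x)) = 0"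
      unfolding scaleR_diff_right by (subst set_integral_diff(2)) (use i li in auto)
  qed
  then show ?thesis by simp
qed

text \<open>This removes the arbitrary choice of a representative in \<^const>\<open>weak_deriv\<close>.\<close>

lemma weak_deriv_AE_eq:
  assumes "has_weak_deriv {0<..} k f h"
  shows "AE x in lebesgue. x > 0 \<longrightarrow> weak_deriv k f x = h x"
proof (rule weak_deriv_unique[OF _ assms])
  show "has_weak_deriv {0<..} k f (weak_deriv k f)"
    unfolding weak_deriv_def by (rule someI[of "has_weak_deriv {0<..} k f", OF assms])
qed

lemma set_lebesgue_integral_cong_AE_on:
  fixes f g :: "real \<Rightarrow> complex"
  assumes "AE x in lebesgue. x \<in> S \<longrightarrow> f x = g x"
  shows "set_integrable lebesgue S f \<longleftrightarrow> set_integrable lebesgue S g"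
    and "(LINT x:S|lebesgue. f x) = (LINT x:S|lebesgue. g x)"
proof -
  have ae: "AE x in lebesgue. indicator S x *\<^sub>R f x = indicator S x *\<^sub>R g x"
    using assms by (rule AE_mp) (auto intro!: AE_I2 simp: indicator_def)
  have ae': "AE x in lebesgue. indicator S x *\<^sub>R g x = indicator S x *\<^sub>R f x"
    using ae by (rule AE_mp) (auto intro!: AE_I2)
  have m: "(\<lambda>x. indicator S x *\<^sub>R f x) \<in> borel_measurable lebesgue \<longleftrightarrow>
      (\<lambda>x. indicator S x *\<^sub>R g x) \<in> borel_measurable lebesgue"
    using borel_measurable_AE[OF _ ae] borel_measurable_AE[OF _ ae'] by blast
  show "set_integrable lebesgue S f \<longleftrightarrow> set_integrable lebesgue S g"
    unfolding set_integrable_def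
  proof
    assume i: "integrable lebesgue (\<lambda>x. indicator S x *\<^sub>R f x)"
    show "integrable lebesgue (\<lambda>x. indicator S x *\<^sub>R g x)"
      by (rule integrable_cong_AE_imp[OF i iffD1[OF m borel_measurable_integrable[OF i]] ae])
  next
    assume i: "integrable lebesgue (\<lambda>x. indicator S x *\<^sub>R g x)"
    show "integrable lebesgue (\<lambda>x. indicator S x *\<^sub>R f x)"
      by (rule integrable_cong_AE_imp[OF i iffD2[OF m borel_measurable_integrable[OF i]] ae'])
  qed
  show "(LINT x:S|lebesgue. f x) = (LINT x:S|lebesgue. g x)"
  proof (cases "(\<lambda>x. indicator S x *\<^sub>R f x) \<in> borel_measurable lebesgue")
    case True
    show ?thesis unfolding set_lebesgue_integral_def by (rule integral_cong_AE[OF True iffD1[OF m True] ae])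
  next
    case False
    then have "\<not> integrable lebesgue (\<lambda>x. indicator S x *\<^sub>R f x)"
      "\<not> integrable lebesgue (\<lambda>x. indicator S x *\<^sub>R g x)"
      using m borel_measurable_integrable[of lebesgue "\<lambda>x. indicator S x *\<^sub>R f x"]
        borel_measurable_integrable[of lebesgue "\<lambda>x. indicator S x *\<^sub>R g x"] by blast+
    then show ?thesis unfolding set_lebesgue_integral_def by (metis not_integrable_integral_eq)
  qed
qed

lemma locally_integrable_cong_AE:
  assumes "AE x in lebesgue. x > 0 \<longrightarrow> f x = g x" "locally_integrable {0<..} f"
  shows "locally_integrable {0<..} g"
  unfolding locally_integrable_def
proof (intro allI impI)
  fix K :: "real set" assume K: "compact K \<and> K \<subseteq> {0<..}"
  have "AE x in lebesgue. x \<in> K \<longrightarrow> f x = g x"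
    using assms(1) by (rule AE_mp) (use K in \<open>auto intro!: AE_I2\<close>)
  then show "set_integrable lebesgue K g"
    using assms(2) K set_lebesgue_integral_cong_AE_on(1) unfolding locally_integrable_def by blast
qed

lemma has_weak_deriv_cong_AE:
  assumes "has_weak_deriv {0<..} k f h" "AE x in lebesgue. x > 0 \<longrightarrow> h x = h' x"
  shows "has_weak_deriv {0<..} k f h'"
proof -
  have "(LINT x:{0<..}|lebesgue. \<phi> x *\<^sub>R h x) = (LINT x:{0<..}|lebesgue. \<phi> x *\<^sub>R h' x)" for \<phi> :: "real \<Rightarrow> real"
    by (rule set_lebesgue_integral_cong_AE_on(2), rule AE_mp[OF assms(2)]) (auto intro!: AE_I2)
  then show ?thesis using assms locally_integrable_cong_AE[OF assms(2)] unfolding has_weak_deriv_def by auto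
qed

text \<open>The set where the inequality fails is open, and a nonempty open set is not a null set.\<close>

lemma AE_le_imp_le:
  fixes f g :: "real \<Rightarrow> real"
  assumes "AE x in lebesgue. x > c \<longrightarrow> f x \<le> g x" "continuous_on {c<..} f" "continuous_on {c<..} g" "x > c"
  shows "f x \<le> g x"
proof (rule ccontr)
  assume "\<not> f x \<le> g x"
  let ?S = "{x \<in> {c<..}. 0 < f x - g x}"
  have "open ({c<..} \<inter> (\<lambda>x. f x - g x) -` {0<..})"
    by (rule continuous_open_preimage[OF continuous_on_diff[OF assms(2,3)]]) auto
  moreover have "{c<..} \<inter> (\<lambda>x. f x - g x) -` {0<..} = ?S" by auto
  ultimately have "open ?S" by simp
  moreover have "?S \<noteq> {}" using \<open>\<not> f x \<le> g x\<close> assms(4) by auto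
  ultimately have "\<not> negligible ?S" by (rule open_not_negligible)
  moreover have "?S \<in> null_sets lebesgue"
  proof -
    have "?S \<in> sets lebesgue" using \<open>open ?S\<close> by (intro borel_open[THEN sets_completionI_sets[where M=lborel, simplified]])
    moreover have "AE x in lebesgue. x \<notin> ?S" using assms(1) by (rule AE_mp) (auto intro!: AE_I2)
    ultimately show ?thesis by (simp add: AE_iff_null_sets)
  qed
  ultimately show False by (simp add: negligible_iff_null_sets)
qed

lemma AE_eq_imp_eq:
  fixes f g :: "real \<Rightarrow> complex"
  assumes "AE x in lebesgue. x > c \<longrightarrow> f x = g x" "continuous_on {c<..} f" "continuous_on {c<..} g" "x > c"
  shows "f x = g x"
proof -
  have "norm (f x - g x) \<le> 0"
    by (rule AE_le_imp_le[OF _ _ _ assms(4)])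
      (use assms in \<open>auto intro!: continuous_intros elim!: AE_mp intro: AE_I2\<close>)
  then show ?thesis by simp
qed

definition primitive_on_half_line :: "(real \<Rightarrow> complex) \<Rightarrow> (real \<Rightarrow> complex) \<Rightarrow> bool" where
  "primitive_on_half_line u h \<longleftrightarrow> (\<forall>p q. 0 < p \<longrightarrow> is_primitive p q u h)"

lemma primitive_on_half_line_continuous_on:
  assumes "primitive_on_half_line u h"
  shows "continuous_on {0<..} u"
proof (rule continuous_at_imp_continuous_on, rule ballI)
  fix x :: real assume "x \<in> {0<..}"
  then have x: "x > 0" by simp
  have "continuous_on {x/2..x+1} u"
    using assms x unfolding primitive_on_half_line_def by (intro is_primitive_continuous_on[of _ _ _ h]) auto
  then have "continuous_on {x/2<..<x+1} u" by (rule continuous_on_subset) auto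
  then show "isCont u x" using x by (subst (asm) continuous_on_eq_continuous_at) auto
qed

lemma primitive_on_half_line_exists:
  assumes "\<And>p q. 0 < p \<Longrightarrow> h \<in> borel_measurable (lebesgue_on {p..q})"
    and "\<And>p q. 0 < p \<Longrightarrow> \<exists>B. \<forall>t\<in>{p..q}. norm (h t) \<le> B"
  obtains H where "primitive_on_half_line H h"
proof -
  define H where "H = (\<lambda>x. if x \<ge> 1 then integral {1..x} h else - integral {x..1} h)"
  have int: "h integrable_on {x..y}" if x: "0 < x" for x y
  proof -
    obtain B where B: "\<And>t. t \<in> {x..y} \<Longrightarrow> norm (h t) \<le> B" using assms(2)[OF x, of y] by blast
    show ?thesis
      using abs_integrable_bounded_measurable[OF assms(1)[OF x] B] unfolding absolutely_integrable_on_def by blast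
  qed
  have "(h has_integral (H y - H x)) {x..y}" if "0 < x" "x \<le> y" for x y
  proof -
    consider "1 \<le> x" | "x < 1" "1 \<le> y" | "y < 1" using that by linarith
    then have "H y - H x = integral {x..y} h"
    proof cases
      case 1
      then show ?thesis
        using Henstock_Kurzweil_Integration.integral_combine[of 1 x y h] int[of 1 y] that
        by (simp add: H_def algebra_simps)
    next
      case 2
      then show ?thesis
        using Henstock_Kurzweil_Integration.integral_combine[of x 1 y h] int[of x y] that
        by (simp add: H_def algebra_simps)
    next
      case 3
      then show ?thesis
        using Henstock_Kurzweil_Integration.integral_combine[of x y 1 h] int[of x 1] that
        by (simp add: H_def algebra_simps)
    qed
    then show ?thesis using int[OF that(1)] by (simp add: has_integral_iff)
  qed
  then have "primitive_on_half_line H h"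
    unfolding primitive_on_half_line_def is_primitive_def using assms by auto
  then show ?thesis by (rule that)
qed

text \<open>Setting the function to zero where one of the countably many essential bounds fails changes it only on a
  null set and turns the essential bounds into pointwise ones.\<close>

lemma locally_bounded_representative:
  assumes "has_weak_deriv {0<..} k f h"
    and "\<forall>R>0. \<exists>C. AE x in lebesgue. x \<in> {0<..<R} \<longrightarrow> norm (h x) \<le> C"
  obtains h' where "has_weak_deriv {0<..} k f h'" "\<And>R. R > 0 \<Longrightarrow> \<exists>C. \<forall>x\<in>{0<..<R}. norm (h' x) \<le> C"
    "\<And>p q. 0 < p \<Longrightarrow> h' \<in> borel_measurable (lebesgue_on {p..q})"
proof -
  have "\<forall>n. \<exists>C. AE x in lebesgue. x \<in> {0<..<real (Suc n)} \<longrightarrow> norm (h x) \<le> C"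
    using assms(2) by (auto simp del: of_nat_Suc)
  then obtain C where C: "\<And>n. AE x in lebesgue. x \<in> {0<..<real (Suc n)} \<longrightarrow> norm (h x) \<le> C n" by metis
  define h' where "h' = (\<lambda>x. if \<forall>n. x \<in> {0<..<real (Suc n)} \<longrightarrow> norm (h x) \<le> C n then h x else 0)"
  have "AE x in lebesgue. \<forall>n. x \<in> {0<..<real (Suc n)} \<longrightarrow> norm (h x) \<le> C n"
    using C by (subst AE_all_countable) blast
  then have ae: "AE x in lebesgue. x > 0 \<longrightarrow> h x = h' x"
    by (rule AE_mp) (intro AE_I2, auto simp: h'_def simp del: of_nat_Suc)
  note w = has_weak_deriv_cong_AE[OF assms(1) ae]
  show ?thesis
  proof (rule that[OF w])
    fix R :: real assume "R > 0"
    obtain n where n: "R < real n" using reals_Archimedean2 by blast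
    have "norm (h' x) \<le> max (C n) 0" if "x \<in> {0<..<R}" for x
    proof (cases "\<forall>n. x \<in> {0<..<real (Suc n)} \<longrightarrow> norm (h x) \<le> C n")
      case True
      moreover have "x \<in> {0<..<real (Suc n)}" using that n by auto
      ultimately have "norm (h x) \<le> C n" by blast
      moreover have "h' x = h x" using True unfolding h'_def by meson
      ultimately show ?thesis by simp
    next
      case False
      then have "h' x = 0" unfolding h'_def by meson
      then show ?thesis by simp
    qed
    then show "\<exists>C. \<forall>x\<in>{0<..<R}. norm (h' x) \<le> C" by blast
  next
    fix p q :: real assume "0 < p"
    then have "h' absolutely_integrable_on {p..q}"
      using w unfolding has_weak_deriv_def by (blast intro: locally_integrable_Icc)
    then show "h' \<in> borel_measurable (lebesgue_on {p..q})"
      by (rule absolutely_integrable_imp_borel_measurable) auto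
  qed
qed

lemma has_weak_deriv_0:
  assumes "continuous_on {0<..} V"
  shows "has_weak_deriv {0<..} 0 V V"
proof -
  have "locally_integrable {0<..} V"
    unfolding locally_integrable_def
  proof (intro allI impI)
    fix K :: "real set" assume K: "compact K \<and> K \<subseteq> {0<..}"
    have c: "continuous_on K V" using K by (intro continuous_on_subset[OF assms]) auto
    obtain B where B: "\<And>x. x \<in> K \<Longrightarrow> norm (V x) \<le> B"
      using compact_imp_bounded[OF compact_continuous_image[OF c]] K by (meson bounded_iff imageI)
    show "set_integrable lebesgue K V"
      by (rule measurable_bounded_by_integrable_imp_absolutely_integrable[where g="\<lambda>_. B"])
        (use K B c in \<open>auto intro!: continuous_imp_measurable_on_sets_lebesgue integrable_on_const
          lmeasurable_compact fmeasurableD\<close>)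
  qed
  then show ?thesis unfolding has_weak_deriv_def by simp
qed

lemma weak_deriv_successive:
  assumes "has_weak_deriv {0<..} m V h" "has_weak_deriv {0<..} (Suc m) V k"
    and "test_function {0<..} \<phi>"
  shows "(LINT x:{0<..}|lebesgue. deriv \<phi> x *\<^sub>R h x) = - (LINT x:{0<..}|lebesgue. \<phi> x *\<^sub>R k x)"
proof -
  have "test_function {0<..} (deriv \<phi>)" using test_function_deriv[OF assms(3)] by simp
  then have 1: "(LINT x:{0<..}|lebesgue. (deriv ^^ m) (deriv \<phi>) x *\<^sub>R V x) =
      (-1) ^ m * (LINT x:{0<..}|lebesgue. deriv \<phi> x *\<^sub>R h x)"
    using assms(1) unfolding has_weak_deriv_def by blast
  have 2: "(LINT x:{0<..}|lebesgue. (deriv ^^ Suc m) \<phi> x *\<^sub>R V x) =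
      (-1) ^ Suc m * (LINT x:{0<..}|lebesgue. \<phi> x *\<^sub>R k x)"
    using assms(2,3) unfolding has_weak_deriv_def by blast
  have "(-1) ^ m * (LINT x:{0<..}|lebesgue. deriv \<phi> x *\<^sub>R h x)
      = (-1) ^ m * (- (LINT x:{0<..}|lebesgue. \<phi> x *\<^sub>R k x))"
    using 1 2 by (simp add: funpow_Suc_right del: funpow.simps)
  then show ?thesis by (subst (asm) mult_cancel_left) simp
qed

text \<open>The difference of \<open>h\<close> and an actual primitive \<open>H\<close> of \<open>k\<close> annihilates derivatives of test functions, so it is
  constant.\<close>

lemma weak_derivative_primitive:
  assumes h: "locally_integrable {0<..} h" and k: "primitive_on_half_line H k"
    and eq: "\<And>\<phi>. test_function {0<..} \<phi> \<Longrightarrow>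
      (LINT x:{0<..}|lebesgue. deriv \<phi> x *\<^sub>R h x) = - (LINT x:{0<..}|lebesgue. \<phi> x *\<^sub>R k x)"
  obtains G where "primitive_on_half_line G k" "AE x in lebesgue. x > 0 \<longrightarrow> h x = G x"
proof -
  have H: "\<And>p q. 0 < p \<Longrightarrow> is_primitive p q H k" using k unfolding primitive_on_half_line_def by blast
  have li: "locally_integrable {0<..} H" using is_primitive_imp_locally_integrable H by blast
  have "locally_integrable {0<..} (\<lambda>x. h x - H x)"
    using h li unfolding locally_integrable_def by (auto intro!: set_integral_diff(1))
  moreover have "(LINT x:{0<..}|lebesgue. deriv \<phi> x *\<^sub>R (h x - H x)) = 0"
    if \<phi>: "test_function {0<..} \<phi>" for \<phi>
  proof -
    have \<phi>': "test_function {0<..} (deriv \<phi>)" using test_function_deriv[OF \<phi>] by simp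
    note D = test_functionD[OF \<phi>']
    obtain p q where pq: "0 < p" "p < q" "\<And>k x. x \<notin> {p<..<q} \<Longrightarrow> (deriv ^^ k) (deriv \<phi>) x = 0"
      using D(2) by blast
    have z: "\<forall>x. x \<notin> {p..q} \<longrightarrow> deriv \<phi> x = 0" using pq(3)[of _ 0] by auto
    note i = continuous_support_times_locally_integrable(1)[OF times_differentiable_continuous_on[OF D(1)[of 0]] pq(1) z]
    show ?thesis unfolding scaleR_diff_right
      by (subst set_integral_diff(2))
        (use i h li eq[OF \<phi>] integration_by_parts_test_function[OF H \<phi>] in auto)
  qed
  ultimately obtain c where c: "AE x in lebesgue. x > 0 \<longrightarrow> h x - H x = c"
    by (rule du_bois_reymond_constant)
  have "primitive_on_half_line (\<lambda>x. H x + c) k"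
    unfolding primitive_on_half_line_def
  proof (intro allI impI)
    fix p q :: real assume "0 < p"
    from is_primitive_add[OF H[OF this] is_primitive_const]
    show "is_primitive p q (\<lambda>x. H x + c) k" by simp
  qed
  moreover have "AE x in lebesgue. x > 0 \<longrightarrow> h x = H x + c"
    using c by (rule AE_mp) (auto intro!: AE_I2 simp: algebra_simps)
  ultimately show ?thesis by (rule that)
qed

lemma AE_lebesgue_negligible:
  assumes "AE x in lebesgue. P x"
  obtains S where "negligible S" "\<And>x. x \<notin> S \<Longrightarrow> P x"
proof -
  obtain N where "N \<in> null_sets lebesgue" "\<And>x. x \<notin> N \<Longrightarrow> P x"
    using assms unfolding completion.AE_iff_null_sets by auto
  then show ?thesis using that by (auto simp: negligible_iff_null_sets)
qed

text \<open>Going down from one weak derivative to the preceding one, each derivative of order below \<open>N\<close> has a locally Lipschitz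
  representative whose derivative is the next one. The bound near the origin expresses boundedness of \<open>V\<close> up to the
  end point of the half-line; it is needed for the uniqueness of the turning point.\<close>

theorem sobolev_derivatives:
  assumes V: "continuous_on {0<..} V" and sob: "sobolev_inf_loc N V" and N: "N \<ge> 1"
  shows "\<exists>D. D 0 = V \<and> (\<forall>m<N. primitive_on_half_line (D m) (D (Suc m))) \<and>
    (\<forall>m\<in>{1..N}. AE x in lebesgue. x > 0 \<longrightarrow> D m x = weak_deriv m V x) \<and>
    (\<forall>R>0. \<exists>C. \<forall>x\<in>{0<..<R}. norm (V x) \<le> C)"
proof -
  have "\<exists>h'. has_weak_deriv {0<..} m V h' \<and> (\<forall>R>0. \<exists>C. \<forall>x\<in>{0<..<R}. norm (h' x) \<le> C) \<and>
      (\<forall>p q. 0 < p \<longrightarrow> h' \<in> borel_measurable (lebesgue_on {p..q}))" if m: "m \<le> N" for m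
  proof -
    obtain h where "has_weak_deriv {0<..} m V h"
      "\<forall>R>0. \<exists>C. AE x in lebesgue. x \<in> {0<..<R} \<longrightarrow> norm (h x) \<le> C"
      using sob m unfolding sobolev_inf_loc_def by blast
    then show ?thesis by (rule locally_bounded_representative) blast
  qed
  then obtain h where h: "\<And>m. m \<le> N \<Longrightarrow> has_weak_deriv {0<..} m V (h m)"
    "\<And>m R. m \<le> N \<Longrightarrow> R > 0 \<Longrightarrow> \<exists>C. \<forall>x\<in>{0<..<R}. norm (h m x) \<le> C"
    "\<And>m p q. m \<le> N \<Longrightarrow> 0 < p \<Longrightarrow> h m \<in> borel_measurable (lebesgue_on {p..q})"
    by metis
  have prim: "\<exists>G. primitive_on_half_line G (h (Suc m)) \<and> (AE x in lebesgue. x > 0 \<longrightarrow> h m x = G x)"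
    if m: "m < N" for m
  proof -
    have "\<exists>B. \<forall>t\<in>{p..q}. norm (h (Suc m) t) \<le> B" if "0 < p" for p q
    proof -
      obtain B where "\<forall>x\<in>{0<..<\<bar>q\<bar> + 1}. norm (h (Suc m) x) \<le> B" using h(2)[of "Suc m" "\<bar>q\<bar> + 1"] m by force
      then show ?thesis using that by (intro exI[of _ B]) auto
    qed
    moreover have "h (Suc m) \<in> borel_measurable (lebesgue_on {p..q})" if "0 < p" for p q
      using h(3)[of "Suc m"] m that by simp
    ultimately obtain H where H: "primitive_on_half_line H (h (Suc m))"
      using primitive_on_half_line_exists[of "h (Suc m)"] by blast
    have li: "locally_integrable {0<..} (h m)" using h(1)[of m] m unfolding has_weak_deriv_def by auto
    show ?thesis
      by (rule weak_derivative_primitive[OF li H weak_deriv_successive[OF h(1) h(1)]]) (use m in auto)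
  qed
  then obtain G where G: "\<And>m. m < N \<Longrightarrow> primitive_on_half_line (G m) (h (Suc m))"
    "\<And>m. m < N \<Longrightarrow> AE x in lebesgue. x > 0 \<longrightarrow> h m x = G m x" by metis
  have h0: "AE x in lebesgue. x > 0 \<longrightarrow> V x = h 0 x"
    by (rule weak_deriv_unique[OF has_weak_deriv_0[OF V] h(1)]) simp
  then have "AE x in lebesgue. x > 0 \<longrightarrow> V x = G 0 x" using G(2)[of 0] N by (auto elim: AE_mp)
  then have G0: "V x = G 0 x" if "x > 0" for x
    by (rule AE_eq_imp_eq[OF _ V primitive_on_half_line_continuous_on[OF G(1)] that]) (use N in auto)
  \<comment> \<open>At the top order no continuous representative exists, and the bounded one is kept.\<close>
  define D where "D = (\<lambda>m. if m = 0 then V else if m < N then G m else h m)"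
  have Dh: "AE x in lebesgue. x > 0 \<longrightarrow> h m x = D m x" if "m \<in> {1..N}" for m
    using G(2)[of m] that by (auto simp: D_def)
  show ?thesis
  proof (intro exI[of _ D] conjI allI impI ballI)
    show "D 0 = V" by (simp add: D_def)
    show "primitive_on_half_line (D m) (D (Suc m))" if m: "m < N" for m
      unfolding primitive_on_half_line_def
    proof (intro allI impI)
      fix p q :: real assume p: "0 < p"
      obtain S where S: "negligible S" "\<And>x. x \<notin> S \<Longrightarrow> x > 0 \<longrightarrow> h (Suc m) x = D (Suc m) x"
        using Dh[of "Suc m"] m by (auto elim: AE_lebesgue_negligible)
      have "\<exists>B. \<forall>t\<in>{p..q}. norm (D (Suc m) t) \<le> B"
      proof (cases "Suc m < N")
        case True
        then have "is_primitive p q (D (Suc m)) (h (Suc (Suc m)))"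
          using G(1)[OF True] p unfolding primitive_on_half_line_def D_def by simp
        then have "continuous_on {p..q} (D (Suc m))" by (rule is_primitive_continuous_on)
        then show ?thesis
          by (meson bounded_iff compact_Icc compact_continuous_image compact_imp_bounded imageI)
      next
        case False
        then have "D (Suc m) = h (Suc m)" by (simp add: D_def)
        moreover obtain B where "\<forall>x\<in>{0<..<\<bar>q\<bar> + 1}. norm (h (Suc m) x) \<le> B"
          using h(2)[of "Suc m" "\<bar>q\<bar> + 1"] m by force
        ultimately show ?thesis using p by (intro exI[of _ B]) auto
      qed
      then obtain B where B: "\<And>t. t \<in> {p..q} \<Longrightarrow> norm (D (Suc m) t) \<le> B" by blast
      have "is_primitive p q (G m) (h (Suc m))" using G(1)[OF m] p unfolding primitive_on_half_line_def by blast
      then have "is_primitive p q (G m) (D (Suc m))"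
        by (rule is_primitive_spike[OF _ S(1) _ B]) (use S(2) p in auto)
      then show "is_primitive p q (D m) (D (Suc m))"
        by (rule is_primitive_cong) (use G0 p m in \<open>auto simp: D_def\<close>)
    qed
    show "AE x in lebesgue. x > 0 \<longrightarrow> D m x = weak_deriv m V x" if "m \<in> {1..N}" for m
      using Dh[OF that] weak_deriv_AE_eq[OF h(1)[of m]] that by (auto elim: AE_mp)
    fix R :: real assume R: "R > 0"
    obtain C where C: "\<forall>x\<in>{0<..<R}. norm (h 0 x) \<le> C" using h(2)[of 0 R] R by auto
    have "norm (V x) \<le> C" if x: "x \<in> {0<..<R}" for x
    proof (rule ccontr)
      assume neg: "\<not> norm (V x) \<le> C"
      let ?S = "{0<..<R} \<inter> (\<lambda>x. norm (V x)) -` {C<..}"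
      have "open ?S" by (rule continuous_open_preimage)
          (auto intro!: continuous_intros continuous_on_subset[OF V])
      moreover have "?S \<noteq> {}" using x neg by auto
      ultimately have "\<not> negligible ?S" by (rule open_not_negligible)
      moreover obtain T where T: "negligible T" "\<And>x. x \<notin> T \<Longrightarrow> x > 0 \<longrightarrow> V x = h 0 x"
        using AE_lebesgue_negligible[OF h0] by blast
      moreover have "?S \<subseteq> T" using C T(2) by force
      ultimately show False using negligible_subset by blast
    qed
    then show "\<exists>C. \<forall>x\<in>{0<..<R}. norm (V x) \<le> C" by blast
  qed
qed

section \<open>Polynomials in the inverse root and the derivatives\<close>

text \<open>Polynomials in a variable \<open>R\<close> and in \<open>D 1, D 2, \<dots>\<close>, isobaric in two gradings: \<open>s\<close> is the total order of
  the factors \<open>D m\<close>, and \<open>e\<close> is the degree in \<open>R\<close> minus twice the number of such factors. With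
  \<open>R = (z - V)^(-1/2)\<close> and \<open>D m\<close> the \<open>m\<close>-th derivative of \<open>V\<close>, the second grading is the homogeneity under scaling of
  \<open>z - V\<close>.\<close>

inductive jet :: "nat \<Rightarrow> int \<Rightarrow> (complex \<Rightarrow> (nat \<Rightarrow> complex) \<Rightarrow> complex) \<Rightarrow> bool" where
  zero: "jet s e (\<lambda>R D. 0)"
| const: "jet 0 0 (\<lambda>R D. c)"
| mult_R: "jet s e F \<Longrightarrow> jet s (e + 1) (\<lambda>R D. R * F R D)"
| mult_D: "jet s e F \<Longrightarrow> 1 \<le> m \<Longrightarrow> jet (s + m) (e - 2) (\<lambda>R D. D m * F R D)"
| add: "jet s e F \<Longrightarrow> jet s e G \<Longrightarrow> jet s e (\<lambda>R D. F R D + G R D)"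

lemma jet_weight_cong: "jet s e F \<Longrightarrow> s = s' \<Longrightarrow> e = e' \<Longrightarrow> jet s' e' F"
  by simp

lemma jet_mult:
  "jet s e F \<Longrightarrow> jet s' e' G \<Longrightarrow> jet (s + s') (e + e') (\<lambda>R D. F R D * G R D)"
proof (induction rule: jet.induct)
  case (zero s e)
  then show ?case using jet.zero by simp
next
  case (const c)
  from const show ?case
  proof (induction rule: jet.induct)
    case (const c') then show ?case using jet.const[of "c * c'"] by simp
  next
    case (mult_R s e F)
    then show ?case using jet.mult_R[of s e "\<lambda>R D. c * F R D"] by (simp add: mult.left_commute add_ac)
  next
    case (mult_D s e F m)
    then show ?case using jet.mult_D[of s e "\<lambda>R D. c * F R D" m] by (simp add: mult.left_commute)
  next
    case (add s e F G)
    then show ?case using jet.add by (simp add: distrib_left)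
  qed (use jet.zero in auto)
next
  case (mult_R s e F)
  then show ?case using jet.mult_R[of "s + s'" "e + e'" "\<lambda>R D. F R D * G R D"] by (simp add: mult.assoc add_ac)
next
  case (mult_D s e F m)
  then have "jet (s + s' + m) (e + e' - 2) (\<lambda>R D. D m * (F R D * G R D))" by (intro jet.mult_D) auto
  then have "jet (s + s' + m) (e + e' - 2) (\<lambda>R D. D m * F R D * G R D)" by (simp add: mult.assoc)
  then show ?case by (rule jet_weight_cong) auto
next
  case (add s e F H)
  then show ?case using jet.add by (simp add: distrib_right)
qed

lemma jet_scale: "jet s e F \<Longrightarrow> jet s e (\<lambda>R D. c * F R D)"
  using jet_mult[OF jet.const[of c]] by fastforce

lemma jet_sum: "(\<And>i. i \<in> I \<Longrightarrow> jet s e (F i)) \<Longrightarrow> jet s e (\<lambda>R D. \<Sum>i\<in>I. F i R D)"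
  by (induction I rule: infinite_finite_induct) (auto intro: jet.zero jet.add)

lemma is_primitive_eqI:
  "is_primitive p q u h \<Longrightarrow> (\<And>t. u t = u' t) \<Longrightarrow> (\<And>t. h t = h' t) \<Longrightarrow> is_primitive p q u' h'"
  by (metis ext)

text \<open>Differentiation raises the order by one and preserves the second grading, because \<open>R' = R\<^sup>3 V' / 2\<close> adds two
  powers of \<open>R\<close> together with one derivative of \<open>V\<close>. The resulting jet does not depend on the functions inserted.\<close>

lemma jet_derivation:
  "jet s e F \<Longrightarrow> \<exists>F'. jet (Suc s) e F' \<and>
     (\<forall>p q R D. is_primitive p q R (\<lambda>t. R t ^ 3 * D 1 t / 2) \<longrightarrow>
        (\<forall>m\<in>{1..s}. is_primitive p q (D m) (D (Suc m))) \<longrightarrow>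
        is_primitive p q (\<lambda>t. F (R t) (\<lambda>m. D m t)) (\<lambda>t. F' (R t) (\<lambda>m. D m t)))"
proof (induction rule: jet.induct)
  case (zero s e)
  show ?case by (intro exI[of _ "\<lambda>R D. 0"]) (auto intro: jet.zero is_primitive_const)
next
  case (const c)
  show ?case by (intro exI[of _ "\<lambda>R D. 0"]) (auto intro: jet.zero is_primitive_const)
next
  case (mult_R s e F)
  then obtain F' where F': "jet (Suc s) e F'"
    "\<And>p q R D. is_primitive p q R (\<lambda>t. R t ^ 3 * D 1 t / 2) \<Longrightarrow>
        (\<forall>m\<in>{1..s}. is_primitive p q (D m) (D (Suc m))) \<Longrightarrow>
        is_primitive p q (\<lambda>t. F (R t) (\<lambda>m. D m t)) (\<lambda>t. F' (R t) (\<lambda>m. D m t))"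
    by blast
  let ?F' = "\<lambda>R D. 1/2 * (R * (R * (R * (D 1 * F R D)))) + R * F' R D"
  have "jet (Suc s) (e + 1) (\<lambda>R D. R * (R * (R * (D 1 * F R D))))"
    by (rule jet_weight_cong[OF jet.mult_R[OF jet.mult_R[OF jet.mult_R[OF jet.mult_D[OF mult_R.hyps, of 1]]]]]) auto
  then have "jet (Suc s) (e + 1) ?F'"
    by (intro jet.add[OF jet_scale jet.mult_R] F'(1))
  moreover have "is_primitive p q (\<lambda>t. R t * F (R t) (\<lambda>m. D m t)) (\<lambda>t. ?F' (R t) (\<lambda>m. D m t))"
    if "is_primitive p q R (\<lambda>t. R t ^ 3 * D 1 t / 2)"
      "\<forall>m\<in>{1..s}. is_primitive p q (D m) (D (Suc m))" for p q R D
    using is_primitive_mult[OF that(1) F'(2)[OF that]]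
    by (rule is_primitive_eqI) (simp_all add: power3_eq_cube field_simps)
  ultimately show ?case by blast
next
  case (mult_D s e F m)
  then obtain F' where F': "jet (Suc s) e F'"
    "\<And>p q R D. is_primitive p q R (\<lambda>t. R t ^ 3 * D 1 t / 2) \<Longrightarrow>
        (\<forall>m\<in>{1..s}. is_primitive p q (D m) (D (Suc m))) \<Longrightarrow>
        is_primitive p q (\<lambda>t. F (R t) (\<lambda>m. D m t)) (\<lambda>t. F' (R t) (\<lambda>m. D m t))"
    by blast
  let ?F' = "\<lambda>R D. D (Suc m) * F R D + D m * F' R D"
  have "jet (Suc (s + m)) (e - 2) ?F'"
    using jet.mult_D[OF mult_D.hyps(1), of "Suc m"] jet.mult_D[OF F'(1) mult_D.hyps(2)]
    by (intro jet.add) auto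
  moreover have "is_primitive p q (\<lambda>t. D m t * F (R t) (\<lambda>m. D m t)) (\<lambda>t. ?F' (R t) (\<lambda>m. D m t))"
    if "is_primitive p q R (\<lambda>t. R t ^ 3 * D 1 t / 2)"
      "\<forall>m\<in>{1..s + m}. is_primitive p q (D m) (D (Suc m))" for p q R D
  proof (rule is_primitive_mult)
    show "is_primitive p q (D m) (D (Suc m))" using that(2) mult_D.hyps(2) by simp
    show "is_primitive p q (\<lambda>t. F (R t) (\<lambda>m. D m t)) (\<lambda>t. F' (R t) (\<lambda>m. D m t))"
      using that by (intro F'(2)) auto
  qed
  ultimately show ?case by blast
next
  case (add s e F G)
  then obtain F' G' where F': "jet (Suc s) e F'"
    "\<And>p q R D. is_primitive p q R (\<lambda>t. R t ^ 3 * D 1 t / 2) \<Longrightarrow>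
        (\<forall>m\<in>{1..s}. is_primitive p q (D m) (D (Suc m))) \<Longrightarrow>
        is_primitive p q (\<lambda>t. F (R t) (\<lambda>m. D m t)) (\<lambda>t. F' (R t) (\<lambda>m. D m t))"
    and G': "jet (Suc s) e G'"
    "\<And>p q R D. is_primitive p q R (\<lambda>t. R t ^ 3 * D 1 t / 2) \<Longrightarrow>
        (\<forall>m\<in>{1..s}. is_primitive p q (D m) (D (Suc m))) \<Longrightarrow>
        is_primitive p q (\<lambda>t. G (R t) (\<lambda>m. D m t)) (\<lambda>t. G' (R t) (\<lambda>m. D m t))"
    by blast
  show ?case
    by (intro exI[of _ "\<lambda>R D. F' R D + G' R D"] conjI jet.add F'(1) G'(1) allI impI is_primitive_add F'(2) G'(2))
qed

lemma jet_continuous_on: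
  fixes D :: "nat \<Rightarrow> real \<Rightarrow> complex"
  assumes "jet s e F" "continuous_on S R" "\<forall>m\<in>{1..s}. continuous_on S (D m)"
  shows "continuous_on S (\<lambda>t. F (R t) (\<lambda>m. D m t))"
  using assms by (induction rule: jet.induct) (auto intro!: continuous_on_add continuous_on_mult)

text \<open>A monomial with \<open>l\<close> factors \<open>D m\<close> carries \<open>R\<close> to the power \<open>e + 2 l\<close>. There is at least one such factor when
  the order \<open>s\<close> is positive, which explains the lower limit of the sum.\<close>

lemma jet_bound:
  "jet s e F \<Longrightarrow> \<exists>C\<ge>0. \<forall>R D Y \<kappa>. R \<noteq> 0 \<longrightarrow> Y \<ge> 0 \<longrightarrow> \<kappa> \<ge> 0 \<longrightarrow> (\<forall>m\<in>{1..s}. cmod (D m) \<le> Y * \<kappa> ^ m) \<longrightarrow>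
     norm (F R D) \<le> C * \<kappa> ^ s * (norm R powi e) * (\<Sum>l=min 1 s..s. ((norm R)\<^sup>2 * Y) ^ l)"
proof (induction rule: jet.induct)
  case (zero s e)
  show ?case by (intro exI[of _ 0]) auto
next
  case (const c)
  show ?case by (intro exI[of _ "norm c"]) auto
next
  case (mult_R s e F)
  then obtain C where C: "C \<ge> 0" "\<And>R D Y \<kappa>. R \<noteq> 0 \<Longrightarrow> Y \<ge> 0 \<Longrightarrow> \<kappa> \<ge> 0 \<Longrightarrow> (\<forall>m\<in>{1..s}. cmod (D m) \<le> Y * \<kappa> ^ m) \<Longrightarrow>
     norm (F R D) \<le> C * \<kappa> ^ s * (norm R powi e) * (\<Sum>l=min 1 s..s. ((norm R)\<^sup>2 * Y) ^ l)"
    by blast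
  show ?case
  proof (intro exI[of _ C] conjI C(1) allI impI)
    fix R :: complex and D and Y \<kappa> :: real
    assume R: "R \<noteq> 0" and *: "0 \<le> Y" "0 \<le> \<kappa>" "\<forall>m\<in>{1..s}. cmod (D m) \<le> Y * \<kappa> ^ m"
    have "norm (R * F R D) \<le> norm R * (C * \<kappa> ^ s * (norm R powi e) * (\<Sum>l=min 1 s..s. ((norm R)\<^sup>2 * Y) ^ l))"
      unfolding norm_mult by (intro mult_left_mono C(2) R *) auto
    also have "\<dots> = C * \<kappa> ^ s * (norm R powi (e + 1)) * (\<Sum>l=min 1 s..s. ((norm R)\<^sup>2 * Y) ^ l)"
      using R by (simp add: power_int_add_1 mult_ac)
    finally show "norm (R * F R D) \<le> \<dots>" .
  qed
next
  case (mult_D s e F m)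
  then obtain C where C: "C \<ge> 0" "\<And>R D Y \<kappa>. R \<noteq> 0 \<Longrightarrow> Y \<ge> 0 \<Longrightarrow> \<kappa> \<ge> 0 \<Longrightarrow> (\<forall>m\<in>{1..s}. cmod (D m) \<le> Y * \<kappa> ^ m) \<Longrightarrow>
     norm (F R D) \<le> C * \<kappa> ^ s * (norm R powi e) * (\<Sum>l=min 1 s..s. ((norm R)\<^sup>2 * Y) ^ l)"
    by blast
  show ?case
  proof (intro exI[of _ C] conjI C(1) allI impI)
    fix R :: complex and D and Y \<kappa> :: real
    assume R: "R \<noteq> 0" and *: "0 \<le> Y" "0 \<le> \<kappa>" "\<forall>k\<in>{1..s + m}. cmod (D k) \<le> Y * \<kappa> ^ k"
    let ?u = "(norm R)\<^sup>2 * Y"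
    have u: "?u \<ge> 0" using * by simp
    have "norm (D m * F R D) \<le> (Y * \<kappa> ^ m) * (C * \<kappa> ^ s * (norm R powi e) * (\<Sum>l=min 1 s..s. ?u ^ l))"
      unfolding norm_mult
      by (intro mult_mono C(2) R) (use * mult_D.hyps(2) in auto)
    also have "\<dots> = C * \<kappa> ^ (s + m) * (norm R powi (e - 2)) * (\<Sum>l=min 1 s..s. ?u ^ Suc l)"
    proof -
      have "norm R powi e = norm R powi (e - 2) * (norm R)\<^sup>2"
        using R power_int_add[of "norm R" "e - 2" 2] by simp
      then show ?thesis by (simp add: power_add sum_distrib_left mult_ac)
    qed
    also have "\<dots> \<le> C * \<kappa> ^ (s + m) * (norm R powi (e - 2)) * (\<Sum>l=min 1 (s + m)..s + m. ?u ^ l)"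
    proof (rule mult_left_mono)
      have "(\<Sum>l=min 1 s..s. ?u ^ Suc l) = (\<Sum>l=Suc (min 1 s)..Suc s. ?u ^ l)"
        by (rule sum.shift_bounds_cl_Suc_ivl[symmetric])
      also have "\<dots> \<le> (\<Sum>l=min 1 (s + m)..s + m. ?u ^ l)"
        using mult_D.hyps(2) u by (intro sum_mono2) auto
      finally show "(\<Sum>l=min 1 s..s. ?u ^ Suc l) \<le> \<dots>" .
    qed (use C(1) * in auto)
    finally show "norm (D m * F R D) \<le> \<dots>" .
  qed
next
  case (add s e F G)
  then obtain C where C: "C \<ge> 0" "\<And>R D Y \<kappa>. R \<noteq> 0 \<Longrightarrow> Y \<ge> 0 \<Longrightarrow> \<kappa> \<ge> 0 \<Longrightarrow> (\<forall>m\<in>{1..s}. cmod (D m) \<le> Y * \<kappa> ^ m) \<Longrightarrow>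
     norm (F R D) \<le> C * \<kappa> ^ s * (norm R powi e) * (\<Sum>l=min 1 s..s. ((norm R)\<^sup>2 * Y) ^ l)"
    by blast
  from add obtain B where B: "B \<ge> 0" "\<And>R D Y \<kappa>. R \<noteq> 0 \<Longrightarrow> Y \<ge> 0 \<Longrightarrow> \<kappa> \<ge> 0 \<Longrightarrow> (\<forall>m\<in>{1..s}. cmod (D m) \<le> Y * \<kappa> ^ m) \<Longrightarrow>
     norm (G R D) \<le> B * \<kappa> ^ s * (norm R powi e) * (\<Sum>l=min 1 s..s. ((norm R)\<^sup>2 * Y) ^ l)"
    by blast
  show ?case
  proof (intro exI[of _ "C + B"] conjI allI impI)
    fix R :: complex and D and Y \<kappa> :: real
    assume *: "R \<noteq> 0" "0 \<le> Y" "0 \<le> \<kappa>" "\<forall>m\<in>{1..s}. cmod (D m) \<le> Y * \<kappa> ^ m"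
    show "norm (F R D + G R D) \<le> (C + B) * \<kappa> ^ s * (norm R powi e) * (\<Sum>l=min 1 s..s. ((norm R)\<^sup>2 * Y) ^ l)"
      using norm_triangle_mono[OF C(2)[OF *] B(2)[OF *]] by (simp add: distrib_right)
  qed (use B C in auto)
qed

section \<open>The WKB rates\<close>

definition derivative_chain :: "nat \<Rightarrow> (real \<Rightarrow> complex) \<Rightarrow> (nat \<Rightarrow> real \<Rightarrow> complex) \<Rightarrow> bool" where
  "derivative_chain N V D \<longleftrightarrow> D 0 = V \<and> (\<forall>m<N. primitive_on_half_line (D m) (D (Suc m)))"

text \<open>Where \<open>Re (z - V)\<close> is positive, the principal root of \<open>z - V\<close> stays away from its branch cut.\<close>

definition wkb_domain :: "(real \<Rightarrow> complex) \<Rightarrow> complex \<Rightarrow> real set" where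
  "wkb_domain V z = {x. x > 0 \<and> Re (z - V x) > 0}"

text \<open>The terms of the logarithmic derivative of the WKB function, including their powers of \<open>z\<close>; in this
  normalisation \<open>z\<close> enters the recursion only through \<open>z - V\<close>.\<close>

definition wkb_rate :: "(real \<Rightarrow> complex) \<Rightarrow> complex \<Rightarrow> nat \<Rightarrow> real \<Rightarrow> complex" where
  "wkb_rate V z j x = z powr (- (of_nat j - 1) / 2) * dpsi V z j x"

lemma derivative_chain_continuous_on:
  "derivative_chain N V D \<Longrightarrow> m < N \<Longrightarrow> S \<subseteq> {0<..} \<Longrightarrow> continuous_on S (D m)"
  unfolding derivative_chain_def
  by (blast intro: continuous_on_subset[OF primitive_on_half_line_continuous_on])

lemma derivative_chain_has_vector_derivative:
  assumes "derivative_chain N V D" "Suc m < N" "x > 0"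
  shows "(D m has_vector_derivative D (Suc m) x) (at x)"
proof (rule is_primitive_has_vector_derivative_at)
  show "is_primitive (x/2) (x+1) (D m) (D (Suc m))"
    using assms unfolding derivative_chain_def primitive_on_half_line_def by simp
  show "continuous_on {x/2..x+1} (D (Suc m))"
    by (rule derivative_chain_continuous_on[OF assms(1,2)]) (use assms in auto)
qed (use assms in auto)

lemma open_wkb_domain:
  assumes "continuous_on {0<..} V"
  shows "open (wkb_domain V z)"
proof -
  have "open ({0<..} \<inter> (\<lambda>x. Re (z - V x)) -` {0<..})"
    by (rule continuous_open_preimage) (auto intro!: continuous_intros assms)
  moreover have "{0<..} \<inter> (\<lambda>x. Re (z - V x)) -` {0<..} = wkb_domain V z"
    by (auto simp: wkb_domain_def)
  ultimately show ?thesis by simp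
qed

lemma wkb_domainD:
  assumes "x \<in> wkb_domain V z"
  shows "x > 0" "z - V x \<notin> \<real>\<^sub>\<le>\<^sub>0" "z - V x \<noteq> 0" "csqrt (z - V x) \<noteq> 0"
proof -
  have *: "x > 0" "0 < Re (z - V x)" using assms by (auto simp: wkb_domain_def)
  then show "x > 0" "z - V x \<notin> \<real>\<^sub>\<le>\<^sub>0" by (auto simp: complex_nonpos_Reals_iff)
  show "z - V x \<noteq> 0" using * by (metis less_irrefl zero_complex.sel(1))
  then show "csqrt (z - V x) \<noteq> 0" by (simp only: csqrt_eq_0 not_False_eq_True)
qed

lemma csqrt_has_vector_derivative:
  assumes "(V has_vector_derivative d) (at x)" "z - V x \<notin> \<real>\<^sub>\<le>\<^sub>0"
  shows "((\<lambda>t. csqrt (z - V t)) has_vector_derivative - d / (2 * csqrt (z - V x))) (at x)"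
proof -
  have "((\<lambda>t. z - V t) has_vector_derivative - d) (at x)"
    using assms(1) by (auto intro!: derivative_eq_intros)
  from field_vector_diff_chain_at[OF this has_field_derivative_csqrt[OF assms(2)]]
  show ?thesis by (simp only: o_def divide_inverse)
qed

lemma inverse_csqrt_has_vector_derivative:
  assumes "(V has_vector_derivative d) (at x)" "z - V x \<notin> \<real>\<^sub>\<le>\<^sub>0"
  shows "((\<lambda>t. 1 / csqrt (z - V t)) has_vector_derivative (1 / csqrt (z - V x)) ^ 3 * d / 2) (at x)"
proof -
  have nz: "csqrt (z - V x) \<noteq> 0" using assms(2) by auto
  have "((\<lambda>w. 1 / w) has_field_derivative - (1 / csqrt (z - V x) ^ 2)) (at (csqrt (z - V x)))"
    using nz by (auto intro!: derivative_eq_intros simp: power2_eq_square)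
  from field_vector_diff_chain_at[OF csqrt_has_vector_derivative[OF assms] this]
  have "((\<lambda>t. 1 / csqrt (z - V t)) has_vector_derivative
      (- d / (2 * csqrt (z - V x))) * - (1 / csqrt (z - V x) ^ 2)) (at x)"
    by (simp only: o_def)
  moreover have "(- d / (2 * csqrt (z - V x))) * - (1 / csqrt (z - V x) ^ 2)
      = (1 / csqrt (z - V x)) ^ 3 * d / 2"
    using nz by (simp add: field_simps power2_eq_square power3_eq_cube del: power2_csqrt)
  ultimately show ?thesis by (simp only:)
qed

lemma wkb_domain_continuous_on:
  assumes "continuous_on {0<..} V"
  shows "continuous_on (wkb_domain V z) (\<lambda>t. csqrt (z - V t))"
    and "continuous_on (wkb_domain V z) (\<lambda>t. 1 / csqrt (z - V t))"
proof -
  have "continuous_on (wkb_domain V z) (\<lambda>t. z - V t)"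
    by (intro continuous_intros continuous_on_subset[OF assms]) (auto simp: wkb_domain_def)
  moreover have "continuous_on ((\<lambda>t. z - V t) ` wkb_domain V z) csqrt"
    by (intro continuous_at_imp_continuous_on field_differentiable_imp_continuous_at ballI
        field_differentiable_at_csqrt) (auto dest: wkb_domainD(2))
  ultimately show 1: "continuous_on (wkb_domain V z) (\<lambda>t. csqrt (z - V t))"
    using continuous_on_compose[of "wkb_domain V z" "\<lambda>t. z - V t" csqrt] by (simp add: o_def)
  show "continuous_on (wkb_domain V z) (\<lambda>t. 1 / csqrt (z - V t))"
    by (intro continuous_intros 1) (auto dest: wkb_domainD(4))
qed

lemma wkb_rate_0:
  assumes "z \<noteq> 0"
  shows "wkb_rate V z 0 x = \<i> * csqrt (z - V x)"
proof -
  have "z powr (1 / 2) * z powr (- 1 / 2) = 1"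
    using powr_add[of z "1/2" "-1/2"] assms by simp
  then show ?thesis by (simp add: wkb_rate_def mult.left_commute mult.assoc[symmetric])
qed

text \<open>The powers of \<open>z\<close> are balanced in the recursion because the shifted indices of the factors add up.\<close>

lemma wkb_rate_Suc:
  assumes z: "z \<noteq> 0" and x: "x \<in> wkb_domain V z"
    and d: "(wkb_rate V z j has_vector_derivative d) (at x)"
  shows "wkb_rate V z (Suc j) x = 1 / (2 * wkb_rate V z 0 x) *
    (d - (\<Sum>i<j. wkb_rate V z (Suc i) x * wkb_rate V z (j - i) x))"
proof -
  define c where "c = (\<lambda>j::nat. z powr (- (of_nat j - 1) / 2))"
  have c_nz: "c j \<noteq> 0" for j using z by (simp add: c_def)
  have rate: "wkb_rate V z j x = c j * dpsi V z j x" for j x by (simp add: wkb_rate_def c_def)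
  have "((\<lambda>x. inverse (c j) * wkb_rate V z j x) has_vector_derivative inverse (c j) * d) (at x)"
    using d by (auto intro!: derivative_eq_intros)
  moreover have "(\<lambda>x. inverse (c j) * wkb_rate V z j x) = dpsi V z j"
    using c_nz by (simp add: rate fun_eq_iff)
  ultimately have vd: "vector_derivative (dpsi V z j) (at x) = inverse (c j) * d"
    using vector_derivative_at by metis
  have cc: "c (Suc i) * c (j - i) = c j" if "i < j" for i
  proof -
    have "- (of_nat (Suc i) - 1) / 2 + - (of_nat (j - i) - 1) / 2 = (- (of_nat j - 1) / 2 :: complex)"
      using that by (simp add: of_nat_diff field_simps)
    then show ?thesis unfolding c_def powr_add[symmetric] by (simp only:)
  qed
  have c0: "c (Suc j) * c 0 = c j"
  proof -
    have "- (of_nat (Suc j) - 1) / 2 + - (of_nat 0 - 1) / 2 = (- (of_nat j - 1) / 2 :: complex)"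
      by (simp add: field_simps)
    then show ?thesis unfolding c_def powr_add[symmetric] by (simp only:)
  qed
  have nz: "dpsi V z 0 x \<noteq> 0" using z wkb_domainD(4)[OF x] by simp
  have S: "(\<Sum>i<j. wkb_rate V z (Suc i) x * wkb_rate V z (j - i) x)
      = c j * (\<Sum>i<j. dpsi V z (Suc i) x * dpsi V z (j - i) x)"
    unfolding sum_distrib_left rate by (intro sum.cong) (auto simp: cc[symmetric] mult_ac simp del: dpsi.simps)
  have "wkb_rate V z (Suc j) x = c (Suc j) * (1 / (2 * dpsi V z 0 x) *
      (inverse (c j) * d - (\<Sum>i<j. dpsi V z (Suc i) x * dpsi V z (j - i) x)))"
    unfolding rate by (subst dpsi.simps(2)) (simp only: vd)
  also have "\<dots> = 1 / (2 * (c 0 * dpsi V z 0 x)) *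
      (d - c j * (\<Sum>i<j. dpsi V z (Suc i) x * dpsi V z (j - i) x))"
  proof -
    have "c (Suc j) = c j / c 0" using c_nz by (simp add: c0[symmetric])
    moreover have "a / b * (1 / (2 * y) * (inverse a * d - S)) = 1 / (2 * (b * y)) * (d - a * S)"
      if "a \<noteq> 0" "b \<noteq> 0" "y \<noteq> 0" for a b y S :: complex
      using that by (simp add: field_simps)
    ultimately show ?thesis using c_nz nz by (simp del: dpsi.simps)
  qed
  finally show ?thesis unfolding S by (simp only: rate)
qed

lemma is_primitive_inverse_csqrt:
  assumes "derivative_chain N V D" "N \<ge> 2" "0 < p" "{p..q} \<subseteq> wkb_domain V z"
  shows "is_primitive p q (\<lambda>t. 1 / csqrt (z - V t)) (\<lambda>t. (1 / csqrt (z - V t)) ^ 3 * D 1 t / 2)"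
proof (rule is_primitive_classical)
  have V: "D 0 = V" using assms(1) by (simp add: derivative_chain_def)
  fix t assume t: "t \<in> {p..q}"
  then have t': "t \<in> wkb_domain V z" using assms(4) by blast
  have "(V has_vector_derivative D 1 t) (at t)"
    using derivative_chain_has_vector_derivative[OF assms(1), of 0 t] assms(2,3) t V by simp
  then show "((\<lambda>t. 1 / csqrt (z - V t)) has_vector_derivative (1 / csqrt (z - V t)) ^ 3 * D 1 t / 2)
      (at t within {p..q})"
    using inverse_csqrt_has_vector_derivative wkb_domainD(2)[OF t'] has_vector_derivative_at_within by blast
next
  have "continuous_on {0<..} V"
    using derivative_chain_continuous_on[OF assms(1), of 0] assms(1,2) by (simp add: derivative_chain_def)
  then have cr: "continuous_on {p..q} (\<lambda>t. 1 / csqrt (z - V t))"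
    by (rule continuous_on_subset[OF wkb_domain_continuous_on(2) assms(4)])
  have cD: "continuous_on {p..q} (D 1)"
    by (rule derivative_chain_continuous_on[OF assms(1)]) (use assms in auto)
  show "continuous_on {p..q} (\<lambda>t. (1 / csqrt (z - V t)) ^ 3 * D 1 t / 2)"
    by (intro cr cD continuous_on_mult continuous_on_power continuous_on_const
        continuous_on_divide[where g="\<lambda>_. 2"]) simp
qed

lemma is_primitive_csqrt:
  assumes "derivative_chain N V D" "N \<ge> 2" "0 < p" "{p..q} \<subseteq> wkb_domain V z"
  shows "is_primitive p q (\<lambda>t. \<i> * csqrt (z - V t)) (\<lambda>t. (- \<i> / 2) * ((1 / csqrt (z - V t)) * D 1 t))"
proof (rule is_primitive_classical)
  have V: "D 0 = V" using assms(1) by (simp add: derivative_chain_def)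
  fix t assume t: "t \<in> {p..q}"
  then have t': "t \<in> wkb_domain V z" using assms(4) by blast
  have "(V has_vector_derivative D 1 t) (at t)"
    using derivative_chain_has_vector_derivative[OF assms(1), of 0 t] assms(2,3) t V by simp
  from csqrt_has_vector_derivative[OF this wkb_domainD(2)[OF t']]
  have "((\<lambda>t. \<i> * csqrt (z - V t)) has_vector_derivative \<i> * (- D 1 t / (2 * csqrt (z - V t)))) (at t)"
    by (rule has_vector_derivative_mult_right)
  then have "((\<lambda>t. \<i> * csqrt (z - V t)) has_vector_derivative (- \<i> / 2) * ((1 / csqrt (z - V t)) * D 1 t)) (at t)"
    by (simp add: mult_ac)
  then show "((\<lambda>t. \<i> * csqrt (z - V t)) has_vector_derivative (- \<i> / 2) * ((1 / csqrt (z - V t)) * D 1 t))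
      (at t within {p..q})"
    by (rule has_vector_derivative_at_within)
next
  have "continuous_on {0<..} V"
    using derivative_chain_continuous_on[OF assms(1), of 0] assms(1,2) by (simp add: derivative_chain_def)
  then have cr: "continuous_on {p..q} (\<lambda>t. 1 / csqrt (z - V t))"
    by (rule continuous_on_subset[OF wkb_domain_continuous_on(2) assms(4)])
  have cD: "continuous_on {p..q} (D 1)"
    by (rule derivative_chain_continuous_on[OF assms(1)]) (use assms in auto)
  show "continuous_on {p..q} (\<lambda>t. (- \<i> / 2) * ((1 / csqrt (z - V t)) * D 1 t))"
    by (intro cr cD continuous_on_mult continuous_on_const)
qed

lemma wkb_domain_interval:
  assumes "continuous_on {0<..} V" "x \<in> wkb_domain V z"
  obtains p q where "0 < p" "x \<in> {p<..<q}" "{p..q} \<subseteq> wkb_domain V z"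
proof -
  obtain e where e: "e > 0" "cball x e \<subseteq> wkb_domain V z"
    using open_contains_cball[of "wkb_domain V z"] open_wkb_domain[OF assms(1)] assms(2) by blast
  have "cball x e = {x - e..x + e}" by (rule cball_eq_atLeastAtMost)
  then have "x - e \<in> wkb_domain V z" using e by auto
  then have "0 < x - e" by (rule wkb_domainD(1))
  then show ?thesis using that[of "x - e" "x + e"] e \<open>cball x e = _\<close> by auto
qed

text \<open>The quantifiers are arranged so that one polynomial \<open>F\<close> serves all potentials and all \<open>z\<close>; this is what makes
  the later constants uniform in the spectral parameter.\<close>

definition rate_jet :: "nat \<Rightarrow> (complex \<Rightarrow> (nat \<Rightarrow> complex) \<Rightarrow> complex) \<Rightarrow> bool" where
  "rate_jet j F \<longleftrightarrow> (\<forall>N V z D. derivative_chain N V D \<longrightarrow> z \<noteq> 0 \<longrightarrow> j < N \<longrightarrow> 2 \<le> N \<longrightarrow>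
     (\<forall>x\<in>wkb_domain V z. wkb_rate V z j x = F (1 / csqrt (z - V x)) (\<lambda>m. D m x)))"

text \<open>Up to the last rate the derivative is classical, as the recursion for the next rate requires; for the last one
  only the primitive relation is available, because its derivative involves the bounded derivative of top order.\<close>

definition rate_derivative :: "nat \<Rightarrow> (complex \<Rightarrow> (nat \<Rightarrow> complex) \<Rightarrow> complex) \<Rightarrow> bool" where
  "rate_derivative j F' \<longleftrightarrow> (\<forall>N V z D. derivative_chain N V D \<longrightarrow> z \<noteq> 0 \<longrightarrow> j < N \<longrightarrow> 2 \<le> N \<longrightarrow>
     (\<forall>p q. 0 < p \<longrightarrow> {p..q} \<subseteq> wkb_domain V z \<longrightarrow>
        is_primitive p q (wkb_rate V z j) (\<lambda>t. F' (1 / csqrt (z - V t)) (\<lambda>m. D m t))) \<and>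
     (Suc j < N \<longrightarrow> (\<forall>x\<in>wkb_domain V z.
        (wkb_rate V z j has_vector_derivative F' (1 / csqrt (z - V x)) (\<lambda>m. D m x)) (at x))))"

lemma wkb_rate_jet_derivative:
  assumes F: "jet (Suc j) (int j) F" "rate_jet (Suc j) F"
  shows "\<exists>F'. jet (Suc (Suc j)) (int j) F' \<and> rate_derivative (Suc j) F'"
proof -
  obtain F' where F': "jet (Suc (Suc j)) (int j) F'"
    "\<And>p q R D. is_primitive p q R (\<lambda>t. R t ^ 3 * D 1 t / 2) \<Longrightarrow>
        (\<forall>m\<in>{1..Suc j}. is_primitive p q (D m) (D (Suc m))) \<Longrightarrow>
        is_primitive p q (\<lambda>t. F (R t) (\<lambda>m. D m t)) (\<lambda>t. F' (R t) (\<lambda>m. D m t))"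
    using jet_derivation[OF F(1)] by blast
  have prim: "is_primitive p q (wkb_rate V z (Suc j)) (\<lambda>t. F' (1 / csqrt (z - V t)) (\<lambda>m. D m t))"
    if *: "derivative_chain N V D" "z \<noteq> 0" "Suc j < N" "0 < p" "{p..q} \<subseteq> wkb_domain V z" for N V z D p q
  proof (rule is_primitive_cong)
    show "is_primitive p q (\<lambda>t. F (1 / csqrt (z - V t)) (\<lambda>m. D m t)) (\<lambda>t. F' (1 / csqrt (z - V t)) (\<lambda>m. D m t))"
    proof (rule F'(2))
      show "is_primitive p q (\<lambda>t. 1 / csqrt (z - V t)) (\<lambda>t. (1 / csqrt (z - V t)) ^ 3 * D 1 t / 2)"
        by (rule is_primitive_inverse_csqrt[OF *(1)]) (use * in auto)
      show "\<forall>m\<in>{1..Suc j}. is_primitive p q (D m) (D (Suc m))"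
        using * unfolding derivative_chain_def primitive_on_half_line_def by auto
    qed
    show "F (1 / csqrt (z - V t)) (\<lambda>m. D m t) = wkb_rate V z (Suc j) t" if "t \<in> {p..q}" for t
      using F(2) * that unfolding rate_jet_def by fastforce
  qed simp
  have "(wkb_rate V z (Suc j) has_vector_derivative F' (1 / csqrt (z - V x)) (\<lambda>m. D m x)) (at x)"
    if *: "derivative_chain N V D" "z \<noteq> 0" "Suc (Suc j) < N" "x \<in> wkb_domain V z" for N V z D x
  proof -
    have V: "continuous_on {0<..} V"
      using derivative_chain_continuous_on[OF *(1), of 0] *(1,3) by (simp add: derivative_chain_def)
    obtain p q where pq: "0 < p" "x \<in> {p<..<q}" "{p..q} \<subseteq> wkb_domain V z"
      using wkb_domain_interval[OF V *(4)] .
    show ?thesis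
    proof (rule is_primitive_has_vector_derivative_at[OF prim[OF *(1,2) _ pq(1,3)] _ pq(2)])
      show "continuous_on {p..q} (\<lambda>x. F' (1 / csqrt (z - V x)) (\<lambda>m. D m x))"
      proof (rule jet_continuous_on[OF F'(1)])
        show "continuous_on {p..q} (\<lambda>x. 1 / csqrt (z - V x))"
          by (rule continuous_on_subset[OF wkb_domain_continuous_on(2)[OF V] pq(3)])
        show "\<forall>m\<in>{1..Suc (Suc j)}. continuous_on {p..q} (D m)"
        proof
          fix m assume "m \<in> {1..Suc (Suc j)}"
          then show "continuous_on {p..q} (D m)"
            by (intro derivative_chain_continuous_on[OF *(1)]) (use *(3) pq(1) in auto)
        qed
      qed
    qed (use * in auto)
  qed
  with F'(1) prim show ?thesis unfolding rate_derivative_def by blast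
qed

lemma wkb_rate_0_has_vector_derivative:
  assumes "derivative_chain N V D" "z \<noteq> 0" "2 \<le> N" "x \<in> wkb_domain V z"
  shows "(wkb_rate V z 0 has_vector_derivative (- \<i> / 2) * ((1 / csqrt (z - V x)) * D 1 x)) (at x)"
proof -
  have V: "D 0 = V" using assms(1) by (simp add: derivative_chain_def)
  have "(V has_vector_derivative D 1 x) (at x)"
    using derivative_chain_has_vector_derivative[OF assms(1), of 0 x] assms(3) wkb_domainD(1)[OF assms(4)] V by simp
  from csqrt_has_vector_derivative[OF this wkb_domainD(2)[OF assms(4)]]
  have "((\<lambda>t. \<i> * csqrt (z - V t)) has_vector_derivative \<i> * (- D 1 x / (2 * csqrt (z - V x)))) (at x)"
    by (rule has_vector_derivative_mult_right)
  then show ?thesis by (simp add: mult_ac wkb_rate_0[OF assms(2), abs_def])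
qed

text \<open>Every step of the recursion divides by \<open>P\<^sub>0 = i / R\<close>, that is, multiplies by \<open>R\<close>, and differentiates or
  multiplies lower jets; the gradings add up to \<open>(j + 1, j)\<close>.\<close>

lemma wkb_rate_is_jet: "\<exists>F. jet (Suc j) (int j) F \<and> rate_jet (Suc j) F"
proof (induction j rule: less_induct)
  case (less j)
  show ?case
  proof (cases j)
    case 0
    let ?F = "\<lambda>R D. (-1/4) * (R * (R * (D 1 * 1)))"
    have "jet 1 0 ?F"
      by (rule jet_scale, rule jet_weight_cong[OF jet.mult_R[OF jet.mult_R[OF jet.mult_D[OF jet.const]]]]) auto
    moreover have "rate_jet 1 ?F"
      unfolding rate_jet_def
    proof (intro allI impI ballI)
      fix N V z D x
      assume *: "derivative_chain N V D" "z \<noteq> 0" "1 < N" "2 \<le> N" "x \<in> wkb_domain V z"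
      note d = wkb_rate_0_has_vector_derivative[OF *(1,2,4,5)]
      have "wkb_rate V z 1 x = 1 / (2 * (\<i> * csqrt (z - V x))) * ((- \<i> / 2) * ((1 / csqrt (z - V x)) * D 1 x))"
        using wkb_rate_Suc[OF *(2,5) d] by (simp add: wkb_rate_0[OF *(2)])
      also have "\<dots> = (-1/4) * ((1 / csqrt (z - V x)) * ((1 / csqrt (z - V x)) * (D 1 x * 1)))"
        using wkb_domainD(4)[OF *(5)] by (simp add: field_simps)
      finally show "wkb_rate V z 1 x = \<dots>" .
    qed
    ultimately show ?thesis using 0 by auto
  next
    case (Suc k)
    have "\<forall>i\<le>k. \<exists>F. jet (Suc i) (int i) F \<and> rate_jet (Suc i) F" using less Suc by auto
    then obtain F where F: "\<And>i. i \<le> k \<Longrightarrow> jet (Suc i) (int i) (F i)" "\<And>i. i \<le> k \<Longrightarrow> rate_jet (Suc i) (F i)"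
      by metis
    obtain F' where F': "jet (Suc (Suc k)) (int k) F'" "rate_derivative (Suc k) F'"
      using wkb_rate_jet_derivative[OF F(1)[OF order_refl] F(2)[OF order_refl]] by blast
    let ?F = "\<lambda>R D. (1 / (2 * \<i>)) * (R * (F' R D + (-1) * (\<Sum>i\<in>{..<Suc k}. F i R D * F (k - i) R D)))"
    have "jet (Suc (Suc k)) (int k) (\<lambda>R D. F i R D * F (k - i) R D)" if "i < Suc k" for i
      by (rule jet_weight_cong[OF jet_mult[OF F(1) F(1)]]) (use that in auto)
    then have "jet (Suc (Suc k)) (int k + 1) ?F"
      by (intro jet_scale jet.mult_R jet.add F'(1) jet_sum) auto
    then have "jet (Suc j) (int j) ?F" using Suc by (simp add: add.commute)
    moreover have "rate_jet (Suc j) ?F"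
      unfolding rate_jet_def
    proof (intro allI impI ballI)
      fix N V z D x
      assume *: "derivative_chain N V D" "z \<noteq> 0" "Suc j < N" "2 \<le> N" "x \<in> wkb_domain V z"
      let ?R = "1 / csqrt (z - V x)" and ?D = "\<lambda>m. D m x"
      have FF: "wkb_rate V z (Suc i) x = F i ?R ?D" if "i \<le> k" for i
        using F(2)[OF that] * Suc that unfolding rate_jet_def by auto
      have S: "(\<Sum>i<Suc k. wkb_rate V z (Suc i) x * wkb_rate V z (Suc k - i) x)
          = (\<Sum>i<Suc k. F i ?R ?D * F (k - i) ?R ?D)"
        by (intro sum.cong) (auto simp: FF Suc_diff_le)
      have "wkb_rate V z (Suc j) x = 1 / (2 * wkb_rate V z 0 x) *
          (F' ?R ?D - (\<Sum>i<Suc k. F i ?R ?D * F (k - i) ?R ?D))"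
      proof -
        have "(wkb_rate V z (Suc k) has_vector_derivative F' ?R ?D) (at x)"
          using F'(2) * Suc unfolding rate_derivative_def by auto
        then show ?thesis unfolding Suc S[symmetric] by (rule wkb_rate_Suc[OF *(2,5)])
      qed
      then show "wkb_rate V z (Suc j) x = ?F ?R ?D"
      proof -
        have "1 / (2 * (\<i> * w)) * (A - B) = 1 / (2 * \<i>) * (1 / w * (A + (-1) * B))" for A B w :: complex
          by (simp add: divide_simps)
        then show ?thesis
          using \<open>wkb_rate V z (Suc j) x = _\<close> unfolding wkb_rate_0[OF *(2)] by (simp only:)
      qed
    qed
    ultimately show ?thesis by blast
  qed
qed

section \<open>Truncation of the Riccati equation\<close>

text \<open>The three properties of the rates on which the estimates rest: their derivatives exist almost everywhere, the
  derivatives satisfy the Riccati hierarchy below the top index, and rates and top derivative obey the bounds inherited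
  from their form as jets.\<close>

definition wkb_hierarchy ::
    "nat \<Rightarrow> real \<Rightarrow> (real \<Rightarrow> complex) \<Rightarrow> complex \<Rightarrow> (nat \<Rightarrow> real \<Rightarrow> complex) \<Rightarrow> (nat \<Rightarrow> real \<Rightarrow> complex) \<Rightarrow> bool" where
  "wkb_hierarchy N C V z D P' \<longleftrightarrow>
     (\<forall>j<N. \<forall>p q. 0 < p \<longrightarrow> {p..q} \<subseteq> wkb_domain V z \<longrightarrow> is_primitive p q (wkb_rate V z j) (P' j)) \<and>
     (\<forall>j. Suc j < N \<longrightarrow> (\<forall>x\<in>wkb_domain V z.
        P' j x = (\<Sum>i\<le>Suc j. wkb_rate V z i x * wkb_rate V z (Suc j - i) x))) \<and>
     (\<forall>x\<in>wkb_domain V z. \<forall>r Y \<kappa>. r = 1 / sqrt (cmod (z - V x)) \<longrightarrow> Y \<ge> 0 \<longrightarrow> \<kappa> \<ge> 0 \<longrightarrow>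
        (\<forall>m\<in>{1..N}. cmod (D m x) \<le> Y * \<kappa> ^ m) \<longrightarrow>
        (\<forall>j\<in>{1..<N}. cmod (wkb_rate V z j x) \<le> C * \<kappa> ^ j * r ^ (j - 1) * (\<Sum>l=1..j. (r\<^sup>2 * Y) ^ l)) \<and>
        cmod (P' (N - 1) x) \<le> C * \<kappa> ^ N * r ^ (N - 2) * (\<Sum>l=1..N. (r\<^sup>2 * Y) ^ l))"

text \<open>The constant depends on \<open>N\<close> alone because the jets are universal.\<close>

lemma wkb_hierarchy_exists:
  assumes N: "N \<ge> 2"
  shows "\<exists>C\<ge>0. \<forall>V (z :: complex) D. derivative_chain N V D \<longrightarrow> z \<noteq> 0 \<longrightarrow> (\<exists>P'. wkb_hierarchy N C V z D P')"
proof -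
  obtain F where F: "\<And>j. jet (Suc j) (int j) (F j)" "\<And>j. rate_jet (Suc j) (F j)"
    using wkb_rate_is_jet by metis
  obtain G where G: "\<And>j. jet (Suc (Suc j)) (int j) (G j)" "\<And>j. rate_derivative (Suc j) (G j)"
    using wkb_rate_jet_derivative[OF F] by metis
  define F' where "F' = (\<lambda>j. if j = 0 then (\<lambda>R D. (- \<i> / 2) * (R * D 1)) else G (j - 1))"
  have d0: "rate_derivative 0 (F' 0)"
    unfolding rate_derivative_def F'_def
  proof (intro allI impI conjI ballI)
    fix N V z D p q
    assume *: "derivative_chain N V D" "z \<noteq> 0" "2 \<le> N" "(0::real) < p" "{p..q} \<subseteq> wkb_domain V z"
    show "is_primitive p q (wkb_rate V z 0)
      (\<lambda>t. (if 0 = 0 then \<lambda>R D. - \<i> / 2 * (R * D 1) else G (0 - 1)) (1 / csqrt (z - V t)) (\<lambda>m. D m t))"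
      using is_primitive_csqrt[OF *(1,3,4,5)] unfolding wkb_rate_0[OF *(2), abs_def] by (simp only: refl if_True)
  next
    fix N V z D x
    assume *: "derivative_chain N V D" "z \<noteq> 0" "2 \<le> N" "x \<in> wkb_domain V z"
    show "(wkb_rate V z 0 has_vector_derivative
      (if 0 = 0 then \<lambda>R D. - \<i> / 2 * (R * D 1) else G (0 - 1)) (1 / csqrt (z - V x)) (\<lambda>m. D m x)) (at x)"
      using wkb_rate_0_has_vector_derivative[OF *] by (simp only: refl if_True)
  qed
  have d: "rate_derivative j (F' j)" for j
    using d0 G(2)[of "j - 1"] by (cases j) (auto simp: F'_def)
  define bd where "bd = (\<lambda>s e (H :: complex \<Rightarrow> (nat \<Rightarrow> complex) \<Rightarrow> complex) C. (\<forall>R D Y \<kappa>. R \<noteq> 0 \<longrightarrow> Y \<ge> 0 \<longrightarrow> \<kappa> \<ge> 0 \<longrightarrow>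
     (\<forall>m\<in>{1..s}. cmod (D m) \<le> Y * \<kappa> ^ m) \<longrightarrow>
     norm (H R D) \<le> C * \<kappa> ^ s * (norm R powi e) * (\<Sum>l=min 1 s..s. ((norm R)\<^sup>2 * Y) ^ l)))"
  have "\<exists>C\<ge>0. bd (Suc j) (int j) (F j) C" for j
    using jet_bound[OF F(1)[of j]] unfolding bd_def by blast
  then obtain C1 where C1: "\<And>j. C1 j \<ge> 0" "\<And>j. bd (Suc j) (int j) (F j) (C1 j)" by metis
  obtain C2 where C2: "C2 \<ge> 0" "bd N (int (N - 2)) (F' (N - 1)) C2"
  proof -
    have "jet (Suc (Suc (N - 2))) (int (N - 2)) (G (N - 2))" by (rule G(1))
    moreover have "Suc (Suc (N - 2)) = N" "F' (N - 1) = G (N - 2)"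
      using N by (auto simp: F'_def numeral_2_eq_2)
    ultimately show ?thesis using that jet_bound[of N "int (N - 2)" "G (N - 2)"] unfolding bd_def by auto
  qed
  define C where "C = (\<Sum>j<N. C1 j) + C2"
  have C_ge: "C1 j \<le> C" if "j < N" for j
    unfolding C_def using C1(1) C2(1) that by (intro add_increasing2 member_le_sum) auto
  have C_ge2: "C2 \<le> C" unfolding C_def using C1(1) by (simp add: sum_nonneg)
  have "C \<ge> 0" using C2(1) C_ge2 by simp
  show ?thesis
  proof (intro exI[of _ C] conjI \<open>C \<ge> 0\<close> allI impI)
    fix V D and z :: complex assume ch: "derivative_chain N V D" and z: "z \<noteq> 0"
    define P' where "P' = (\<lambda>j x. F' j (1 / csqrt (z - V x)) (\<lambda>m. D m x))"
    show "\<exists>P'. wkb_hierarchy N C V z D P'"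
      unfolding wkb_hierarchy_def
    proof (rule exI[of _ P'], intro conjI allI impI ballI)
      fix j p q assume "j < N" "(0::real) < p" "{p..q} \<subseteq> wkb_domain V z"
      then show "is_primitive p q (wkb_rate V z j) (P' j)"
        using d[of j] ch z N unfolding rate_derivative_def P'_def by blast
    next
      fix j x assume j: "Suc j < N" and x: "x \<in> wkb_domain V z"
      let ?P = "\<lambda>j. wkb_rate V z j x"
      have "(wkb_rate V z j has_vector_derivative P' j x) (at x)"
        using d[of j] ch z N j x unfolding rate_derivative_def P'_def by auto
      from wkb_rate_Suc[OF z x this]
      have "2 * ?P 0 * ?P (Suc j) = P' j x - (\<Sum>i<j. ?P (Suc i) * ?P (j - i))"
        using wkb_domainD(4)[OF x] by (simp add: wkb_rate_0[OF z])
      moreover have "(\<Sum>i\<le>Suc j. ?P i * ?P (Suc j - i)) = 2 * ?P 0 * ?P (Suc j) + (\<Sum>i<j. ?P (Suc i) * ?P (j - i))"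
      proof -
        have "(\<Sum>i\<le>Suc j. h i) = h 0 + ((\<Sum>i<j. h (Suc i)) + h (Suc j))" for h :: "nat \<Rightarrow> complex"
          unfolding sum.atMost_Suc_shift
          by (simp only: lessThan_Suc_atMost[symmetric] sum.lessThan_Suc)
        from this[of "\<lambda>i. ?P i * ?P (Suc j - i)"] show ?thesis by simp
      qed
      ultimately show "P' j x = (\<Sum>i\<le>Suc j. ?P i * ?P (Suc j - i))" by simp
    next
      fix x r Y \<kappa> assume x: "x \<in> wkb_domain V z" and r: "r = 1 / sqrt (cmod (z - V x))"
        and Y: "(0::real) \<le> Y" "(0::real) \<le> \<kappa>" and Dm: "\<forall>m\<in>{1..N}. cmod (D m x) \<le> Y * \<kappa> ^ m"
      let ?R = "1 / csqrt (z - V x)"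
      have R: "?R \<noteq> 0" "cmod ?R = r" using wkb_domainD(4)[OF x] by (auto simp: norm_divide r)
      have r0: "r \<ge> 0" using r by simp
      { fix j assume j: "j \<in> {1..<N}"
        then obtain k where k: "j = Suc k" by (cases j) auto
        have "wkb_rate V z j x = F k ?R (\<lambda>m. D m x)"
          using F(2)[of k] ch z N x j k unfolding rate_jet_def by auto
        also have "cmod \<dots> \<le> C1 k * \<kappa> ^ Suc k * (r powi int k) * (\<Sum>l=min 1 (Suc k)..Suc k. (r\<^sup>2 * Y) ^ l)"
          using C1(2)[of k] R Y Dm j k unfolding bd_def R(2)[symmetric] by auto
        also have "\<dots> = C1 k * (\<kappa> ^ j * r ^ (j - 1) * (\<Sum>l=1..j. (r\<^sup>2 * Y) ^ l))"
          using k by simp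
        also have "\<dots> \<le> C * (\<kappa> ^ j * r ^ (j - 1) * (\<Sum>l=1..j. (r\<^sup>2 * Y) ^ l))"
          using C_ge[of k] j k Y r0 by (intro mult_right_mono mult_nonneg_nonneg sum_nonneg) auto
        finally show "cmod (wkb_rate V z j x) \<le> C * \<kappa> ^ j * r ^ (j - 1) * (\<Sum>l=1..j. (r\<^sup>2 * Y) ^ l)"
          by (simp only: mult.assoc)
      }
      have "cmod (P' (N - 1) x) \<le> C2 * \<kappa> ^ N * (r powi int (N - 2)) * (\<Sum>l=min 1 N..N. (r\<^sup>2 * Y) ^ l)"
        using C2(2) R Y Dm unfolding bd_def P'_def R(2)[symmetric] by auto
      also have "\<dots> = C2 * (\<kappa> ^ N * r ^ (N - 2) * (\<Sum>l=1..N. (r\<^sup>2 * Y) ^ l))"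
      proof -
        have "min 1 N = 1" using N by simp
        then show ?thesis by (simp only: power_int_of_nat mult.assoc)
      qed
      also have "\<dots> \<le> C * (\<kappa> ^ N * r ^ (N - 2) * (\<Sum>l=1..N. (r\<^sup>2 * Y) ^ l))"
        using C_ge2 Y r0 by (intro mult_right_mono mult_nonneg_nonneg sum_nonneg) auto
      finally show "cmod (P' (N - 1) x) \<le> C * \<kappa> ^ N * r ^ (N - 2) * (\<Sum>l=1..N. (r\<^sup>2 * Y) ^ l)"
        by (simp only: mult.assoc)
    qed
  qed
qed

text \<open>Products with \<open>i + j \<le> n\<close> are grouped by \<open>i + j\<close>; each group but the first cancels one derivative.\<close>

lemma riccati_truncation:
  fixes P P' :: "nat \<Rightarrow> complex"
  assumes "\<And>j. j < n \<Longrightarrow> P' j = (\<Sum>i\<le>Suc j. P i * P (Suc j - i))"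
  shows "(\<Sum>j\<le>n. P' j) - (\<Sum>j\<le>n. P j)\<^sup>2
    = P' n - (P 0)\<^sup>2 - (\<Sum>(i, j)\<in>{(i, j) \<in> {..n} \<times> {..n}. n < i + j}. P i * P j)"
proof -
  let ?A = "{(i, j). i + j \<le> n}" and ?B = "{(i, j) \<in> {..n} \<times> {..n}. n < i + j}"
  have A: "finite ?A" by (rule finite_subset[of _ "{..n} \<times> {..n}"]) auto
  have B: "finite ?B" by (rule finite_subset[of _ "{..n} \<times> {..n}"]) auto
  have "(\<Sum>j\<le>n. P j)\<^sup>2 = (\<Sum>(i, j)\<in>{..n} \<times> {..n}. P i * P j)"
    by (simp add: power2_eq_square sum_product sum.cartesian_product)
  also have "{..n} \<times> {..n} = ?A \<union> ?B" by auto
  also have "(\<Sum>(i, j)\<in>?A \<union> ?B. P i * P j) = (\<Sum>(i, j)\<in>?A. P i * P j) + (\<Sum>(i, j)\<in>?B. P i * P j)"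
    by (rule sum.union_disjoint[OF A B]) auto
  also have "(\<Sum>(i, j)\<in>?A. P i * P j) = (\<Sum>m\<le>n. \<Sum>i\<le>m. P i * P (m - i))"
    by (rule sum.triangle_reindex_eq)
  also have "\<dots> = (P 0)\<^sup>2 + (\<Sum>j<n. P' j)"
    using assms by (subst sum.atMost_shift) (simp add: power2_eq_square)
  finally show ?thesis by (simp add: lessThan_Suc_atMost[symmetric])
qed

text \<open>A product \<open>P\<^sub>i P\<^sub>j\<close> with \<open>i + j = N + k\<close> has order \<open>N + k\<close>, degree \<open>N - 2 + k\<close> and at least two factors that are
  derivatives of \<open>V\<close>, one from each rate, whence the range of \<open>l\<close>; only the top derivative contributes \<open>l = 1\<close>.\<close>

lemma wkb_remainder_bound:
  assumes H: "wkb_hierarchy N C V z D P'" and N: "N \<ge> 2" and C: "C \<ge> 0" and z: "z \<noteq> 0"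
    and x: "x \<in> wkb_domain V z" and r: "r = 1 / sqrt (cmod (z - V x))" and Y: "Y \<ge> 0" "\<kappa> \<ge> 0"
    and Dm: "\<forall>m\<in>{1..N}. cmod (D m x) \<le> Y * \<kappa> ^ m"
    and Z1: "\<kappa> ^ N * r ^ (N - 2) * (r\<^sup>2 * Y) \<le> Z"
    and Z2: "\<And>k l. k \<le> N - 2 \<Longrightarrow> l \<in> {2..N+k} \<Longrightarrow> \<kappa> ^ (N + k) * r ^ (N - 2 + k) * (r\<^sup>2 * Y) ^ l \<le> Z"
  shows "cmod ((\<Sum>j<N. P' j x) - (\<Sum>j<N. wkb_rate V z j x)\<^sup>2 + V x - z) \<le> (C * real N + C\<^sup>2 * real N ^ 4) * Z"
proof -
  have r0: "r \<ge> 0" using r by simp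
  define u where "u = r\<^sup>2 * Y"
  have u0: "u \<ge> 0" using Y by (simp add: u_def)
  let ?P = "\<lambda>j. wkb_rate V z j x"
  have "(\<forall>j\<in>{1..<N}. cmod (wkb_rate V z j x) \<le> C * \<kappa> ^ j * r ^ (j - 1) * (\<Sum>l=1..j. (r\<^sup>2 * Y) ^ l)) \<and>
        cmod (P' (N - 1) x) \<le> C * \<kappa> ^ N * r ^ (N - 2) * (\<Sum>l=1..N. (r\<^sup>2 * Y) ^ l)"
    using H x r Y Dm unfolding wkb_hierarchy_def by blast
  then have Pb: "\<And>j. j \<in> {1..<N} \<Longrightarrow> cmod (?P j) \<le> C * \<kappa> ^ j * r ^ (j - 1) * (\<Sum>l=1..j. u ^ l)"
    and P'b: "cmod (P' (N - 1) x) \<le> C * \<kappa> ^ N * r ^ (N - 2) * (\<Sum>l=1..N. u ^ l)"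
    unfolding u_def by blast+
  have rec: "\<And>j. Suc j < N \<Longrightarrow> P' j x = (\<Sum>i\<le>Suc j. ?P i * ?P (Suc j - i))"
    using H x unfolding wkb_hierarchy_def by blast
  note Z1 = Z1[folded u_def] and Z2 = Z2[folded u_def]
  have Z0: "Z \<ge> 0" by (rule order_trans[OF _ Z1]) (use Y r0 u0 in auto)
  have N1: "{..<N} = {..N - 1}" using N by (auto simp: less_eq_Suc_le)
  have "(\<Sum>j<N. P' j x) - (\<Sum>j<N. ?P j)\<^sup>2 = P' (N - 1) x - (?P 0)\<^sup>2
      - (\<Sum>(i, j)\<in>{(i, j) \<in> {..N-1} \<times> {..N-1}. N - 1 < i + j}. ?P i * ?P j)"
    unfolding N1 by (rule riccati_truncation[of "N - 1" "\<lambda>j. P' j x"]) (use rec in auto)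
  moreover have "(?P 0)\<^sup>2 = V x - z"
    by (simp add: wkb_rate_0[OF z] power_mult_distrib)
  ultimately have eq: "(\<Sum>j<N. P' j x) - (\<Sum>j<N. ?P j)\<^sup>2 + V x - z = P' (N - 1) x
      - (\<Sum>(i, j)\<in>{(i, j) \<in> {..N-1} \<times> {..N-1}. N - 1 < i + j}. ?P i * ?P j)"
    by simp
  have "C * \<kappa> ^ N * r ^ (N - 2) * (\<Sum>l=1..N. u ^ l) = C * (\<Sum>l=1..N. \<kappa> ^ N * r ^ (N - 2) * u ^ l)"
    by (simp add: sum_distrib_left mult.assoc)
  also have "\<dots> \<le> C * (\<Sum>l=1..N. Z)"
  proof (intro mult_left_mono C sum_mono)
    fix l assume l: "l \<in> {1..N}"
    show "\<kappa> ^ N * r ^ (N - 2) * u ^ l \<le> Z"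
    proof (cases "l = 1")
      case True then show ?thesis using Z1 by simp
    next
      case False
      then have "l \<in> {2..N + 0}" using l by auto
      then show ?thesis using Z2[of 0 l] by simp
    qed
  qed
  finally have 1: "cmod (P' (N - 1) x) \<le> C * real N * Z" using P'b by simp
  have pair: "cmod (?P i * ?P j) \<le> C\<^sup>2 * real N ^ 2 * Z"
    if ij: "(i, j) \<in> {(i, j) \<in> {..N-1} \<times> {..N-1}. N - 1 < i + j}" for i j
  proof -
    have i: "i \<in> {1..<N}" and j: "j \<in> {1..<N}" using ij N by auto
    define k where "k = i + j - N"
    have k: "N + k = i + j" "k \<le> N - 2" "N - 2 + k = (i - 1) + (j - 1)"
      using ij i j N by (auto simp: k_def)
    have "cmod (?P i * ?P j) \<le> (C * \<kappa> ^ i * r ^ (i - 1) * (\<Sum>l=1..i. u ^ l)) * (C * \<kappa> ^ j * r ^ (j - 1) * (\<Sum>l=1..j. u ^ l))"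
      unfolding norm_mult by (intro mult_mono Pb i j)
        (use C Y r0 u0 in \<open>auto intro!: mult_nonneg_nonneg sum_nonneg\<close>)
    also have "\<dots> = C\<^sup>2 * (\<Sum>l=1..i. \<Sum>l'=1..j. \<kappa> ^ (N + k) * r ^ (N - 2 + k) * u ^ (l + l'))"
      proof -
      have S: "(\<Sum>l=1..i. u ^ l) * (\<Sum>l=1..j. u ^ l) = (\<Sum>l=1..i. \<Sum>l'=1..j. u ^ (l + l'))"
        by (simp only: sum_product power_add)
      have "(C * \<kappa> ^ i * r ^ (i - 1) * (\<Sum>l=1..i. u ^ l)) * (C * \<kappa> ^ j * r ^ (j - 1) * (\<Sum>l=1..j. u ^ l))
          = C\<^sup>2 * ((\<kappa> ^ (N + k) * r ^ (N - 2 + k)) * ((\<Sum>l=1..i. u ^ l) * (\<Sum>l=1..j. u ^ l)))"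
        unfolding k power_add power2_eq_square by (simp only: mult_ac)
      then show ?thesis unfolding S by (simp only: sum_distrib_left)
    qed
    also have "\<dots> \<le> C\<^sup>2 * (\<Sum>l=1..i. \<Sum>l'=1..j. Z)"
    proof (intro mult_left_mono sum_mono)
      fix l l' assume "l \<in> {1..i}" "l' \<in> {1..j}"
      then have "l + l' \<in> {2..N + k}" unfolding k(1) by auto
      then show "\<kappa> ^ (N + k) * r ^ (N - 2 + k) * u ^ (l + l') \<le> Z" using Z2[OF k(2)] by simp
    qed auto
    also have "\<dots> = C\<^sup>2 * (real i * real j) * Z" by simp
    also have "\<dots> \<le> C\<^sup>2 * (real N * real N) * Z"
      using i j Z0 by (intro mult_left_mono mult_right_mono mult_mono) auto
    finally show ?thesis by (simp add: power2_eq_square mult.assoc)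
  qed
  have "cmod (\<Sum>(i, j)\<in>{(i, j) \<in> {..N-1} \<times> {..N-1}. N - 1 < i + j}. ?P i * ?P j)
      \<le> (\<Sum>ij\<in>{(i, j) \<in> {..N-1} \<times> {..N-1}. N - 1 < i + j}. C\<^sup>2 * real N ^ 2 * Z)"
    by (intro sum_norm_le) (use pair in auto)
  also have "\<dots> = real (card {(i, j) \<in> {..N-1} \<times> {..N-1}. N - 1 < i + j}) * (C\<^sup>2 * real N ^ 2 * Z)" by simp
  also have "\<dots> \<le> real (N * N) * (C\<^sup>2 * real N ^ 2 * Z)"
  proof (rule mult_right_mono)
    have "card {(i, j) \<in> {..N-1} \<times> {..N-1}. N - 1 < i + j} \<le> card ({..N-1} \<times> {..N-1})"
      by (rule card_mono) auto
    also have "\<dots> = N * N" using N by (simp add: card_cartesian_product)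
    finally show "real (card {(i, j) \<in> {..N-1} \<times> {..N-1}. N - 1 < i + j}) \<le> real (N * N)" by (simp only: of_nat_mono)
  qed (use Z0 in auto)
  finally have 2: "cmod (\<Sum>(i, j)\<in>{(i, j) \<in> {..N-1} \<times> {..N-1}. N - 1 < i + j}. ?P i * ?P j)
      \<le> C\<^sup>2 * real N ^ 4 * Z"
    by (simp add: power4_eq_xxxx power2_eq_square mult_ac)
  have "cmod ((\<Sum>j<N. P' j x) - (\<Sum>j<N. ?P j)\<^sup>2 + V x - z) \<le> C * real N * Z + C\<^sup>2 * real N ^ 4 * Z"
    unfolding eq by (rule order_trans[OF norm_triangle_ineq4 add_mono[OF 1 2]])
  then show ?thesis by (simp only: distrib_right)
qed

section \<open>Second derivatives and norms of compactly supported functions\<close>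

lemma primitive_on_half_line_zero_extension:
  assumes "is_primitive p q u h" "p \<le> q" "u p = 0" "u q = 0"
  shows "primitive_on_half_line (\<lambda>x. if x \<in> {p..q} then u x else 0) (\<lambda>x. if x \<in> {p..q} then h x else 0)"
  unfolding primitive_on_half_line_def
proof (intro allI impI)
  fix a b :: real
  let ?u = "\<lambda>x. if x \<in> {p..q} then u x else 0" and ?h = "\<lambda>x. if x \<in> {p..q} then h x else 0"
  have "?h absolutely_integrable_on UNIV"
    using is_primitive_abs_integrable[OF assms(1)] by (simp only: absolutely_integrable_restrict_UNIV)
  then have "?h absolutely_integrable_on {a..b}" by (rule set_integrable_subset) auto
  then have m: "?h \<in> borel_measurable (lebesgue_on {a..b})"
    by (rule absolutely_integrable_imp_borel_measurable) auto
  obtain B where B: "B \<ge> 0" "\<And>t. t \<in> {p..q} \<Longrightarrow> norm (h t) \<le> B"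
    using is_primitive_lipschitz[OF assms(1)] by metis
  have "(?h has_integral (?u y - ?u x)) {x..y}" if xy: "x \<le> y" for x y
    unfolding has_integral_restrict_Int Int_atLeastAtMost
  proof (cases "max p x \<le> min q y")
    case True
    have "(h has_integral (u (min q y) - u (max p x))) {max p x..min q y}"
      using assms(1) True unfolding is_primitive_def by auto
    moreover have "u (min q y) = ?u y" "u (max p x) = ?u x"
      using True assms(3,4) by (auto simp: min_def max_def split: if_splits)
    ultimately show "(h has_integral (?u y - ?u x)) {max p x..min q y}" by simp
  next
    case False
    then have "{max p x..min q y} = {}" "?u y - ?u x = 0" using xy assms(2) by (auto simp: max_def min_def split: if_splits)
    then show "(h has_integral (?u y - ?u x)) {max p x..min q y}" by (simp only: has_integral_empty)
  qed
  then show "is_primitive a b ?u ?h"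
    unfolding is_primitive_def using m B by (intro conjI exI[of _ B]) auto
qed

lemma has_weak_deriv_2I:
  assumes "primitive_on_half_line f f1" "primitive_on_half_line f1 f2"
  shows "has_weak_deriv {0<..} 2 f f2"
proof -
  have p: "\<And>p q. 0 < p \<Longrightarrow> is_primitive p q f f1" "\<And>p q. 0 < p \<Longrightarrow> is_primitive p q f1 f2"
    using assms unfolding primitive_on_half_line_def by blast+
  have li: "locally_integrable {0<..} f" "locally_integrable {0<..} f2"
    using is_primitive_imp_locally_integrable p by blast+
  have "(LINT x:{0<..}|lebesgue. (deriv ^^ 2) \<phi> x *\<^sub>R f x) = (-1) ^ 2 * (LINT x:{0<..}|lebesgue. \<phi> x *\<^sub>R f2 x)"
    if \<phi>: "test_function {0<..} \<phi>" for \<phi>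
  proof -
    have "(LINT x:{0<..}|lebesgue. deriv (deriv \<phi>) x *\<^sub>R f x) = - (LINT x:{0<..}|lebesgue. deriv \<phi> x *\<^sub>R f1 x)"
      by (rule integration_by_parts_test_function[OF p(1)]) (use test_function_deriv[OF \<phi>] in auto)
    also have "\<dots> = (LINT x:{0<..}|lebesgue. \<phi> x *\<^sub>R f2 x)"
      using integration_by_parts_test_function[OF p(2) \<phi>] by simp
    finally show ?thesis by (simp add: numeral_2_eq_2)
  qed
  then show ?thesis using li unfolding has_weak_deriv_def by blast
qed

text \<open>On an interval containing the turning point the exponent vanishes at the turning point and has the sum of
  the rates as derivative.\<close>

lemma wkb_is_primitive:
  assumes z: "z \<noteq> 0" and X: "turning_point V (Im z) = X" "X \<in> {p..q}"
    and cont: "\<And>j. j \<le> n \<Longrightarrow> continuous_on {p..q} (wkb_rate V z j)"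
  shows "is_primitive p q (wkb n V z) (\<lambda>x. - (\<Sum>j\<le>n. wkb_rate V z j x) * wkb n V z x)"
    and "\<exists>Q. Q X = 0 \<and> (\<forall>x. wkb n V z x = exp (- Q x)) \<and>
      (\<forall>x\<in>{p..q}. (Q has_vector_derivative (\<Sum>j\<le>n. wkb_rate V z j x)) (at x within {p..q}))"
proof -
  define c where "c = (\<lambda>j::nat. z powr (- (of_nat j - 1) / 2))"
  have cnz: "c j \<noteq> 0" for j using z by (simp add: c_def)
  have rate: "wkb_rate V z j x = c j * dpsi V z j x" for j x by (simp only: wkb_rate_def c_def)
  define Q where "Q = (\<lambda>x. \<Sum>j\<le>n. c j * (LBINT t=ereal X..ereal x. dpsi V z j t))"
  have gQ: "wkb n V z x = exp (- Q x)" for x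
    unfolding wkb_def Q_def X(1) c_def atMost_atLeast0 ..
  have dc: "continuous_on {p..q} (dpsi V z j)" if "j \<le> n" for j
  proof -
    have "continuous_on {p..q} (\<lambda>x. inverse (c j) * wkb_rate V z j x)"
      by (intro continuous_on_mult continuous_on_const cont that)
    moreover have "(\<lambda>x. inverse (c j) * wkb_rate V z j x) = dpsi V z j"
      using cnz[of j] by (simp add: rate fun_eq_iff del: dpsi.simps)
    ultimately show ?thesis by (simp only:)
  qed
  have Q': "(Q has_vector_derivative (\<Sum>j\<le>n. wkb_rate V z j x)) (at x within {p..q})" if x: "x \<in> {p..q}" for x
    unfolding Q_def wkb_rate_def c_def
  proof (rule has_vector_derivative_sum)
    fix j assume "j \<in> {..n}"
    then have "((\<lambda>x. LBINT t=ereal X..ereal x. dpsi V z j t) has_vector_derivative dpsi V z j x) (at x within {p..q})"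
      using X(2) x by (intro interval_integral_FTC2 dc) auto
    then show "((\<lambda>x. z powr (- (of_nat j - 1) / 2) * (LBINT t=ereal X..ereal x. dpsi V z j t))
        has_vector_derivative z powr (- (of_nat j - 1) / 2) * dpsi V z j x) (at x within {p..q})"
      by (rule has_vector_derivative_mult_right)
  qed
  have Q0: "Q X = 0" by (simp add: Q_def)
  have g': "((\<lambda>x. wkb n V z x) has_vector_derivative - (\<Sum>j\<le>n. wkb_rate V z j x) * wkb n V z x) (at x within {p..q})"
    if x: "x \<in> {p..q}" for x
  proof -
    have "((\<lambda>w. exp (- w)) has_field_derivative - exp (- Q x)) (at (Q x) within Q ` {p..q})"
      by (auto intro!: derivative_eq_intros)
    from field_vector_diff_chain_within[OF Q'[OF x] this]
    show ?thesis by (simp add: o_def gQ)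
  qed
  have gc: "continuous_on {p..q} (wkb n V z)"
    using g' by (intro continuous_on_vector_derivative) blast
  show "is_primitive p q (wkb n V z) (\<lambda>x. - (\<Sum>j\<le>n. wkb_rate V z j x) * wkb n V z x)"
    by (rule is_primitive_classical[OF g'])
      (auto intro!: continuous_on_mult continuous_on_minus continuous_on_sum cont gc)
  show "\<exists>Q. Q X = 0 \<and> (\<forall>x. wkb n V z x = exp (- Q x)) \<and>
      (\<forall>x\<in>{p..q}. (Q has_vector_derivative (\<Sum>j\<le>n. wkb_rate V z j x)) (at x within {p..q}))"
    using Q0 gQ Q' by blast
qed

text \<open>Two applications of the product rule, with \<open>g' = - S g\<close>. The function and its derivative vanish at both ends
  of the interval together with the cut-off, so the extension by zero creates no singular part.\<close>

lemma cutoff_times_exponential_second_derivative: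
  fixes \<xi> :: "real \<Rightarrow> real"
  assumes g: "is_primitive p q g (\<lambda>x. - S x * g x)" and S: "is_primitive p q S S'"
    and \<xi>: "test_function {0<..} \<xi>" "\<And>x. x \<notin> {p<..<q} \<Longrightarrow> \<xi> x = 0" and pq: "0 < p" "p \<le> q"
  shows "has_weak_deriv {0<..} 2 (\<lambda>x. of_real (\<xi> x) * g x)
     (\<lambda>x. if x \<in> {p..q} then (of_real (deriv (deriv \<xi>) x) - 2 * of_real (deriv \<xi> x) * S x
        - of_real (\<xi> x) * (S' x - (S x)\<^sup>2)) * g x else 0)"
    (is "has_weak_deriv _ _ ?f ?f2")
proof -
  have \<xi>1: "test_function {0<..} (deriv \<xi>)" using test_function_deriv[OF \<xi>(1)] by simp
  note pr = is_primitive_of_real_test[OF \<xi>(1), of p q] is_primitive_of_real_test[OF \<xi>1, of p q]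
  have \<xi>pq: "\<xi> p = 0" "\<xi> q = 0" using \<xi>(2) by auto
  have \<xi>'pq: "deriv \<xi> p = 0" "deriv \<xi> q = 0"
  proof -
    have "deriv \<xi> x = 0" if "x \<notin> {p..q}" for x
    proof -
      have "((\<lambda>_. 0) has_field_derivative 0) (at x)" by simp
      then have "(\<xi> has_field_derivative 0) (at x)"
        by (rule has_field_derivative_transform_within_open[where S="- {p..q}"])
          (use that \<xi>(2) in \<open>auto intro!: open_Compl\<close>)
      then show ?thesis by (rule DERIV_imp_deriv)
    qed
    then have "{..<p} \<subseteq> {x. deriv \<xi> x = 0}" "{q<..} \<subseteq> {x. deriv \<xi> x = 0}" by auto
    moreover have "closed {x. deriv \<xi> x = 0}"
      by (intro closed_Collect_eq continuous_on_const times_differentiable_continuous_on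
          test_functionD(1)[OF \<xi>1])
    ultimately have "closure {..<p} \<subseteq> {x. deriv \<xi> x = 0}" "closure {q<..} \<subseteq> {x. deriv \<xi> x = 0}"
      by (simp_all only: closure_minimal)
    then show "deriv \<xi> p = 0" "deriv \<xi> q = 0" by auto
  qed
  define f1 where "f1 = (\<lambda>x. of_real (deriv \<xi> x) * g x + (-1) * (of_real (\<xi> x) * (S x * g x)))"
  have 1: "is_primitive p q (\<lambda>x. of_real (\<xi> x) * g x) f1"
    using is_primitive_mult[OF pr(1) g] by (rule is_primitive_eqI) (simp_all add: f1_def algebra_simps)
  have 2: "is_primitive p q f1 (\<lambda>x. (of_real (deriv (deriv \<xi>) x) - 2 * of_real (deriv \<xi> x) * S x
        - of_real (\<xi> x) * (S' x - (S x)\<^sup>2)) * g x)"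
    unfolding f1_def
    using is_primitive_add[OF is_primitive_mult[OF pr(2) g]
        is_primitive_mult[OF is_primitive_const[of p q "-1"] is_primitive_mult[OF pr(1) is_primitive_mult[OF S g]]]]
    by (rule is_primitive_eqI) (simp_all add: algebra_simps power2_eq_square)
  have eq: "?f = (\<lambda>x. if x \<in> {p..q} then of_real (\<xi> x) * g x else 0)"
    using \<xi>(2) by (auto simp: fun_eq_iff)
  have 3: "primitive_on_half_line (\<lambda>x. if x \<in> {p..q} then of_real (\<xi> x) * g x else 0)
      (\<lambda>x. if x \<in> {p..q} then f1 x else 0)"
    by (rule primitive_on_half_line_zero_extension[OF 1 pq(2)]) (simp_all add: \<xi>pq)
  have 4: "primitive_on_half_line (\<lambda>x. if x \<in> {p..q} then f1 x else 0) ?f2"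
    by (rule primitive_on_half_line_zero_extension[OF 2 pq(2)]) (simp_all add: \<xi>pq \<xi>'pq f1_def)
  show ?thesis unfolding eq by (rule has_weak_deriv_2I[OF 3 4])
qed

lemma L2_norm_half_supported:
  assumes f: "AE x in lebesgue. x > 0 \<longrightarrow> f x = (if x \<in> {p..q} then u x else 0)" and p: "0 < p"
    and m: "u \<in> borel_measurable (lebesgue_on {p..q})" and B': "\<forall>t\<in>{p..q}. norm (u t) \<le> B"
  shows "in_L2 f" and "L2_norm_half f = sqrt (integral {p..q} (\<lambda>x. (cmod (u x))\<^sup>2))"
    and "(\<lambda>x. (cmod (u x))\<^sup>2) integrable_on {p..q}"
proof -
  have B: "\<And>t. t \<in> {p..q} \<Longrightarrow> norm (u t) \<le> B" using B' by blast
  have m2: "(\<lambda>x. (cmod (u x))\<^sup>2) \<in> borel_measurable (lebesgue_on {p..q})"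
    by (rule borel_measurable_power[OF measurable_compose[OF m borel_measurable_norm]])
  have ai: "(\<lambda>x. (cmod (u x))\<^sup>2) absolutely_integrable_on {p..q}"
    by (rule measurable_bounded_by_integrable_imp_absolutely_integrable[OF m2, where g="\<lambda>_. B\<^sup>2"])
      (use B in \<open>auto intro!: power_mono\<close>)
  then show "(\<lambda>x. (cmod (u x))\<^sup>2) integrable_on {p..q}" by (simp add: absolutely_integrable_on_def)
  have iu: "integrable lebesgue (\<lambda>x. indicator {p..q} x *\<^sub>R u x)"
    using abs_integrable_bounded_measurable[OF m B] unfolding set_integrable_def .
  have ae1: "AE x in lebesgue. indicator {p..q} x *\<^sub>R u x = indicator {0<..} x *\<^sub>R f x"
    using f by (rule AE_mp) (use p in \<open>auto intro!: AE_I2 simp: indicator_def\<close>)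
  have mf: "(\<lambda>x. indicator {0<..} x *\<^sub>R f x) \<in> borel_measurable lebesgue"
    by (rule borel_measurable_AE[OF borel_measurable_integrable[OF iu] ae1])
  have ae2: "AE x in lebesgue. indicator {p..q} x *\<^sub>R (cmod (u x))\<^sup>2 = indicator {0<..} x *\<^sub>R (cmod (f x))\<^sup>2"
    using f by (rule AE_mp) (use p in \<open>auto intro!: AE_I2 simp: indicator_def\<close>)
  have i2: "integrable lebesgue (\<lambda>x. indicator {p..q} x *\<^sub>R (cmod (u x))\<^sup>2)"
    using ai unfolding set_integrable_def .
  have m3: "(\<lambda>x. indicator {0<..} x *\<^sub>R (cmod (f x))\<^sup>2) \<in> borel_measurable lebesgue"
    by (rule borel_measurable_AE[OF borel_measurable_integrable[OF i2] ae2])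
  have "set_integrable lebesgue {0<..} (\<lambda>x. (cmod (f x))\<^sup>2)"
    unfolding set_integrable_def by (rule integrable_cong_AE_imp[OF i2 m3 ae2])
  then show "in_L2 f" unfolding in_L2_def set_borel_measurable_def using mf by blast
  have "(LINT x:{0<..}|lebesgue. (cmod (f x))\<^sup>2) = (LINT x:{p..q}|lebesgue. (cmod (u x))\<^sup>2)"
    unfolding set_lebesgue_integral_def
    by (rule integral_cong_AE[OF m3 borel_measurable_integrable[OF i2]]) (use ae2 in \<open>auto elim: AE_mp\<close>)
  also have "\<dots> = integral {p..q} (\<lambda>x. (cmod (u x))\<^sup>2)"
    by (rule set_lebesgue_integral_eq_integral(2)[OF ai])
  finally show "L2_norm_half f = sqrt (integral {p..q} (\<lambda>x. (cmod (u x))\<^sup>2))"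
    unfolding L2_norm_half_def by simp
qed

section \<open>The size of the pseudomode near the turning point\<close>

lemma nondecreasing_from_interior_derivative:
  fixes f :: "real \<Rightarrow> real"
  assumes "a \<le> c" "continuous_on {a..c} f"
    and "\<And>x. a < x \<Longrightarrow> x < c \<Longrightarrow> (f has_real_derivative f' x) (at x)"
    and "\<And>x. a < x \<Longrightarrow> x < c \<Longrightarrow> 0 \<le> f' x"
  shows "f a \<le> f c"
proof (cases "a = c")
  case False
  then show ?thesis
    using assms by (intro DERIV_nonneg_imp_increasing_open[of a c f]) auto
qed simp

text \<open>Here \<open>s\<close> is the distance from the turning point on one side, \<open>\<rho>\<close> the main part of the logarithmic decay rate of
  the pseudomode and \<open>\<eta>\<close> the corrections. The bound on \<open>\<eta>\<close> has the explicit antiderivative \<open>\<phi>\<close>, which is only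
  logarithmically large on the whole window. The decay in the third bound is collected on the quarter of the window
  between \<open>\<delta> / 2\<close> and \<open>3 \<delta> / 4\<close>.\<close>

lemma one_sided_exponent_bounds:
  fixes h \<rho> \<eta> :: "real \<Rightarrow> real"
  assumes pos: "0 < \<delta>" "0 < \<kappa>" "0 < b" "0 < \<mu>" "0 \<le> C" "0 \<le> m" and \<delta>: "\<delta> = 1 / (2 * \<kappa>)"
    and h0: "h 0 = 0" and hc: "continuous_on {0..\<delta>} h"
    and h': "\<And>s. 0 < s \<Longrightarrow> s < \<delta> \<Longrightarrow> (h has_real_derivative \<rho> s + \<eta> s) (at s)"
    and \<rho>: "\<And>s. 0 < s \<Longrightarrow> s < \<delta> \<Longrightarrow> 0 \<le> \<rho> s \<and> \<rho> s \<le> B"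
    and \<rho>m: "\<And>s. \<delta> / 2 \<le> s \<Longrightarrow> s < \<delta> \<Longrightarrow> m \<le> \<rho> s"
    and \<eta>: "\<And>s. 0 < s \<Longrightarrow> s < \<delta> \<Longrightarrow> \<bar>\<eta> s\<bar> \<le> C * (\<kappa> + b * \<kappa> / (\<mu> + b * \<kappa> * s))"
    and s: "0 \<le> s" "s \<le> \<delta>"
  shows "- (C * (1 + ln (1 + b / \<mu>))) \<le> h s"
    and "h s \<le> B * s + C * (1 + ln (1 + b / \<mu>))"
    and "3 * \<delta> / 4 \<le> s \<Longrightarrow> m * \<delta> / 4 - C * (1 + ln (1 + b / \<mu>)) \<le> h s"
proof -
  define \<phi> where "\<phi> = (\<lambda>s. C * (\<kappa> * s + (ln (\<mu> + b * \<kappa> * s) - ln \<mu>)))"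
  have pp: "\<mu> + b * \<kappa> * s > 0" if "s \<ge> 0" for s using pos that by (simp add: add_pos_nonneg)
  have \<phi>': "(\<phi> has_real_derivative C * (\<kappa> + b * \<kappa> / (\<mu> + b * \<kappa> * s))) (at s)" if "s \<ge> 0" for s
    unfolding \<phi>_def using pp[OF that] by (auto intro!: derivative_eq_intros)
  have \<phi>c: "continuous_on {x..y} \<phi>" if "x \<ge> 0" for x y
    by (intro continuous_at_imp_continuous_on ballI) (rule DERIV_isCont[OF \<phi>'], use that in auto)
  have \<phi>0: "\<phi> 0 = 0" by (simp add: \<phi>_def)
  have \<phi>b: "\<phi> s \<le> C * (1 + ln (1 + b / \<mu>))" if "0 \<le> s" "s \<le> \<delta>" for s
  proof -
    have "\<kappa> * s \<le> \<kappa> * \<delta>" using that pos by simp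
    also have "\<dots> = 1 / 2" using pos by (simp add: \<delta>)
    finally have ks: "\<kappa> * s \<le> 1 / 2" .
    have "b * (\<kappa> * s) \<le> b * 1" using ks pos by (intro mult_left_mono) auto
    then have "\<mu> + b * \<kappa> * s \<le> \<mu> + b" by (simp add: mult.assoc)
    also have "\<dots> = \<mu> * (1 + b / \<mu>)" using pos by (simp add: field_simps)
    finally have "ln (\<mu> + b * \<kappa> * s) \<le> ln (\<mu> * (1 + b / \<mu>))" using pp[OF that(1)] by (simp add: ln_mono)
    also have "\<dots> = ln \<mu> + ln (1 + b / \<mu>)" using pos by (intro ln_mult_pos) (auto simp: add_pos_pos)
    finally show ?thesis unfolding \<phi>_def using ks pos by (intro mult_left_mono) auto
  qed
  have mono1: "h x + \<phi> x \<le> h y + \<phi> y" if "0 \<le> x" "x \<le> y" "y \<le> \<delta>" for x y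
  proof (rule nondecreasing_from_interior_derivative[where f="\<lambda>s. h s + \<phi> s", OF that(2)])
    show "continuous_on {x..y} (\<lambda>s. h s + \<phi> s)"
      by (intro continuous_on_add \<phi>c continuous_on_subset[OF hc]) (use that in auto)
    fix t assume t: "x < t" "t < y"
    then have t': "0 < t" "t < \<delta>" using that by auto
    show "((\<lambda>s. h s + \<phi> s) has_real_derivative (\<rho> t + \<eta> t) + C * (\<kappa> + b * \<kappa> / (\<mu> + b * \<kappa> * t))) (at t)"
      by (rule DERIV_add[OF h'[OF t'] \<phi>']) (use t' in auto)
    show "0 \<le> (\<rho> t + \<eta> t) + C * (\<kappa> + b * \<kappa> / (\<mu> + b * \<kappa> * t))" using \<rho>[OF t'] \<eta>[OF t'] by linarith
  qed
  show low: "- (C * (1 + ln (1 + b / \<mu>))) \<le> h s"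
    using mono1[of 0 s] s \<phi>b[OF s] by (simp add: \<phi>0 h0)
  have "B * 0 - h 0 + \<phi> 0 \<le> B * s - h s + \<phi> s"
  proof (rule nondecreasing_from_interior_derivative[where f="\<lambda>s. B * s - h s + \<phi> s", OF s(1)])
    show "continuous_on {0..s} (\<lambda>s. B * s - h s + \<phi> s)"
      by (intro continuous_on_add continuous_on_diff continuous_on_mult continuous_on_const continuous_on_id
          \<phi>c continuous_on_subset[OF hc]) (use s in auto)
    fix t assume t: "0 < t" "t < s"
    then have t': "0 < t" "t < \<delta>" using s by auto
    show "((\<lambda>s. B * s - h s + \<phi> s) has_real_derivative B * 1 - (\<rho> t + \<eta> t) + C * (\<kappa> + b * \<kappa> / (\<mu> + b * \<kappa> * t))) (at t)"
      by (intro DERIV_add DERIV_diff DERIV_cmult DERIV_ident h' \<phi>') (use t' in auto)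
    show "0 \<le> B * 1 - (\<rho> t + \<eta> t) + C * (\<kappa> + b * \<kappa> / (\<mu> + b * \<kappa> * t))" using \<rho>[OF t'] \<eta>[OF t'] by linarith
  qed
  then show "h s \<le> B * s + C * (1 + ln (1 + b / \<mu>))" using \<phi>b[OF s] by (simp add: h0 \<phi>0)
  assume s34: "3 * \<delta> / 4 \<le> s"
  have "h (\<delta> / 2) + \<phi> (\<delta> / 2) - m * (\<delta> / 2) \<le> h s + \<phi> s - m * s"
  proof (rule nondecreasing_from_interior_derivative[where f="\<lambda>s. h s + \<phi> s - m * s" and a="\<delta> / 2" and c=s])
    show "\<delta> / 2 \<le> s" using s34 pos by simp
    show "continuous_on {\<delta> / 2..s} (\<lambda>s. h s + \<phi> s - m * s)"
      by (intro continuous_on_add continuous_on_diff continuous_on_mult continuous_on_const continuous_on_id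
          \<phi>c continuous_on_subset[OF hc]) (use s pos in auto)
    fix t assume t: "\<delta> / 2 < t" "t < s"
    then have t': "0 < t" "t < \<delta>" using s pos by auto
    show "((\<lambda>s. h s + \<phi> s - m * s) has_real_derivative (\<rho> t + \<eta> t) + C * (\<kappa> + b * \<kappa> / (\<mu> + b * \<kappa> * t)) - m * 1) (at t)"
      by (intro DERIV_add DERIV_diff DERIV_cmult DERIV_ident h' \<phi>') (use t' in auto)
    show "0 \<le> (\<rho> t + \<eta> t) + C * (\<kappa> + b * \<kappa> / (\<mu> + b * \<kappa> * t)) - m * 1"
      using \<rho>m[of t] \<eta>[OF t'] t t' by linarith
  qed
  moreover have "0 \<le> h (\<delta> / 2) + \<phi> (\<delta> / 2)" using mono1[of 0 "\<delta> / 2"] pos by (simp add: h0 \<phi>0)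
  moreover have "m * (3 * \<delta> / 4) \<le> m * s" using s34 pos by (intro mult_left_mono) auto
  ultimately show "m * \<delta> / 4 - C * (1 + ln (1 + b / \<mu>)) \<le> h s" using \<phi>b[OF s] by simp
qed

text \<open>The situation on the window of half-width \<open>\<delta>\<close> around the turning point \<open>X\<close>, with one constant \<open>K\<close> for all
  comparisons. The number \<open>\<kappa>\<close> stands for \<open>X\<^sup>\<nu>\<close>, the inverse length scale on which \<open>V\<close> varies; \<open>\<mu>\<close> is the lower bound
  on the gap \<open>a - Re V\<close> contained in the admissibility condition, and \<open>T\<^sup>2\<close> is an upper bound for both the gap and \<open>b\<close>,
  so that \<open>T\<close> bounds the root of \<open>|z - V|\<close>.\<close>

locale wkb_window =
  fixes N :: nat and V :: "real \<Rightarrow> complex" and D :: "nat \<Rightarrow> real \<Rightarrow> complex"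
    and a b X \<kappa> \<delta> K T \<mu> :: real
  assumes N: "N \<ge> 2" and chain: "derivative_chain N V D" and K: "K \<ge> 1"
    and b: "b \<ge> 1" and \<kappa>: "\<kappa> > 0" and \<delta>: "\<delta> = 1 / (2 * \<kappa>)" and X: "0 < X - \<delta>" and T: "T > 0"
    and tp: "turning_point V b = X"
    and D_bound: "\<And>t m. t \<in> {X-\<delta>..X+\<delta>} \<Longrightarrow> m \<in> {1..N} \<Longrightarrow> cmod (D m t) \<le> K * (b + \<bar>Re (V t)\<bar>) * \<kappa> ^ m"
    and Im_right: "\<And>t. t \<in> {X-\<delta>..X+\<delta>} \<Longrightarrow> X \<le> t \<Longrightarrow> b * \<kappa> * (t - X) \<le> K * (Im (V t) - b)"
    and Im_left: "\<And>t. t \<in> {X-\<delta>..X+\<delta>} \<Longrightarrow> t \<le> X \<Longrightarrow> b * \<kappa> * (X - t) \<le> K * (b - Im (V t))"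
    and Im_bound: "\<And>t. t \<in> {X-\<delta>..X+\<delta>} \<Longrightarrow> 0 < Im (V t) \<and> Im (V t) \<le> K * b"
    and \<mu>: "\<mu> = (b * \<kappa>) powr (2 / 3)"
    and gap_lower: "\<And>t. t \<in> {X-\<delta>..X+\<delta>} \<Longrightarrow> \<mu> \<le> K * (a - Re (V t))"
    and Re_bound: "\<And>t. t \<in> {X-\<delta>..X+\<delta>} \<Longrightarrow> \<bar>Re (V t)\<bar> \<le> K * (a - Re (V t))"
    and gap_upper: "\<And>t. t \<in> {X-\<delta>..X+\<delta>} \<Longrightarrow> a - Re (V t) \<le> K * T\<^sup>2"
    and b_upper: "b \<le> K * T\<^sup>2" and \<kappa>_upper: "\<kappa>\<^sup>2 \<le> K * b"
begin

abbreviation "I \<equiv> {X-\<delta>..X+\<delta>}"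
definition z where "z = Complex a b"
definition W where "W t = z - V t"
definition S where "S t = (\<Sum>j<N. wkb_rate V z j t)"

lemma z_nonzero: "z \<noteq> 0"
  using b by (auto simp: z_def complex_eq_iff)

lemma pos: "b > 0" "\<mu> > 0" "\<delta> > 0" "K > 0" "\<kappa> * \<delta> = 1 / 2"
  using b \<kappa> \<mu> \<delta> K by auto

lemma \<mu>_cubed: "\<mu> ^ 3 = (b * \<kappa>)\<^sup>2"
proof -
  have p: "b * \<kappa> > 0" "\<mu> > 0" using b \<kappa> by (auto simp: \<mu>)
  have "\<mu> ^ 3 = \<mu> powr real 3" by (rule powr_realpow[OF p(2), symmetric])
  also have "\<dots> = (b * \<kappa>) powr real 2" unfolding \<mu> powr_powr by simp
  also have "\<dots> = (b * \<kappa>)\<^sup>2" by (rule powr_realpow[OF p(1)])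
  finally show ?thesis .
qed

lemma gap_positive: "t \<in> I \<Longrightarrow> 0 < a - Re (V t)"
  using gap_lower[of t] pos by (metis less_le_trans mult_pos_pos zero_less_mult_pos)

lemma W_parts: "Re (W t) = a - Re (V t)" "Im (W t) = b - Im (V t)"
  by (simp_all add: W_def z_def)

lemma window_subset: "I \<subseteq> wkb_domain V z"
  using X gap_positive by (auto simp: wkb_domain_def z_def)

lemma V_continuous: "continuous_on I V"
proof -
  have "I \<subseteq> {0<..}" using X by auto
  then show ?thesis
    using derivative_chain_continuous_on[OF chain, of 0 I] chain N by (simp add: derivative_chain_def)
qed

lemma gap_le_W: "a - Re (V t) \<le> cmod (W t)"
  using complex_Re_le_cmod[of "W t"] by (simp add: W_parts)

lemma W_positive: "t \<in> I \<Longrightarrow> 0 < cmod (W t)"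
  using gap_positive gap_le_W less_le_trans by blast

lemma Im_W_lower: "t \<in> I \<Longrightarrow> b * \<kappa> * \<bar>t - X\<bar> \<le> K * \<bar>Im (W t)\<bar>"
proof -
  assume t: "t \<in> I"
  show ?thesis
  proof (cases "X \<le> t")
    case True
    have "b * \<kappa> * \<bar>t - X\<bar> \<le> K * (Im (V t) - b)" using Im_right[OF t True] True by simp
    also have "\<dots> \<le> K * \<bar>Im (W t)\<bar>" using pos by (intro mult_left_mono) (auto simp: W_parts)
    finally show ?thesis .
  next
    case False
    have "b * \<kappa> * \<bar>t - X\<bar> \<le> K * (b - Im (V t))" using Im_left[OF t] False by simp
    also have "\<dots> \<le> K * \<bar>Im (W t)\<bar>" using pos by (intro mult_left_mono) (auto simp: W_parts)
    finally show ?thesis .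
  qed
qed

lemma \<mu>_le_W: "t \<in> I \<Longrightarrow> \<mu> \<le> K * cmod (W t)"
  using gap_lower gap_le_W pos by (meson mult_left_mono less_imp_le order_trans)

lemma W_lower: "t \<in> I \<Longrightarrow> \<mu> + b * \<kappa> * \<bar>t - X\<bar> \<le> 2 * K * cmod (W t)"
proof -
  assume t: "t \<in> I"
  have "K * \<bar>Im (W t)\<bar> \<le> K * cmod (W t)" using pos by (intro mult_left_mono abs_Im_le_cmod) auto
  then show ?thesis using \<mu>_le_W[OF t] Im_W_lower[OF t] by simp
qed

lemma W_upper: "t \<in> I \<Longrightarrow> sqrt (cmod (W t)) \<le> 2 * K * T"
proof -
  assume t: "t \<in> I"
  have "\<bar>Im (W t)\<bar> \<le> K * b"
  proof -
    have "b \<le> K * b" using K b by simp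
    moreover have "0 < Im (V t)" "Im (V t) \<le> K * b" using Im_bound[OF t] by auto
    ultimately show ?thesis using b unfolding W_parts by (intro abs_leI) linarith+
  qed
  also have "\<dots> \<le> K * (K * T\<^sup>2)" using pos by (intro mult_left_mono b_upper) auto
  finally have 1: "\<bar>Im (W t)\<bar> \<le> K\<^sup>2 * T\<^sup>2" by (simp add: power2_eq_square)
  have "\<bar>Re (W t)\<bar> \<le> K * T\<^sup>2" using gap_positive[OF t] gap_upper[OF t] by (simp add: W_parts)
  also have "\<dots> \<le> K\<^sup>2 * T\<^sup>2" using K by (intro mult_right_mono) (auto simp: power2_eq_square)
  finally have "cmod (W t) \<le> K\<^sup>2 * T\<^sup>2 + K\<^sup>2 * T\<^sup>2" using cmod_le[of "W t"] 1 by linarith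
  also have "\<dots> \<le> (2 * K * T)\<^sup>2" by (simp add: power_mult_distrib)
  finally show ?thesis using pos T by (intro real_le_lsqrt) auto
qed

lemma coefficient_bound:
  assumes t: "t \<in> I"
  shows "K * (b + \<bar>Re (V t)\<bar>) / cmod (W t) \<le> K\<^sup>2 * (1 + b / cmod (W t))"
proof -
  have L: "cmod (W t) > 0" by (rule W_positive[OF t])
  have "\<bar>Re (V t)\<bar> \<le> K * cmod (W t)"
    using Re_bound[OF t] gap_le_W[of t] pos by (meson mult_left_mono less_imp_le order_trans)
  moreover have "b \<le> K * b" using K b by simp
  ultimately have "K * (b + \<bar>Re (V t)\<bar>) \<le> K * (K * b + K * cmod (W t))"
    using pos by (intro mult_left_mono add_mono) auto
  also have "\<dots> = K\<^sup>2 * (1 + b / cmod (W t)) * cmod (W t)" using L by (simp add: field_simps power2_eq_square)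
  finally show ?thesis using L by (simp add: pos_divide_le_eq)
qed

text \<open>The rates form a series in the parameter \<open>\<kappa> |W|^(-1/2) (1 + b / |W|)\<close>. It is bounded because \<open>|W| \<ge> \<mu> / K\<close> and
  \<open>\<mu>\<^sup>3 = (b \<kappa>)\<^sup>2\<close>: the lower admissibility condition amounts to this requirement, and the part without \<open>b\<close> follows from
  \<open>\<kappa>\<^sup>2 \<le> K b\<close>.\<close>

lemma expansion_parameter_bound:
  assumes t: "t \<in> I"
  shows "\<kappa> * (1 / sqrt (cmod (W t))) * (K\<^sup>2 * (1 + b / cmod (W t))) \<le> 2 * K ^ 4"
proof -
  define L where "L = cmod (W t)"
  have L: "L > 0" using W_positive[OF t] by (simp add: L_def)
  have \<mu>L: "\<mu> \<le> K * L" using \<mu>_le_W[OF t] by (simp add: L_def)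
  then have cube: "(b * \<kappa>)\<^sup>2 \<le> K ^ 3 * L ^ 3"
    unfolding \<mu>_cubed[symmetric] power_mult_distrib[symmetric] using pos by (intro power_mono) auto
  have c1: "b\<^sup>2 * \<kappa>\<^sup>2 / L ^ 3 \<le> K ^ 3" using cube L by (simp add: pos_divide_le_eq power_mult_distrib)
  have c2: "\<kappa>\<^sup>2 / L \<le> K\<^sup>2"
  proof -
    have "(\<kappa>\<^sup>2) ^ 3 = \<kappa>\<^sup>2 * (\<kappa>\<^sup>2)\<^sup>2" by (simp add: power3_eq_cube power2_eq_square)
    also have "\<dots> \<le> \<kappa>\<^sup>2 * (K * b)\<^sup>2" using \<kappa>_upper by (intro mult_left_mono power_mono) auto
    also have "\<dots> = K\<^sup>2 * (b * \<kappa>)\<^sup>2" by (simp add: power_mult_distrib mult_ac)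
    also have "\<dots> \<le> K\<^sup>2 * (K ^ 3 * L ^ 3)" by (intro mult_left_mono cube) auto
    also have "\<dots> \<le> K ^ 3 * (K ^ 3 * L ^ 3)" using K L by (intro mult_right_mono power_increasing) auto
    also have "\<dots> = (K\<^sup>2 * L) ^ 3" by (simp add: power_mult_distrib flip: power_mult power_add)
    finally have "\<kappa>\<^sup>2 \<le> K\<^sup>2 * L" using L K by (intro power_le_imp_le_base[of "\<kappa>\<^sup>2" 2 "K\<^sup>2 * L"]) (auto simp: numeral_3_eq_3)
    then show ?thesis using L by (simp add: pos_divide_le_eq)
  qed
  have "(\<kappa> * (1 / sqrt L) * (K\<^sup>2 * (1 + b / L)))\<^sup>2 = K ^ 4 * (\<kappa>\<^sup>2 / L * (1 + b / L)\<^sup>2)"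
    using L by (simp add: power_mult_distrib power_divide flip: power_mult)
  also have "\<dots> \<le> K ^ 4 * (\<kappa>\<^sup>2 / L * (2 + 2 * (b / L)\<^sup>2))"
  proof (intro mult_left_mono)
    have "(1 + y)\<^sup>2 \<le> 2 + 2 * y\<^sup>2" for y :: real
      using zero_le_power2[of "1 - y"] by (simp add: power2_eq_square algebra_simps)
    then show "(1 + b / L)\<^sup>2 \<le> 2 + 2 * (b / L)\<^sup>2" .
  qed (use L in auto)
  also have "\<dots> = K ^ 4 * (2 * (\<kappa>\<^sup>2 / L) + 2 * (b\<^sup>2 * \<kappa>\<^sup>2 / L ^ 3))"
    using L by (simp add: field_simps power2_eq_square power3_eq_cube)
  also have "\<dots> \<le> K ^ 4 * (2 * K ^ 4 + 2 * K ^ 4)"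
  proof (intro mult_left_mono add_mono)
    show "\<kappa>\<^sup>2 / L \<le> K ^ 4" using c2 power_increasing[of 2 4 K] K by linarith
    show "b\<^sup>2 * \<kappa>\<^sup>2 / L ^ 3 \<le> K ^ 4" using c1 power_increasing[of 3 4 K] K by linarith
  qed auto
  also have "\<dots> = (2 * K ^ 4)\<^sup>2" by (simp add: power2_eq_square)
  finally show ?thesis unfolding L_def[symmetric] by (rule power2_le_imp_le) (use pos in auto)
qed

text \<open>Of the factors \<open>\<kappa> w\<close>, all but one come with a factor \<open>r\<close>, with which they form the bounded expansion parameter.\<close>

lemma higher_rate_bound:
  assumes C: "C \<ge> 0" and H: "wkb_hierarchy N C V z D P'" and t: "t \<in> I" and j: "j \<in> {1..<N}"
  shows "cmod (wkb_rate V z j t) \<le> C * real N * (2 * K ^ 4) ^ N * K\<^sup>2 * (\<kappa> * (1 + b / cmod (W t)))"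
proof -
  define L where "L = cmod (W t)"
  define r where "r = 1 / sqrt L"
  define Y where "Y = K * (b + \<bar>Re (V t)\<bar>)"
  define w where "w = K\<^sup>2 * (1 + b / L)"
  have L: "L > 0" using W_positive[OF t] by (simp add: L_def)
  have r0: "r \<ge> 0" "r\<^sup>2 = 1 / L" using L by (auto simp: r_def power_divide)
  have Y0: "Y \<ge> 0" using K b by (simp add: Y_def)
  have w1: "w \<ge> 1"
  proof -
    have "1 * 1 \<le> K\<^sup>2 * (1 + b / L)" using K b L by (intro mult_mono) (auto simp: one_le_power)
    then show ?thesis by (simp add: w_def)
  qed
  have u: "r\<^sup>2 * Y \<le> w" using coefficient_bound[OF t] by (simp add: r0 Y_def w_def L_def)
  have M: "\<kappa> * r * w \<le> 2 * K ^ 4" using expansion_parameter_bound[OF t] by (simp add: r_def w_def L_def)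
  have M1: "1 \<le> 2 * K ^ 4" using one_le_power[OF K, of 4] by simp
  have Mw0: "0 \<le> \<kappa> * r * w" using \<kappa> r0 w1 by simp
  have D: "\<forall>m\<in>{1..N}. cmod (D m t) \<le> Y * \<kappa> ^ m" using D_bound[OF t] by (simp add: Y_def)
  have tW: "t \<in> wkb_domain V z" using window_subset t by blast
  have "cmod (wkb_rate V z j t) \<le> C * \<kappa> ^ j * r ^ (j - 1) * (\<Sum>l=1..j. (r\<^sup>2 * Y) ^ l)"
    using H tW Y0 \<kappa> D j unfolding wkb_hierarchy_def r_def L_def W_def by simp
  also have "\<dots> \<le> C * \<kappa> ^ j * r ^ (j - 1) * (\<Sum>l=1..j. w ^ j)"
  proof (intro mult_left_mono sum_mono)
    fix l assume l: "l \<in> {1..j}"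
    have "(r\<^sup>2 * Y) ^ l \<le> w ^ l" by (rule power_mono[OF u mult_nonneg_nonneg[OF zero_le_power2 Y0]])
    also have "\<dots> \<le> w ^ j" using w1 l by (intro power_increasing) auto
    finally show "(r\<^sup>2 * Y) ^ l \<le> w ^ j" .
  qed (use C \<kappa> r0 in auto)
  also have "\<dots> = C * real j * (\<kappa> * r * w) ^ (j - 1) * (\<kappa> * w)"
  proof -
    have "\<kappa> ^ j = \<kappa> ^ (j - 1) * \<kappa>" "w ^ j = w ^ (j - 1) * w" using j by (cases j; simp)+
    then show ?thesis by (simp add: power_mult_distrib)
  qed
  also have "\<dots> \<le> C * real N * (2 * K ^ 4) ^ N * (\<kappa> * w)"
  proof (intro mult_right_mono mult_mono)
    have "(\<kappa> * r * w) ^ (j - 1) \<le> (2 * K ^ 4) ^ (j - 1)" by (rule power_mono[OF M Mw0])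
    also have "\<dots> \<le> (2 * K ^ 4) ^ N" using M1 j by (intro power_increasing) auto
    finally show "(\<kappa> * r * w) ^ (j - 1) \<le> (2 * K ^ 4) ^ N" .
  qed (use C j \<kappa> w1 Mw0 in auto)
  also have "\<dots> = C * real N * (2 * K ^ 4) ^ N * K\<^sup>2 * (\<kappa> * (1 + b / L))" by (simp add: w_def)
  finally show ?thesis by (simp add: L_def)
qed

definition correction_const :: "real \<Rightarrow> real" where
  "correction_const C = 2 * K * (C * real N ^ 2 * (2 * K ^ 4) ^ N * K\<^sup>2)"

lemma correction_const_nonneg: "C \<ge> 0 \<Longrightarrow> correction_const C \<ge> 0"
  using K by (simp add: correction_const_def)

text \<open>Since \<open>|W|\<close> is at least a constant times \<open>\<mu> + b \<kappa> |t - X|\<close>, the corrections are integrable up to a logarithm across the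
  turning point.\<close>

lemma correction_bound:
  assumes C: "C \<ge> 0" and H: "wkb_hierarchy N C V z D P'" and t: "t \<in> I"
  shows "cmod (S t - \<i> * csqrt (W t)) \<le> correction_const C * (\<kappa> + b * \<kappa> / (\<mu> + b * \<kappa> * \<bar>t - X\<bar>))"
proof -
  define L where "L = cmod (W t)"
  have L: "L > 0" using W_positive[OF t] by (simp add: L_def)
  define c where "c = C * real N * (2 * K ^ 4) ^ N * K\<^sup>2"
  have c0: "c \<ge> 0" using C K by (simp add: c_def)
  have "S t = wkb_rate V z 0 t + (\<Sum>j=1..<N. wkb_rate V z j t)"
    unfolding S_def using N by (simp add: sum.atLeast_Suc_lessThan lessThan_atLeast0)
  then have "cmod (S t - \<i> * csqrt (W t)) = cmod (\<Sum>j=1..<N. wkb_rate V z j t)"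
    by (simp add: wkb_rate_0[OF z_nonzero] W_def)
  also have "\<dots> \<le> (\<Sum>j=1..<N. c * (\<kappa> * (1 + b / L)))"
    unfolding c_def L_def by (intro sum_norm_le higher_rate_bound[OF C H t])
  also have "\<dots> \<le> real N * (c * (\<kappa> * (1 + b / L)))"
    using c0 \<kappa> b L by (simp add: mult_right_mono)
  also have "\<dots> \<le> real N * (c * (\<kappa> * (2 * K * (1 + b / (\<mu> + b * \<kappa> * \<bar>t - X\<bar>)))))"
  proof (intro mult_left_mono)
    have den: "\<mu> + b * \<kappa> * \<bar>t - X\<bar> > 0" using pos \<kappa> by (simp add: add_pos_nonneg)
    have "b / L \<le> b / ((\<mu> + b * \<kappa> * \<bar>t - X\<bar>) / (2 * K))"
      using W_lower[OF t] den pos L by (intro divide_left_mono) (auto simp: L_def pos_divide_le_eq mult_ac)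
    then have "b / L \<le> 2 * K * (b / (\<mu> + b * \<kappa> * \<bar>t - X\<bar>))" by (simp add: mult_ac)
    then show "1 + b / L \<le> 2 * K * (1 + b / (\<mu> + b * \<kappa> * \<bar>t - X\<bar>))" using K by (simp add: distrib_left)
  qed (use c0 \<kappa> in auto)
  also have "\<dots> = correction_const C * (\<kappa> + b * \<kappa> / (\<mu> + b * \<kappa> * \<bar>t - X\<bar>))"
    by (simp add: correction_const_def c_def power2_eq_square distrib_left mult_ac)
  finally show ?thesis .
qed

text \<open>From \<open>2 Re q Im q = Im W\<close> for the root \<open>q\<close> of \<open>W\<close>, with \<open>Re q > 0\<close>: the imaginary part changes sign at the turning
  point, and it is at least \<open>|Im W| / (2 |q|)\<close>.\<close>

lemma csqrt_W:
  assumes t: "t \<in> I"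
  shows "\<bar>Im (csqrt (W t))\<bar> \<le> 2 * K * T"
    and "X < t \<Longrightarrow> 0 \<le> - Im (csqrt (W t))" and "t < X \<Longrightarrow> 0 \<le> Im (csqrt (W t))"
    and "\<delta> / 2 \<le> \<bar>t - X\<bar> \<Longrightarrow> b / (16 * K\<^sup>2 * T) \<le> \<bar>Im (csqrt (W t))\<bar>"
proof -
  define q where "q = csqrt (W t)"
  have q2: "q\<^sup>2 = W t" by (simp add: q_def)
  have nq: "cmod q \<le> 2 * K * T" using W_upper[OF t] by (simp add: q_def)
  then show "\<bar>Im (csqrt (W t))\<bar> \<le> 2 * K * T" using abs_Im_le_cmod[of q] unfolding q_def by linarith
  have Re0: "Re q \<ge> 0" using csqrt_principal[of "W t"] by (auto simp: q_def)
  have reW: "(Re q)\<^sup>2 - (Im q)\<^sup>2 = Re (W t)" "2 * (Re q * Im q) = Im (W t)"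
    unfolding q2[symmetric] by (simp_all add: power2_eq_square)
  have "Re q \<noteq> 0"
  proof
    assume "Re q = 0"
    then have "Re (W t) = - (Im q)\<^sup>2" using reW(1) by simp
    then have "Re (W t) \<le> 0" using zero_le_power2[of "Im q"] by linarith
    then show False using gap_positive[OF t] by (simp add: W_parts)
  qed
  then have Rp: "Re q > 0" using Re0 by simp
  { assume "X < t"
    then have "0 < b * \<kappa> * (t - X)" using pos \<kappa> by simp
    also have "\<dots> \<le> K * (Im (V t) - b)" using Im_right[OF t] \<open>X < t\<close> by simp
    finally have "Im (W t) < 0" using pos by (simp add: W_parts zero_less_mult_iff)
    then have "Re q * Im q < 0" using reW(2) by simp
    then show "0 \<le> - Im (csqrt (W t))" unfolding q_def[symmetric] using Rp by (simp add: mult_less_0_iff) }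
  { assume "t < X"
    then have "0 < b * \<kappa> * (X - t)" using pos \<kappa> by simp
    also have "\<dots> \<le> K * (b - Im (V t))" using Im_left[OF t] \<open>t < X\<close> by simp
    finally have "0 < Im (W t)" using pos by (simp add: W_parts zero_less_mult_iff)
    then have "0 < Re q * Im q" using reW(2) by simp
    then show "0 \<le> Im (csqrt (W t))" unfolding q_def[symmetric] using Rp by (simp add: zero_less_mult_iff) }
  assume far: "\<delta> / 2 \<le> \<bar>t - X\<bar>"
  have "b / 4 = b * \<kappa> * (\<delta> / 2)" using pos(5) by (simp add: mult.assoc)
  also have "\<dots> \<le> b * \<kappa> * \<bar>t - X\<bar>" using far pos \<kappa> by (intro mult_left_mono) auto
  also have "\<dots> \<le> K * \<bar>Im (W t)\<bar>" by (rule Im_W_lower[OF t])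
  also have "\<dots> = K * (2 * (Re q * \<bar>Im q\<bar>))" unfolding reW(2)[symmetric] using Rp by (simp add: abs_mult)
  also have "\<dots> \<le> K * (2 * ((2 * K * T) * \<bar>Im q\<bar>))"
    using pos nq complex_Re_le_cmod[of q] by (intro mult_left_mono mult_right_mono) auto
  finally have "b \<le> \<bar>Im q\<bar> * (16 * K\<^sup>2 * T)" by (simp add: power2_eq_square mult_ac)
  then show "b / (16 * K\<^sup>2 * T) \<le> \<bar>Im (csqrt (W t))\<bar>"
    unfolding q_def[symmetric] using pos T by (simp add: pos_divide_le_eq)
qed

text \<open>Both sides of the turning point are reduced to the one-sided comparison by reflection, with
  \<open>Re S\<close> split into \<open>- Im (csqrt W)\<close> and the corrections.\<close>

lemma wkb_amplitude_bounds:
  assumes C: "C \<ge> 0" and H: "wkb_hierarchy N C V z D P'" and t: "t \<in> I"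
  defines "\<Phi> \<equiv> correction_const C * (1 + ln (1 + b / \<mu>))"
  shows "cmod (wkb (N - 1) V z t) \<le> exp \<Phi>"
    and "exp (- (2 * K * T * \<bar>t - X\<bar>) - \<Phi>) \<le> cmod (wkb (N - 1) V z t)"
    and "3 * \<delta> / 4 \<le> \<bar>t - X\<bar> \<Longrightarrow> cmod (wkb (N - 1) V z t) \<le> exp (\<Phi> - b / (128 * K\<^sup>2 * \<kappa> * T))"
proof -
  have cont: "continuous_on I (wkb_rate V z j)" if "j \<le> N - 1" for j
  proof -
    have "is_primitive (X-\<delta>) (X+\<delta>) (wkb_rate V z j) (P' j)"
      using H that N X window_subset unfolding wkb_hierarchy_def by auto
    then show ?thesis by (rule is_primitive_continuous_on)
  qed
  have XI: "X \<in> I" using pos by simp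
  have tp': "turning_point V (Im z) = X" using tp by (simp add: z_def)
  have S': "S t = (\<Sum>j\<le>N-1. wkb_rate V z j t)" for t
    unfolding S_def using N by (intro sum.cong) auto
  have "\<exists>Q. Q X = 0 \<and> (\<forall>x. wkb (N - 1) V z x = exp (- Q x)) \<and>
      (\<forall>x\<in>I. (Q has_vector_derivative (\<Sum>j\<le>N-1. wkb_rate V z j x)) (at x within I))"
    by (rule wkb_is_primitive(2)[OF z_nonzero tp' XI]) (rule cont)
  then obtain Q where Q: "Q X = 0" "\<forall>x. wkb (N - 1) V z x = exp (- Q x)"
    "\<forall>x\<in>I. (Q has_vector_derivative S x) (at x within I)"
    unfolding S'[symmetric] by (elim exE conjE) (rule that)
  define u where "u = (\<lambda>x. Re (Q x))"
  have norm_g: "cmod (wkb (N - 1) V z x) = exp (- u x)" for x using Q(2) by (simp add: u_def)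
  have ud: "(u has_vector_derivative Re (S x)) (at x within I)" if "x \<in> I" for x
    unfolding u_def using Q(3) that by (intro bounded_linear.has_vector_derivative[OF bounded_linear_Re]) auto
  have uc: "continuous_on I u" using ud by (intro continuous_on_vector_derivative) auto
  have udi: "(u has_real_derivative Re (S x)) (at x)" if "X - \<delta> < x" "x < X + \<delta>" for x
  proof -
    have "(u has_vector_derivative Re (S x)) (at x within {X - \<delta><..<X + \<delta>})"
      by (rule has_vector_derivative_within_subset[OF ud]) (use that in auto)
    then have "(u has_vector_derivative Re (S x)) (at x)"
      using has_vector_derivative_within_open[of x "{X - \<delta><..<X + \<delta>}" u] that by simp
    then show ?thesis by (simp add: has_real_derivative_iff_has_vector_derivative)
  qed
  define CC where "CC = correction_const C"
  have CC: "CC \<ge> 0" using correction_const_nonneg[OF C] by (simp add: CC_def)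
  define m where "m = b / (16 * K\<^sup>2 * T)"
  have m: "m \<ge> 0" using b T by (simp add: m_def)
  have m\<delta>: "m * \<delta> / 4 = b / (128 * K\<^sup>2 * \<kappa> * T)" using pos \<kappa> T by (simp add: m_def \<delta> field_simps)
  have err: "\<bar>Re (S x) - (- Im (csqrt (W x)))\<bar> \<le> CC * (\<kappa> + b * \<kappa> / (\<mu> + b * \<kappa> * \<bar>x - X\<bar>))" if "x \<in> I" for x
  proof -
    have "Re (S x) - (- Im (csqrt (W x))) = Re (S x - \<i> * csqrt (W x))" by simp
    then show ?thesis using correction_bound[OF C H that] abs_Re_le_cmod[of "S x - \<i> * csqrt (W x)"]
      unfolding CC_def by linarith
  qed
  define s where "s = \<bar>t - X\<bar>"
  have s: "0 \<le> s" "s \<le> \<delta>" using t by (auto simp: s_def)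
  have all: "- \<Phi> \<le> u t \<and> u t \<le> 2 * K * T * s + \<Phi> \<and> (3 * \<delta> / 4 \<le> s \<longrightarrow> m * \<delta> / 4 - \<Phi> \<le> u t)"
  proof (cases "X \<le> t")
    case True
    define h where "h = (\<lambda>s. u (X + s))"
    have h0: "h 0 = 0" by (simp add: h_def u_def Q)
    have hc: "continuous_on {0..\<delta>} h"
      unfolding h_def by (intro continuous_on_compose2[OF uc] continuous_intros) auto
    have hd: "(h has_real_derivative - Im (csqrt (W (X + s))) + (Re (S (X + s)) - (- Im (csqrt (W (X + s)))))) (at s)"
      if "0 < s" "s < \<delta>" for s
    proof -
      have "(u has_real_derivative Re (S (s + X))) (at (s + X))" by (rule udi) (use that in auto)
      then have "(h has_real_derivative Re (S (X + s))) (at s)"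
        unfolding h_def DERIV_shift add.commute[of X] .
      then show ?thesis by simp
    qed
    have \<rho>: "0 \<le> - Im (csqrt (W (X + s))) \<and> - Im (csqrt (W (X + s))) \<le> 2 * K * T" if "0 < s" "s < \<delta>" for s
      using csqrt_W(1,2)[of "X + s"] that by auto
    have \<rho>m: "m \<le> - Im (csqrt (W (X + s)))" if "\<delta> / 2 \<le> s" "s < \<delta>" for s
      using csqrt_W(2,4)[of "X + s"] that pos by (auto simp: m_def)
    have \<eta>: "\<bar>Re (S (X + s)) - (- Im (csqrt (W (X + s))))\<bar> \<le> CC * (\<kappa> + b * \<kappa> / (\<mu> + b * \<kappa> * s))"
      if "0 < s" "s < \<delta>" for s
      using err[of "X + s"] that by auto
    note B = one_sided_exponent_bounds[OF pos(3) \<kappa> pos(1,2) CC m \<delta> h0 hc hd \<rho> \<rho>m \<eta> s]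
    have "h s = u t" using True by (simp add: h_def s_def)
    then show ?thesis using B unfolding \<Phi>_def CC_def by simp
  next
    case False
    define h where "h = (\<lambda>s. u (X - s))"
    have h0: "h 0 = 0" by (simp add: h_def u_def Q)
    have hc: "continuous_on {0..\<delta>} h"
      unfolding h_def by (intro continuous_on_compose2[OF uc] continuous_intros) auto
    have hd: "(h has_real_derivative Im (csqrt (W (X - s))) + (- (Re (S (X - s)) - (- Im (csqrt (W (X - s))))))) (at s)"
      if "0 < s" "s < \<delta>" for s
    proof -
      have "(u has_real_derivative Re (S (X - s))) (at (X - s))" by (rule udi) (use that in auto)
      then have "(h has_real_derivative Re (S (X - s)) * (0 - 1)) (at s)"
        unfolding h_def by (rule DERIV_chain2) (intro DERIV_diff DERIV_const DERIV_ident)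
      then show ?thesis by simp
    qed
    have \<rho>: "0 \<le> Im (csqrt (W (X - s))) \<and> Im (csqrt (W (X - s))) \<le> 2 * K * T" if "0 < s" "s < \<delta>" for s
      using csqrt_W(1,3)[of "X - s"] that by auto
    have \<rho>m: "m \<le> Im (csqrt (W (X - s)))" if "\<delta> / 2 \<le> s" "s < \<delta>" for s
      using csqrt_W(3,4)[of "X - s"] that pos by (auto simp: m_def)
    have \<eta>: "\<bar>- (Re (S (X - s)) - (- Im (csqrt (W (X - s)))))\<bar> \<le> CC * (\<kappa> + b * \<kappa> / (\<mu> + b * \<kappa> * s))"
      if "0 < s" "s < \<delta>" for s
      using err[of "X - s"] that by (simp add: abs_minus_commute)
    note B = one_sided_exponent_bounds[OF pos(3) \<kappa> pos(1,2) CC m \<delta> h0 hc hd \<rho> \<rho>m \<eta> s]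
    have "h s = u t" using False by (simp add: h_def s_def)
    then show ?thesis using B unfolding \<Phi>_def CC_def by simp
  qed
  show "cmod (wkb (N - 1) V z t) \<le> exp \<Phi>" unfolding norm_g using all by simp
  show "exp (- (2 * K * T * \<bar>t - X\<bar>) - \<Phi>) \<le> cmod (wkb (N - 1) V z t)"
    unfolding norm_g using all by (simp add: s_def)
  show "cmod (wkb (N - 1) V z t) \<le> exp (\<Phi> - b / (128 * K\<^sup>2 * \<kappa> * T))" if "3 * \<delta> / 4 \<le> \<bar>t - X\<bar>"
    unfolding norm_g using all that by (simp add: s_def m\<delta>)
qed

section \<open>The residual compared with the pseudomode\<close>

definition log_amplitude :: "real \<Rightarrow> real" where
  "log_amplitude C = correction_const C * (1 + ln (1 + b / \<mu>))"

definition rate_bound :: "real \<Rightarrow> real" where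
  "rate_bound C = 2 * K * T + correction_const C * (\<kappa> * (1 + b / \<mu>))"

definition edge_bound :: "real \<Rightarrow> real \<Rightarrow> real" where
  "edge_bound C c = (2 * c * \<kappa> * rate_bound C + c * \<kappa>\<^sup>2) * exp (log_amplitude C - b / (128 * K\<^sup>2 * \<kappa> * T))"

lemma rate_sum_bound:
  assumes C: "C \<ge> 0" and H: "wkb_hierarchy N C V z D P'" and t: "t \<in> I"
  shows "cmod (S t) \<le> rate_bound C"
proof -
  have "cmod (S t) \<le> cmod (\<i> * csqrt (W t)) + cmod (S t - \<i> * csqrt (W t))"
    using norm_triangle_ineq[of "\<i> * csqrt (W t)" "S t - \<i> * csqrt (W t)"] by simp
  also have "cmod (\<i> * csqrt (W t)) \<le> 2 * K * T" using W_upper[OF t] by (simp add: norm_mult)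
  also have "cmod (S t - \<i> * csqrt (W t)) \<le> correction_const C * (\<kappa> + b * \<kappa> / (\<mu> + b * \<kappa> * \<bar>t - X\<bar>))"
    by (rule correction_bound[OF C H t])
  also have "\<dots> \<le> correction_const C * (\<kappa> + b * \<kappa> / \<mu>)"
    using pos \<kappa> correction_const_nonneg[OF C]
    by (intro mult_left_mono add_left_mono divide_left_mono) (auto simp: add_pos_nonneg)
  finally show ?thesis by (simp add: rate_bound_def distrib_left mult_ac)
qed

text \<open>The residual is \<open>\<rho>\<^sub>1 + \<rho>\<^sub>2\<close>: the Riccati remainder times \<open>f\<close> itself, which contributes \<open>Z\<close> to the quotient, and the
  terms containing derivatives of the cut-off, supported where \<open>g\<close> is small. The latter are compared with a lower bound
  for the norm of \<open>f\<close>, obtained on an interval of length \<open>1 / (4 \<kappa> + T)\<close> next to the turning point, on which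
  \<open>|g|\<close> loses at most a factor \<open>exp (- 2 K)\<close> besides the logarithmic correction.\<close>

theorem residual_ratio_bound:
  fixes \<Xi> :: "real \<Rightarrow> real \<Rightarrow> real"
  assumes C: "C \<ge> 0" and H: "wkb_hierarchy N C V z D P'"
    and \<xi>: "test_function {0<..} (\<Xi> b)" "\<And>x. 0 \<le> \<Xi> b x \<and> \<Xi> b x \<le> 1"
    and \<xi>1: "\<And>x. \<bar>x - X\<bar> < 3 * \<delta> / 4 \<Longrightarrow> \<Xi> b x = 1" and \<xi>0: "\<And>x. \<delta> \<le> \<bar>x - X\<bar> \<Longrightarrow> \<Xi> b x = 0"
    and c: "c \<ge> 0" "\<And>x. \<bar>deriv (\<Xi> b) x\<bar> \<le> c * \<kappa>" "\<And>x. \<bar>deriv (deriv (\<Xi> b)) x\<bar> \<le> c * \<kappa>\<^sup>2"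
    and Z: "Z \<ge> 0"
    and Z1: "\<And>t. \<bar>t - X\<bar> < \<delta> \<Longrightarrow> \<kappa> ^ N * (1 / sqrt (cmod (W t))) ^ (N - 2) * ((1 / sqrt (cmod (W t)))\<^sup>2 * (K * (b + \<bar>Re (V t)\<bar>))) \<le> Z"
    and Z2: "\<And>t k l. \<bar>t - X\<bar> < \<delta> \<Longrightarrow> k \<le> N - 2 \<Longrightarrow> l \<in> {2..N+k} \<Longrightarrow>
      \<kappa> ^ (N + k) * (1 / sqrt (cmod (W t))) ^ (N - 2 + k) * ((1 / sqrt (cmod (W t)))\<^sup>2 * (K * (b + \<bar>Re (V t)\<bar>))) ^ l \<le> Z"
  defines "f \<equiv> pseudomode (N - 1) V \<Xi> z"
  shows "in_L2 f" "\<exists>h. has_weak_deriv {0<..} 2 f h" "in_L2 (residual V z f)" "L2_norm_half f > 0"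
    and "L2_norm_half (residual V z f) / L2_norm_half f \<le>
      2 * (C * real N + C\<^sup>2 * real N ^ 4) * Z + 2 * edge_bound C c * (2 + T / \<kappa>) * exp (2 * K + log_amplitude C)"
proof -
  define g where "g = wkb (N - 1) V z"
  define \<xi>' where "\<xi>' = deriv (\<Xi> b)"
  define \<xi>'' where "\<xi>'' = deriv \<xi>'"
  define S' where "S' = (\<lambda>t. \<Sum>j<N. P' j t)"
  define CR where "CR = C * real N + C\<^sup>2 * real N ^ 4"
  have CR: "CR \<ge> 0" using C by (simp add: CR_def)
  have f: "f = (\<lambda>x. of_real (\<Xi> b x) * g x)" by (simp add: f_def pseudomode_def z_def g_def fun_eq_iff)
  have prim: "is_primitive (X-\<delta>) (X+\<delta>) (wkb_rate V z j) (P' j)" if "j < N" for j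
    using H that X window_subset unfolding wkb_hierarchy_def by auto
  have Sprim: "is_primitive (X-\<delta>) (X+\<delta>) S S'"
    unfolding S_def[abs_def] S'_def by (rule is_primitive_sum) (use prim in auto)
  have cont: "continuous_on I (wkb_rate V z j)" if "j \<le> N - 1" for j
    by (rule is_primitive_continuous_on[OF prim]) (use that N in auto)
  have Sc: "continuous_on I S" by (rule is_primitive_continuous_on[OF Sprim])
  have XI: "X \<in> I" using pos by simp
  have tp': "turning_point V (Im z) = X" using tp by (simp add: z_def)
  have S_eq: "(\<Sum>j\<le>N-1. wkb_rate V z j t) = S t" for t
    unfolding S_def using N by (intro sum.cong) auto
  have gprim: "is_primitive (X-\<delta>) (X+\<delta>) g (\<lambda>x. - S x * g x)"
    unfolding g_def S_eq[symmetric] by (rule wkb_is_primitive(1)[OF z_nonzero tp' XI]) (rule cont)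
  have gc: "continuous_on I g" by (rule is_primitive_continuous_on[OF gprim])
  have \<xi>out: "\<Xi> b x = 0" if "x \<notin> {X-\<delta><..<X+\<delta>}" for x
    by (rule \<xi>0) (use that in \<open>auto simp: abs_if split: if_splits\<close>)
  define u2 where "u2 = (\<lambda>x. (of_real (\<xi>'' x) - 2 * of_real (\<xi>' x) * S x
        - of_real (\<Xi> b x) * (S' x - (S x)\<^sup>2)) * g x)"
  have wd: "has_weak_deriv {0<..} 2 f (\<lambda>x. if x \<in> I then u2 x else 0)"
    unfolding f u2_def \<xi>''_def \<xi>'_def
    by (rule cutoff_times_exponential_second_derivative[OF gprim Sprim \<xi>(1) \<xi>out]) (use X pos in auto)
  then show "\<exists>h. has_weak_deriv {0<..} 2 f h" by blast
  define \<rho>1 where "\<rho>1 = (\<lambda>x. (S' x - (S x)\<^sup>2 + V x - z) * (of_real (\<Xi> b x) * g x))"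
  define \<rho>2 where "\<rho>2 = (\<lambda>x. (2 * of_real (\<xi>' x) * S x - of_real (\<xi>'' x)) * g x)"
  have res: "AE x in lebesgue. x > 0 \<longrightarrow> residual V z f x = (if x \<in> I then \<rho>1 x + \<rho>2 x else 0)"
    using weak_deriv_AE_eq[OF wd]
  proof eventually_elim
    case (elim x)
    show ?case
    proof
      assume "x > 0"
      then have w: "weak_deriv 2 f x = (if x \<in> I then u2 x else 0)" using elim by blast
      show "residual V z f x = (if x \<in> I then \<rho>1 x + \<rho>2 x else 0)"
      proof (cases "x \<in> I")
        case True
        then show ?thesis unfolding residual_def schroedinger_op_def w
          by (simp add: f u2_def \<rho>1_def \<rho>2_def algebra_simps)
      next
        case False
        then have "\<Xi> b x = 0" by (intro \<xi>out) auto
        then show ?thesis unfolding residual_def schroedinger_op_def w using False by (simp add: f del: atLeastAtMost_iff)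
      qed
    qed
  qed
  have td: "times_differentiable 2 (\<Xi> b)" by (rule test_functionD(1)[OF \<xi>(1)])
  have \<xi>c: "continuous_on I (\<Xi> b)" "continuous_on I \<xi>'" "continuous_on I \<xi>''"
    using td unfolding numeral_2_eq_2 \<xi>''_def \<xi>'_def
    by (auto intro: times_differentiable_continuous_on[of 0])
  have m: "h \<in> borel_measurable (lebesgue_on I)" if "continuous_on I h" for h :: "real \<Rightarrow> complex"
    using that by (rule continuous_imp_measurable_on_sets_lebesgue) auto
  have S'm: "S' \<in> borel_measurable (lebesgue_on I)" using Sprim unfolding is_primitive_def by blast
  have "(\<lambda>x. S' x * (of_real (\<Xi> b x) * g x) + ((- (S x)\<^sup>2 + V x - z) * (of_real (\<Xi> b x) * g x)
      + (2 * of_real (\<xi>' x) * S x - of_real (\<xi>'' x)) * g x)) \<in> borel_measurable (lebesgue_on I)"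
    by (intro borel_measurable_add borel_measurable_times[OF S'm] m)
      (intro continuous_intros \<xi>c gc Sc V_continuous)+
  then have \<rho>m: "(\<lambda>x. \<rho>1 x + \<rho>2 x) \<in> borel_measurable (lebesgue_on I)"
    by (simp add: \<rho>1_def \<rho>2_def algebra_simps)
  have fc: "continuous_on I (\<lambda>x. of_real (\<Xi> b x) * g x)" by (intro continuous_intros \<xi>c gc)
  have E0: "edge_bound C c \<ge> 0"
    using c \<kappa> T K pos correction_const_nonneg[OF C] by (auto simp: edge_bound_def rate_bound_def intro!: mult_nonneg_nonneg add_nonneg_nonneg)
  have b1: "cmod (\<rho>1 x) \<le> CR * Z * cmod (of_real (\<Xi> b x) * g x)" if x: "x \<in> I" for x
  proof (cases "\<Xi> b x = 0")
    case True then show ?thesis by (simp add: \<rho>1_def)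
  next
    case False
    then have xd: "\<bar>x - X\<bar> < \<delta>" using \<xi>0[of x] by linarith
    have dom: "x \<in> wkb_domain V z" using window_subset x by blast
    have "cmod (S' x - (S x)\<^sup>2 + V x - z) \<le> CR * Z"
      unfolding CR_def S'_def S_def
    proof (rule wkb_remainder_bound[OF H N C z_nonzero dom refl])
      show "0 \<le> K * (b + \<bar>Re (V x)\<bar>)" using pos by simp
      show "\<forall>m\<in>{1..N}. cmod (D m x) \<le> K * (b + \<bar>Re (V x)\<bar>) * \<kappa> ^ m" using D_bound[OF x] by blast
    qed (use \<kappa> Z1[OF xd] Z2[OF xd] in \<open>auto simp: W_def\<close>)
    then show ?thesis unfolding \<rho>1_def norm_mult by (intro mult_right_mono) auto
  qed
  have b2: "cmod (\<rho>2 x) \<le> edge_bound C c" if x: "x \<in> I" for x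
  proof (cases "\<bar>x - X\<bar> < 3 * \<delta> / 4")
    case True
    \<comment> \<open>The cut-off is constant on an open set around \<open>x\<close>, so both of its derivatives vanish there.\<close>
    let ?O = "{X - 3 * \<delta> / 4<..<X + 3 * \<delta> / 4}"
    have der0: "deriv \<phi> y = 0" if "y \<in> ?O" "\<And>y. y \<in> ?O \<Longrightarrow> \<phi> y = k" for \<phi> :: "real \<Rightarrow> real" and y k
    proof -
      have "((\<lambda>_. k) has_field_derivative 0) (at y)" by simp
      then have "(\<phi> has_field_derivative 0) (at y)"
        by (rule has_field_derivative_transform_within_open[where S="?O"]) (use that in auto)
      then show ?thesis by (rule DERIV_imp_deriv)
    qed
    have d1: "\<xi>' y = 0" if "y \<in> ?O" for y
      unfolding \<xi>'_def by (rule der0[OF that, where k=1], rule \<xi>1)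
        (simp only: abs_less_iff greaterThanLessThan_iff, linarith)
    have d2: "\<xi>'' y = 0" if "y \<in> ?O" for y
      unfolding \<xi>''_def by (rule der0[OF that, where k=0]) (rule d1)
    have "x \<in> ?O" using True unfolding abs_less_iff greaterThanLessThan_iff by linarith
    then have "\<rho>2 x = 0" using d1 d2 by (simp add: \<rho>2_def)
    then show ?thesis using E0 by simp
  next
    case False
    have "cmod (2 * of_real (\<xi>' x) * S x - of_real (\<xi>'' x)) \<le> 2 * \<bar>\<xi>' x\<bar> * cmod (S x) + \<bar>\<xi>'' x\<bar>"
      using norm_triangle_ineq4[of "2 * of_real (\<xi>' x) * S x" "of_real (\<xi>'' x)"] by (simp add: norm_mult)
    also have "\<dots> \<le> 2 * (c * \<kappa>) * rate_bound C + c * \<kappa>\<^sup>2"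
      using c rate_sum_bound[OF C H x] \<kappa> unfolding \<xi>''_def \<xi>'_def
      by (intro add_mono mult_mono mult_left_mono) auto
    finally have "cmod (\<rho>2 x) \<le> (2 * (c * \<kappa>) * rate_bound C + c * \<kappa>\<^sup>2) * exp (log_amplitude C - b / (128 * K\<^sup>2 * \<kappa> * T))"
      unfolding \<rho>2_def norm_mult g_def log_amplitude_def
      using wkb_amplitude_bounds(3)[OF C H x] False
      by (intro mult_mono order_trans[OF norm_ge_zero]) auto
    then show ?thesis by (simp add: edge_bound_def mult.assoc)
  qed
  obtain G where G: "\<And>x. x \<in> I \<Longrightarrow> cmod (of_real (\<Xi> b x) * g x) \<le> G"
    using compact_imp_bounded[OF compact_continuous_image[OF fc compact_Icc]] by (meson bounded_iff imageI)
  have b3: "cmod (\<rho>1 x + \<rho>2 x) \<le> CR * Z * G + edge_bound C c" if x: "x \<in> I" for x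
  proof -
    have "CR * Z * cmod (of_real (\<Xi> b x) * g x) \<le> CR * Z * G" using CR Z by (intro mult_left_mono G x) auto
    then show ?thesis using norm_triangle_ineq[of "\<rho>1 x" "\<rho>2 x"] b1[OF x] b2[OF x] by linarith
  qed
  have G': "\<forall>x\<in>I. cmod (of_real (\<Xi> b x) * g x) \<le> G"
    and b3': "\<forall>x\<in>I. cmod (\<rho>1 x + \<rho>2 x) \<le> CR * Z * G + edge_bound C c"
    using G b3 by blast+
  have fae: "AE x in lebesgue. x > 0 \<longrightarrow> f x = (if x \<in> I then of_real (\<Xi> b x) * g x else 0)"
    using \<xi>out by (intro AE_I2) (auto simp: f)
  note Lf = L2_norm_half_supported[OF fae X m[OF fc] G']
  note Lr = L2_norm_half_supported[OF res X \<rho>m b3']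
  show "in_L2 f" by (rule Lf(1))
  show "in_L2 (residual V z f)" by (rule Lr(1))
  define A where "A = integral I (\<lambda>x. (cmod (of_real (\<Xi> b x) * g x))\<^sup>2)"
  \<comment> \<open>Short enough to stay where the cut-off is \<open>1\<close> and to keep the loss \<open>T r0\<close> in the exponent at most \<open>1\<close>.\<close>
  define r0 where "r0 = 1 / (4 * \<kappa> + T)"
  have r0: "r0 > 0" "r0 \<le> \<delta> / 2" "r0 * T \<le> 1"
    using \<kappa> T by (auto simp: r0_def \<delta> divide_simps)
  define low where "low = exp (- (4 * K) - 2 * log_amplitude C)"
  have A: "r0 * low \<le> A"
  proof -
    have "integral {X..X + r0} (\<lambda>x. low) \<le> integral {X..X + r0} (\<lambda>x. (cmod (of_real (\<Xi> b x) * g x))\<^sup>2)"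
    proof (rule integral_le)
      show "(\<lambda>x. (cmod (of_real (\<Xi> b x) * g x))\<^sup>2) integrable_on {X..X + r0}"
        by (rule integrable_subinterval_real[OF Lf(3)]) (use r0 pos in auto)
      fix x assume x: "x \<in> {X..X + r0}"
      have xI: "x \<in> I" and x34: "\<bar>x - X\<bar> < 3 * \<delta> / 4" using x r0 pos by auto
      have "2 * K * T * \<bar>x - X\<bar> \<le> 2 * K * T * r0" using x K T by (intro mult_left_mono) auto
      also have "\<dots> = 2 * K * (r0 * T)" by simp
      also have "\<dots> \<le> 2 * K * 1" using K r0 by (intro mult_left_mono) auto
      finally have "exp (- (2 * K) - log_amplitude C) \<le> exp (- (2 * K * T * \<bar>x - X\<bar>) - log_amplitude C)" by simp
      also have "\<dots> \<le> cmod (g x)" unfolding g_def log_amplitude_def by (rule wkb_amplitude_bounds(2)[OF C H xI])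
      finally have "(exp (- (2 * K) - log_amplitude C))\<^sup>2 \<le> (cmod (g x))\<^sup>2" by (intro power_mono) auto
      moreover have "(exp (- (2 * K) - log_amplitude C))\<^sup>2 = low"
        unfolding low_def by (simp add: power2_eq_square exp_add[symmetric])
      ultimately show "low \<le> (cmod (of_real (\<Xi> b x) * g x))\<^sup>2" using \<xi>1[OF x34] by simp
    qed auto
    also have "\<dots> \<le> A" unfolding A_def
      by (rule integral_subset_le)
        (use r0 pos Lf(3) in \<open>auto intro: integrable_subinterval_real[OF Lf(3)]\<close>)
    finally show ?thesis using r0 by (simp add: mult.commute)
  qed
  have low0: "low > 0" by (simp add: low_def)
  have Apos: "A > 0" using A r0(1) low0 by (meson less_le_trans mult_pos_pos)
  have nf: "L2_norm_half f = sqrt A" unfolding A_def by (rule Lf(2))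
  then show "L2_norm_half f > 0" using Apos by simp
  define E where "E = edge_bound C c"
  have nr: "(L2_norm_half (residual V z f))\<^sup>2 \<le> 2 * (CR * Z)\<^sup>2 * A + 4 * E\<^sup>2 * \<delta>"
  proof -
    have i0: "0 \<le> integral I (\<lambda>x. (cmod (\<rho>1 x + \<rho>2 x))\<^sup>2)" by (rule integral_nonneg[OF Lr(3)]) (rule zero_le_power2)
    have "(L2_norm_half (residual V z f))\<^sup>2 = integral I (\<lambda>x. (cmod (\<rho>1 x + \<rho>2 x))\<^sup>2)"
      unfolding Lr(2) using i0 by simp
    also have "\<dots> \<le> integral I (\<lambda>x. 2 * (CR * Z)\<^sup>2 * (cmod (of_real (\<Xi> b x) * g x))\<^sup>2 + 2 * E\<^sup>2)"
    proof (rule integral_le[OF Lr(3)])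
      show "(\<lambda>x. 2 * (CR * Z)\<^sup>2 * (cmod (of_real (\<Xi> b x) * g x))\<^sup>2 + 2 * E\<^sup>2) integrable_on I"
        by (intro integrable_add integrable_on_mult_right Lf(3)) auto
      fix x assume x: "x \<in> I"
      have sq: "(p + q)\<^sup>2 \<le> 2 * p\<^sup>2 + 2 * q\<^sup>2" for p q :: real
        using zero_le_power2[of "p - q"] by (simp add: power2_eq_square algebra_simps)
      have "(cmod (\<rho>1 x + \<rho>2 x))\<^sup>2 \<le> (CR * Z * cmod (of_real (\<Xi> b x) * g x) + E)\<^sup>2"
        unfolding E_def
        by (rule power_mono[OF order_trans[OF norm_triangle_ineq add_mono[OF b1[OF x] b2[OF x]]] norm_ge_zero])
      also have "\<dots> \<le> 2 * (CR * Z * cmod (of_real (\<Xi> b x) * g x))\<^sup>2 + 2 * E\<^sup>2" by (rule sq)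
      finally show "(cmod (\<rho>1 x + \<rho>2 x))\<^sup>2 \<le> 2 * (CR * Z)\<^sup>2 * (cmod (of_real (\<Xi> b x) * g x))\<^sup>2 + 2 * E\<^sup>2"
        by (simp only: power_mult_distrib mult.assoc)
    qed
    also have "\<dots> = 2 * (CR * Z)\<^sup>2 * A + 4 * E\<^sup>2 * \<delta>"
      unfolding A_def using Lf(3) pos
      by (subst integral_add) (auto intro!: integrable_on_mult_right)
    finally show ?thesis .
  qed
  define w where "w = 2 + T / \<kappa>"
  have w: "\<delta> \<le> w * r0" "w \<ge> 2"
  proof -
    have "4 * \<kappa> + T > 0" using \<kappa> T by simp
    then have "\<delta> = (2 + T / (2 * \<kappa>)) * r0"
      using \<kappa> T by (simp add: r0_def \<delta> divide_simps)
    also have "\<dots> \<le> w * r0"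
      using \<kappa> T r0(1) unfolding w_def by (intro mult_right_mono add_left_mono divide_left_mono) auto
    finally show "\<delta> \<le> w * r0" .
    show "w \<ge> 2" using \<kappa> T by (simp add: w_def)
  qed
  define F where "F = exp (2 * K + log_amplitude C)"
  have F2: "F\<^sup>2 * low = 1" unfolding F_def low_def by (simp add: power2_eq_square exp_add[symmetric])
  have "4 * E\<^sup>2 * \<delta> \<le> 4 * E\<^sup>2 * (w * r0 * (F\<^sup>2 * low))" using w by (intro mult_left_mono) (auto simp: F2)
  also have "\<dots> = 4 * E\<^sup>2 * F\<^sup>2 * w * (r0 * low)" by simp
  also have "\<dots> \<le> 4 * E\<^sup>2 * F\<^sup>2 * w * A" using w by (intro mult_left_mono A) auto
  also have "\<dots> \<le> 4 * E\<^sup>2 * F\<^sup>2 * w\<^sup>2 * A"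
    using w Apos by (intro mult_right_mono mult_left_mono) (auto simp: power2_eq_square)
  finally have "(L2_norm_half (residual V z f))\<^sup>2 \<le> 2 * (CR * Z)\<^sup>2 * A + 4 * E\<^sup>2 * F\<^sup>2 * w\<^sup>2 * A" using nr by linarith
  also have "\<dots> \<le> (2 * CR * Z + 2 * E * w * F)\<^sup>2 * A"
  proof -
    have "2 * (CR * Z)\<^sup>2 + 4 * E\<^sup>2 * F\<^sup>2 * w\<^sup>2 \<le> (2 * CR * Z + 2 * E * w * F)\<^sup>2"
    proof -
      have "0 \<le> (CR * Z) * (E * w * F)" using CR Z E0 w by (simp add: E_def F_def)
      moreover have "0 \<le> (CR * Z)\<^sup>2" by simp
      moreover have "(2 * CR * Z + 2 * E * w * F)\<^sup>2 = 4 * (CR * Z)\<^sup>2 + 8 * ((CR * Z) * (E * w * F)) + 4 * E\<^sup>2 * F\<^sup>2 * w\<^sup>2"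
        by (simp add: power2_eq_square algebra_simps)
      ultimately show ?thesis by linarith
    qed
    then show ?thesis using Apos by (simp add: distrib_right[symmetric] mult_right_mono)
  qed
  also have "\<dots> = ((2 * CR * Z + 2 * E * w * F) * L2_norm_half f)\<^sup>2"
    using Apos by (simp add: nf power_mult_distrib)
  finally have "L2_norm_half (residual V z f) \<le> (2 * CR * Z + 2 * E * w * F) * L2_norm_half f"
    by (rule power2_le_imp_le) (use CR Z E0 w nf Apos in \<open>auto simp: E_def F_def intro!: mult_nonneg_nonneg add_nonneg_nonneg\<close>)
  then show "L2_norm_half (residual V z f) / L2_norm_half f \<le>
      2 * (C * real N + C\<^sup>2 * real N ^ 4) * Z + 2 * edge_bound C c * (2 + T / \<kappa>) * exp (2 * K + log_amplitude C)"
    using Apos by (simp add: nf pos_divide_le_eq CR_def E_def w_def F_def)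
qed

end

section \<open>The potential near its turning point\<close>

lemma powr_le_of_comparable:
  fixes x y s :: real
  assumes "0 < x" "x / 2 \<le> y" "y \<le> 2 * x"
  shows "y powr s \<le> 2 powr \<bar>s\<bar> * x powr s"
proof (cases "s \<ge> 0")
  case True
  have "y powr s \<le> (2 * x) powr s" using assms True by (intro powr_mono2) auto
  then show ?thesis using True assms by (simp add: powr_mult)
next
  case False
  have "y powr s \<le> (x / 2) powr s" using assms False by (intro powr_mono2') auto
  also have "\<dots> = 2 powr \<bar>s\<bar> * x powr s" using False assms by (simp add: powr_divide powr_minus field_simps)
  finally show ?thesis .
qed

lemma jap_comparable:
  assumes "x \<ge> 1"
  shows "x \<le> jap x" "jap x \<le> 2 * x" "jap x > 0"
proof -
  show 1: "x \<le> jap x" unfolding jap_def by (rule real_le_rsqrt) simp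
  have "1 + x\<^sup>2 \<le> (2 * x)\<^sup>2" using mult_mono[OF assms assms] assms by (simp add: power2_eq_square)
  then show "jap x \<le> 2 * x" unfolding jap_def using assms by (intro real_le_lsqrt) auto
  show "jap x > 0" using 1 assms by simp
qed

lemma jap_powr:
  assumes "x \<ge> 1"
  shows "jap x powr s \<le> 2 powr \<bar>s\<bar> * x powr s" "x powr s \<le> 2 powr \<bar>s\<bar> * jap x powr s"
  using jap_comparable[OF assms] assms by (auto intro!: powr_le_of_comparable)

text \<open>Bounds that hold almost everywhere extend to the continuous derivatives of order below \<open>N\<close>. The derivative of
  order \<open>N\<close> is set to zero on the exceptional null set, which preserves the primitive relation. The brackets
  are replaced by powers of \<open>x\<close>, and the growth condition is reduced to the part without \<open>Re V\<close>.\<close>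

lemma derivative_chain_bounds:
  assumes N: "N \<ge> 2" and H: "half_line_assumption N V \<nu> \<epsilon>"
  shows "\<exists>D K x1. derivative_chain N V D \<and> K \<ge> 1 \<and> x1 \<ge> 1 \<and>
    (\<forall>x\<ge>x1. \<forall>m\<in>{1..N}. cmod (D m x) \<le> K * cmod (V x) * x powr (real m * \<nu>)) \<and>
    (\<forall>x\<ge>x1. 1 \<le> Im (V x) \<and> Im (D 1 x) \<le> K * (Im (V x) * x powr \<nu>) \<and>
      Im (V x) * x powr \<nu> \<le> K * Im (D 1 x) \<and>
      x powr (8 * \<nu> + 4 * \<epsilon> + 4) \<le> K * (Im (V x))\<^sup>2) \<and>
    (\<forall>R>0. \<exists>C. \<forall>x\<in>{0<..<R}. Im (V x) \<le> C)"
proof -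
  have Vc: "continuous_on {0<..} V" and sob: "sobolev_inf_loc N V"
    and lim: "filterlim (\<lambda>x. Im (V x)) at_top at_top"
    and b1: "\<And>m. m \<in> {1..N} \<Longrightarrow> ess_bigo (\<lambda>x. cmod (weak_deriv m V x)) (\<lambda>x. cmod (V x) * jap x powr (real m * \<nu>))"
    and b2: "\<And>m. m \<in> {1..N} \<Longrightarrow> ess_bigo (\<lambda>x. Im (weak_deriv m V x)) (\<lambda>x. \<bar>Im (V x)\<bar> * jap x powr (real m * \<nu>))"
    and b3: "(\<lambda>x. jap x powr (4 * (\<nu> + \<epsilon>) + 2) * (jap x powr (4 * \<nu> + 2) + \<bar>Re (V x)\<bar>))
        \<in> O[at_top](\<lambda>x. \<bar>Im (V x)\<bar>\<^sup>2)"
    and b4: "\<exists>c>0. \<exists>x0. AE x in lebesgue. x \<ge> x0 \<longrightarrow> Im (weak_deriv 1 V x) \<ge> c * (Im (V x) * jap x powr \<nu>)"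
    using H unfolding half_line_assumption_def by blast+
  have "N \<ge> 1" using N by simp
  obtain D where D0: "D 0 = V" and DS: "\<forall>m<N. primitive_on_half_line (D m) (D (Suc m))"
    and Dw: "\<forall>m\<in>{1..N}. AE x in lebesgue. x > 0 \<longrightarrow> D m x = weak_deriv m V x"
    and Db: "\<forall>R>0. \<exists>C. \<forall>x\<in>{0<..<R}. norm (V x) \<le> C"
    using sobolev_derivatives[OF Vc sob \<open>N \<ge> 1\<close>] by (elim exE conjE) (rule that)
  note D = D0 DS[rule_format] Dw[rule_format] Db[rule_format]
  have Dc: "continuous_on {0<..} (D m)" if "m < N" for m
    using primitive_on_half_line_continuous_on[OF D(2)[OF that]] .
  have japc: "continuous_on S (\<lambda>x. jap x powr s)" for S s
  proof -
    have "jap x \<noteq> 0" for x by (auto simp: jap_def add_nonneg_eq_0_iff)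
    moreover have "continuous_on S jap" unfolding jap_def by (intro continuous_intros)
    ultimately show ?thesis by (intro continuous_on_powr continuous_on_const) auto
  qed
  have "\<exists>C c. c \<ge> 1 \<and> C \<ge> 0 \<and> (AE x in lebesgue. x > c \<longrightarrow> cmod (D m x) \<le> C * (cmod (V x) * jap x powr (real m * \<nu>)))"
    if m: "m \<in> {1..N}" for m
  proof -
    obtain C x0 where "AE x in lebesgue. x \<ge> x0 \<longrightarrow>
        \<bar>cmod (weak_deriv m V x)\<bar> \<le> C * \<bar>cmod (V x) * jap x powr (real m * \<nu>)\<bar>"
      using b1[OF m] unfolding ess_bigo_def by blast
    with D(3)[OF m] have "AE x in lebesgue. x > max x0 1 \<longrightarrow> cmod (D m x) \<le> max C 0 * (cmod (V x) * jap x powr (real m * \<nu>))"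
    proof eventually_elim
      case (elim x)
      show ?case
      proof
        assume x: "max x0 1 < x"
        then have "cmod (D m x) \<le> C * (cmod (V x) * jap x powr (real m * \<nu>))" using elim by simp
        also have "\<dots> \<le> max C 0 * (cmod (V x) * jap x powr (real m * \<nu>))" by (intro mult_right_mono) auto
        finally show "cmod (D m x) \<le> max C 0 * (cmod (V x) * jap x powr (real m * \<nu>))" .
      qed
    qed
    then show ?thesis by (intro exI[of _ "max C 0"] exI[of _ "max x0 1"]) auto
  qed
  moreover define Q where "Q = (\<lambda>m C c. c \<ge> 1 \<and> C \<ge> 0 \<and>
    (AE x in lebesgue. x > c \<longrightarrow> cmod (D m x) \<le> C * (cmod (V x) * jap x powr (real m * \<nu>))))"
  ultimately have "\<forall>m\<in>{1..N}. \<exists>C c. Q m C c" by blast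
  then obtain C c where "\<forall>m\<in>{1..N}. Q m (C m) (c m)" by metis
  then have Cc: "c m \<ge> 1" "C m \<ge> (0::real)"
    "AE x in lebesgue. x > c m \<longrightarrow> cmod (D m x) \<le> C m * (cmod (V x) * jap x powr (real m * \<nu>))"
    if "m \<in> {1..N}" for m
    using that unfolding Q_def by blast+
  \<comment> \<open>The set where the bound for the derivative of top order holds; its complement is negligible.\<close>
  define good where "good = (\<lambda>x. x > c N \<longrightarrow> cmod (D N x) \<le> C N * (cmod (V x) * jap x powr (real N * \<nu>)))"
  obtain S where S: "negligible S" "\<And>x. x \<notin> S \<Longrightarrow> good x"
    using AE_lebesgue_negligible[OF Cc(3)[of N]] N unfolding good_def by auto
  define E where "E = (\<lambda>m. if m = N then (\<lambda>x. if good x then D N x else 0) else D m)"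
  have E: "E m = D m" if "m < N" for m using that by (simp add: E_def)
  have chain: "derivative_chain N V E"
    unfolding derivative_chain_def
  proof (intro conjI allI impI)
    show "E 0 = V" using D(1) N by (simp add: E_def)
    fix m assume m: "m < N"
    show "primitive_on_half_line (E m) (E (Suc m))"
    proof (cases "Suc m = N")
      case False
      then show ?thesis using D(2)[OF m] m by (simp add: E_def)
    next
      case True
      show ?thesis unfolding primitive_on_half_line_def E[OF m]
      proof (intro allI impI)
        fix p q :: real assume p: "0 < p"
        have pr: "is_primitive p q (D m) (D N)" using D(2)[OF m] p True unfolding primitive_on_half_line_def by auto
        obtain B where B: "B \<ge> 0" "\<And>t. t \<in> {p..q} \<Longrightarrow> norm (D N t) \<le> B" using is_primitive_lipschitz[OF pr] by metis
        show "is_primitive p q (D m) (E (Suc m))"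
          by (rule is_primitive_spike[OF pr S(1), of _ B]) (use S(2) B True in \<open>auto simp: E_def\<close>)
      qed
    qed
  qed
  have Eb: "cmod (E m x) \<le> C m * (cmod (V x) * jap x powr (real m * \<nu>))" if m: "m \<in> {1..N}" and x: "x > c m" for m x
  proof (cases "m = N")
    case True
    then show ?thesis using x Cc(2)[OF m] by (auto simp: E_def good_def)
  next
    case False
    then have "m < N" using m by simp
    have sub: "{c m<..} \<subseteq> {0<..}" using Cc(1)[OF m] by auto
    have "cmod (D m x) \<le> C m * (cmod (V x) * jap x powr (real m * \<nu>))"
      by (rule AE_le_imp_le[OF Cc(3)[OF m] _ _ x])
        (intro continuous_on_norm continuous_on_mult continuous_on_const japc
          continuous_on_subset[OF Dc[OF \<open>m < N\<close>] sub] continuous_on_subset[OF Vc sub])+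
    then show ?thesis using E[OF \<open>m < N\<close>] by simp
  qed
  obtain C1 c1 where C1: "AE x in lebesgue. x \<ge> c1 \<longrightarrow> \<bar>Im (weak_deriv 1 V x)\<bar> \<le> C1 * \<bar>\<bar>Im (V x)\<bar> * jap x powr (real 1 * \<nu>)\<bar>"
    using b2[of 1] N unfolding ess_bigo_def by auto
  obtain c0 c2 where c0: "c0 > 0" "AE x in lebesgue. x \<ge> c2 \<longrightarrow> Im (weak_deriv 1 V x) \<ge> c0 * (Im (V x) * jap x powr \<nu>)"
    using b4 by blast
  define c3 where "c3 = max (max c1 c2) 1"
  have D1: "AE x in lebesgue. x > 0 \<longrightarrow> D 1 x = weak_deriv 1 V x" using D(3)[of 1] N by simp
  have c3: "{c3<..} \<subseteq> {0<..}" by (auto simp: c3_def)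
  have cont1: "continuous_on {c3<..} (\<lambda>x. Im (D 1 x))" "continuous_on {c3<..} (\<lambda>x. Im (V x))"
    by (intro continuous_on_Im continuous_on_subset[OF Dc c3] continuous_on_subset[OF Vc c3]; use N in simp)+
  have up: "Im (D 1 x) \<le> C1 * (\<bar>Im (V x)\<bar> * jap x powr \<nu>)" if x: "x > c3" for x
  proof (rule AE_le_imp_le[OF _ _ _ x])
    from C1 D1 show "AE x in lebesgue. x > c3 \<longrightarrow> Im (D 1 x) \<le> C1 * (\<bar>Im (V x)\<bar> * jap x powr \<nu>)"
      by eventually_elim (auto simp: c3_def abs_mult)
  qed (intro cont1 continuous_on_mult continuous_on_const japc continuous_on_rabs)+
  have lo: "c0 * (Im (V x) * jap x powr \<nu>) \<le> Im (D 1 x)" if x: "x > c3" for x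
  proof (rule AE_le_imp_le[OF _ _ _ x])
    from c0(2) D1 show "AE x in lebesgue. x > c3 \<longrightarrow> c0 * (Im (V x) * jap x powr \<nu>) \<le> Im (D 1 x)"
      by eventually_elim (auto simp: c3_def)
  qed (intro cont1 continuous_on_mult continuous_on_const japc)+
  obtain C3 where C3: "C3 > 0" "eventually (\<lambda>x. norm (jap x powr (4 * (\<nu> + \<epsilon>) + 2) * (jap x powr (4 * \<nu> + 2) + \<bar>Re (V x)\<bar>))
        \<le> C3 * norm (\<bar>Im (V x)\<bar>\<^sup>2)) at_top"
    using landau_o.bigE[OF b3] by blast
  have "eventually (\<lambda>x. Im (V x) \<ge> 1) at_top" using lim by (simp add: filterlim_at_top)
  with C3(2) have "eventually (\<lambda>x. Im (V x) \<ge> 1 \<and> norm (jap x powr (4 * (\<nu> + \<epsilon>) + 2) * (jap x powr (4 * \<nu> + 2) + \<bar>Re (V x)\<bar>))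
        \<le> C3 * norm (\<bar>Im (V x)\<bar>\<^sup>2)) at_top" by eventually_elim simp
  then obtain c4 where c4: "\<And>x. x \<ge> c4 \<Longrightarrow> Im (V x) \<ge> 1 \<and> norm (jap x powr (4 * (\<nu> + \<epsilon>) + 2) * (jap x powr (4 * \<nu> + 2) + \<bar>Re (V x)\<bar>))
        \<le> C3 * norm (\<bar>Im (V x)\<bar>\<^sup>2)" unfolding eventually_at_top_linorder by blast
  define x1 where "x1 = (\<Sum>m=1..N. c m) + \<bar>c3\<bar> + \<bar>c4\<bar> + 2"
  have x1c: "x1 > c m" if "m \<in> {1..N}" for m
  proof -
    have "c m \<le> (\<Sum>m=1..N. c m)"
    proof (rule member_le_sum[OF that])
      show "0 \<le> c x" if "x \<in> {1..N} - {m}" for x using Cc(1)[of x] that by simp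
    qed simp
    then show ?thesis by (simp add: x1_def)
  qed
  have csum: "0 \<le> (\<Sum>m=1..N. c m)"
  proof (rule sum_nonneg)
    show "0 \<le> c x" if "x \<in> {1..N}" for x using Cc(1)[of x] that by simp
  qed
  then have x1: "x1 > c3" "x1 \<ge> c4" "x1 \<ge> 1" by (auto simp: x1_def)
  define p2 where "p2 = (\<lambda>s::real. 2 powr \<bar>s\<bar>)"
  have p2: "p2 s \<ge> 1" for s by (simp add: p2_def ge_one_powr_ge_zero)
  define K where "K = 1 + (\<Sum>m=1..N. C m * p2 (real m * \<nu>)) + \<bar>C1\<bar> * p2 \<nu> + p2 \<nu> / c0 + C3 * p2 (8 * \<nu> + 4 * \<epsilon> + 4)"
  have K_sum: "0 \<le> (\<Sum>m=1..N. C m * p2 (real m * \<nu>))"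
    using Cc(2) p2 by (intro sum_nonneg mult_nonneg_nonneg) (auto simp: p2_def)
  have p20: "0 \<le> p2 s" for s by (simp add: p2_def)
  note nn = K_sum p20[of \<nu>] p20[of "8 * \<nu> + 4 * \<epsilon> + 4"] C3(1) c0(1)
  have nn2: "0 \<le> \<bar>C1\<bar> * p2 \<nu>" "0 \<le> p2 \<nu> / c0" "0 \<le> C3 * p2 (8 * \<nu> + 4 * \<epsilon> + 4)" using nn by auto
  have K1: "K \<ge> 1" "\<bar>C1\<bar> * p2 \<nu> \<le> K" "p2 \<nu> / c0 \<le> K" "C3 * p2 (8 * \<nu> + 4 * \<epsilon> + 4) \<le> K"
    using nn(1) nn2 unfolding K_def by linarith+
  have Km: "C m * p2 (real m * \<nu>) \<le> K" if m: "m \<in> {1..N}" for m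
  proof -
    have "C m * p2 (real m * \<nu>) \<le> (\<Sum>m=1..N. C m * p2 (real m * \<nu>))"
    proof (rule member_le_sum[OF m])
      show "0 \<le> C x * p2 (real x * \<nu>)" if "x \<in> {1..N} - {m}" for x using Cc(2)[of x] p20 that by simp
    qed simp
    then show ?thesis using nn2 unfolding K_def by linarith
  qed
  have A: "(\<forall>m\<in>{1..N}. cmod (E m x) \<le> K * cmod (V x) * x powr (real m * \<nu>)) \<and>
      1 \<le> Im (V x) \<and> Im (E 1 x) \<le> K * (Im (V x) * x powr \<nu>) \<and>
      Im (V x) * x powr \<nu> \<le> K * Im (E 1 x) \<and> x powr (8 * \<nu> + 4 * \<epsilon> + 4) \<le> K * (Im (V x))\<^sup>2"
    if x: "x \<ge> x1" for x
  proof (intro conjI ballI)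
    have x1': "x \<ge> 1" "x > c3" "x \<ge> c4" using x x1 by auto
    have v1: "1 \<le> Im (V x)" using c4[OF x1'(3)] by simp
    then show "1 \<le> Im (V x)" .
    show "cmod (E m x) \<le> K * cmod (V x) * x powr (real m * \<nu>)" if m: "m \<in> {1..N}" for m
    proof -
      have "cmod (E m x) \<le> C m * (cmod (V x) * jap x powr (real m * \<nu>))"
        using Eb[OF m] x1c[OF m] x by simp
      also have "\<dots> \<le> C m * (cmod (V x) * (p2 (real m * \<nu>) * x powr (real m * \<nu>)))"
        using jap_powr(1)[OF x1'(1)] Cc(2)[OF m] unfolding p2_def by (intro mult_left_mono) auto
      also have "\<dots> = (C m * p2 (real m * \<nu>)) * (cmod (V x) * x powr (real m * \<nu>))" by simp
      also have "\<dots> \<le> K * (cmod (V x) * x powr (real m * \<nu>))" by (intro mult_right_mono Km[OF m]) auto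
      finally show ?thesis by (simp add: mult.assoc)
    qed
    have E1: "E 1 = D 1" using E[of 1] N by simp
    have "Im (E 1 x) \<le> C1 * (\<bar>Im (V x)\<bar> * jap x powr \<nu>)" unfolding E1 by (rule up[OF x1'(2)])
    also have "\<dots> \<le> \<bar>C1\<bar> * (Im (V x) * jap x powr \<nu>)" using v1 by (intro mult_mono) auto
    also have "\<dots> \<le> \<bar>C1\<bar> * (Im (V x) * (p2 \<nu> * x powr \<nu>))"
      using jap_powr(1)[OF x1'(1)] v1 unfolding p2_def by (intro mult_left_mono) auto
    also have "\<dots> = (\<bar>C1\<bar> * p2 \<nu>) * (Im (V x) * x powr \<nu>)" by simp
    also have "\<dots> \<le> K * (Im (V x) * x powr \<nu>)" using v1 by (intro mult_right_mono K1) auto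
    finally show "Im (E 1 x) \<le> K * (Im (V x) * x powr \<nu>)" .
    have l: "c0 * (Im (V x) * jap x powr \<nu>) \<le> Im (E 1 x)" unfolding E1 by (rule lo[OF x1'(2)])
    have E0: "0 \<le> Im (E 1 x)" by (rule order_trans[OF _ l]) (use c0 v1 in auto)
    have "Im (V x) * x powr \<nu> \<le> Im (V x) * (p2 \<nu> * jap x powr \<nu>)"
      using jap_powr(2)[OF x1'(1)] v1 unfolding p2_def by (intro mult_left_mono) auto
    also have "\<dots> = p2 \<nu> / c0 * (c0 * (Im (V x) * jap x powr \<nu>))" using c0 by simp
    also have "\<dots> \<le> p2 \<nu> / c0 * Im (E 1 x)" using nn2 by (intro mult_left_mono l)
    also have "\<dots> \<le> K * Im (E 1 x)" by (intro mult_right_mono K1 E0)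
    finally show "Im (V x) * x powr \<nu> \<le> K * Im (E 1 x)" .
    have "jap x powr (8 * \<nu> + 4 * \<epsilon> + 4) = jap x powr (4 * (\<nu> + \<epsilon>) + 2) * jap x powr (4 * \<nu> + 2)"
      by (subst powr_add[symmetric]) (simp add: algebra_simps)
    also have "\<dots> \<le> jap x powr (4 * (\<nu> + \<epsilon>) + 2) * (jap x powr (4 * \<nu> + 2) + \<bar>Re (V x)\<bar>)"
      by (intro mult_left_mono) auto
    also have "\<dots> \<le> C3 * (Im (V x))\<^sup>2" using c4[OF x1'(3)] by (simp add: abs_mult)
    finally have j: "jap x powr (8 * \<nu> + 4 * \<epsilon> + 4) \<le> C3 * (Im (V x))\<^sup>2" .
    have "x powr (8 * \<nu> + 4 * \<epsilon> + 4) \<le> p2 (8 * \<nu> + 4 * \<epsilon> + 4) * jap x powr (8 * \<nu> + 4 * \<epsilon> + 4)"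
      using jap_powr(2)[OF x1'(1)] unfolding p2_def .
    also have "\<dots> \<le> p2 (8 * \<nu> + 4 * \<epsilon> + 4) * (C3 * (Im (V x))\<^sup>2)"
      by (rule mult_left_mono[OF j p20])
    also have "\<dots> = (C3 * p2 (8 * \<nu> + 4 * \<epsilon> + 4)) * (Im (V x))\<^sup>2" by simp
    also have "\<dots> \<le> K * (Im (V x))\<^sup>2" by (intro mult_right_mono K1) auto
    finally show "x powr (8 * \<nu> + 4 * \<epsilon> + 4) \<le> K * (Im (V x))\<^sup>2" .
  qed
  have Bd: "\<exists>C. \<forall>x\<in>{0<..<R}. Im (V x) \<le> C" if R: "R > 0" for R
  proof -
    obtain B where B: "\<forall>x\<in>{0<..<R}. norm (V x) \<le> B" using D(4)[OF R] by blast
    have "Im (V x) \<le> B" if "x \<in> {0<..<R}" for x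
      using B that abs_Im_le_cmod[of "V x"] by fastforce
    then show ?thesis by blast
  qed
  have A1: "\<forall>x\<ge>x1. \<forall>m\<in>{1..N}. cmod (E m x) \<le> K * cmod (V x) * x powr (real m * \<nu>)" using A by blast
  have A2: "\<forall>x\<ge>x1. 1 \<le> Im (V x) \<and> Im (E 1 x) \<le> K * (Im (V x) * x powr \<nu>) \<and>
      Im (V x) * x powr \<nu> \<le> K * Im (E 1 x) \<and> x powr (8 * \<nu> + 4 * \<epsilon> + 4) \<le> K * (Im (V x))\<^sup>2"
    using A by blast
  show ?thesis
    by (intro exI[of _ E] exI[of _ K] exI[of _ x1] conjI chain K1(1) x1(3) A1 A2 allI impI Bd)
qed

lemma Im_has_real_derivative:
  assumes "derivative_chain N V D" "N \<ge> 2" "x > 0"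
  shows "((\<lambda>x. Im (V x)) has_real_derivative Im (D 1 x)) (at x)"
proof -
  have "(V has_vector_derivative D 1 x) (at x)"
    using derivative_chain_has_vector_derivative[OF assms(1), of 0 x] assms by (simp add: derivative_chain_def)
  then have "((\<lambda>x. Im (V x)) has_vector_derivative Im (D 1 x)) (at x)"
    by (rule bounded_linear.has_vector_derivative[OF bounded_linear_Im])
  then show ?thesis by (simp add: has_real_derivative_iff_has_vector_derivative)
qed

text \<open>Beyond \<open>x1\<close> the imaginary part is strictly increasing, and on bounded sets it is bounded; so a large value \<open>b\<close>
  is attained exactly once on the whole half-line.\<close>

lemma turning_point_eventually:
  assumes c: "continuous_on {0<..} V" and mono: "\<And>x y. x1 \<le> x \<Longrightarrow> x < y \<Longrightarrow> Im (V x) < Im (V y)"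
    and bd: "\<And>R. R > 0 \<Longrightarrow> \<exists>C. \<forall>x\<in>{0<..<R}. Im (V x) \<le> C"
    and lim: "filterlim (\<lambda>x. Im (V x)) at_top at_top" and x1: "x1 > 0"
  shows "eventually (\<lambda>b. turning_point V b > R \<and> Im (V (turning_point V b)) = b) at_top"
proof -
  define R' where "R' = max R x1 + 1"
  have R': "R' > 0" "R' > R" "R' > x1" using x1 by (auto simp: R'_def)
  obtain B where B: "\<forall>x\<in>{0<..<R'}. Im (V x) \<le> B" using bd[OF R'(1)] by blast
  show ?thesis
    using eventually_gt_at_top[of "max B (Im (V R'))"]
  proof eventually_elim
    case (elim b)
    have "eventually (\<lambda>x. Im (V x) \<ge> b) at_top" using lim by (simp add: filterlim_at_top)
    then have "eventually (\<lambda>x. Im (V x) \<ge> b \<and> x \<ge> R') at_top"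
      using eventually_ge_at_top by (rule eventually_conj)
    then obtain y where y: "Im (V y) \<ge> b" "y \<ge> R'" using eventually_happens'[OF trivial_limit_at_top_linorder] by blast
    have "\<exists>x\<ge>R'. x \<le> y \<and> Im (V x) = b"
    proof (rule IVT')
      show "continuous_on {R'..y} (\<lambda>x. Im (V x))"
        by (intro continuous_on_Im continuous_on_subset[OF c]) (use R' in auto)
    qed (use y elim in auto)
    then obtain X where X: "X \<ge> R'" "Im (V X) = b" by blast
    have uniq: "x = X" if x: "x > 0 \<and> Im (V x) = b" for x
    proof -
      have "\<not> x < R'"
      proof
        assume "x < R'"
        then have "x \<in> {0<..<R'}" using x by simp
        then have "Im (V x) \<le> B" using B by blast
        then show False using elim x by simp
      qed
      then have "x \<ge> x1" "X \<ge> x1" using R' X by auto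
      then show ?thesis using mono[of x X] mono[of X x] X x by (metis less_irrefl linorder_neqE_linordered_idom)
    qed
    have "turning_point V b = X" unfolding turning_point_def
      by (rule the_equality) (use X R' uniq in auto)
    then show ?case using X R' by auto
  qed
qed

text \<open>The logarithmic derivative of \<open>Im V\<close> is comparable to \<open>x\<^sup>\<nu>\<close>. Over a window of length \<open>X^(-\<nu>)\<close> this changes \<open>Im V\<close> by
  bounded factors only, and its slope remains comparable to \<open>b \<kappa>\<close>. Integrated from a fixed point, it shows that \<open>\<nu> \<ge> - 1\<close>, as
  otherwise \<open>Im V\<close> would be bounded, and that \<open>ln b\<close> is at most of the order \<open>X^(\<nu>+1+\<epsilon>/2)\<close>; the additional \<open>\<epsilon> / 2\<close> covers
  the logarithmic case \<open>\<nu> = - 1\<close>.\<close>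

theorem potential_near_turning_point:
  assumes N: "N \<ge> 2" and H: "half_line_assumption N V \<nu> \<epsilon>"
  obtains D K where "derivative_chain N V D" "K \<ge> 1" "\<nu> \<ge> - 1" "\<epsilon> > 0"
    "filterlim (turning_point V) at_top at_top"
    "\<forall>\<^sub>F b in at_top. \<forall>X \<kappa> \<delta>. X = turning_point V b \<longrightarrow> \<kappa> = X powr \<nu> \<longrightarrow> \<delta> = 1 / (2 * \<kappa>) \<longrightarrow>
       1 \<le> X \<and> 1 \<le> b \<and> \<delta> \<le> X / 2 \<and> X powr (4 * \<nu> + 2 * \<epsilon> + 2) \<le> K * b \<and>
       ln b \<le> K * X powr (\<nu> + 1 + \<epsilon> / 2) \<and>
       (\<forall>t\<in>{X-\<delta>..X+\<delta>}. (\<forall>m\<in>{1..N}. cmod (D m t) \<le> K * (b + \<bar>Re (V t)\<bar>) * \<kappa> ^ m) \<and>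
          Im (V t) \<le> K * b \<and> 0 < Im (V t) \<and>
          (t \<ge> X \<longrightarrow> b * \<kappa> * (t - X) \<le> K * (Im (V t) - b)) \<and>
          (t \<le> X \<longrightarrow> b * \<kappa> * (X - t) \<le> K * (b - Im (V t))))"
proof -
  obtain D K x1 where ch: "derivative_chain N V D" and K: "K \<ge> 1" and x1: "x1 \<ge> 1"
    and Db': "\<forall>x\<ge>x1. \<forall>m\<in>{1..N}. cmod (D m x) \<le> K * cmod (V x) * x powr (real m * \<nu>)"
    and V1': "\<forall>x\<ge>x1. 1 \<le> Im (V x) \<and> Im (D 1 x) \<le> K * (Im (V x) * x powr \<nu>) \<and>
      Im (V x) * x powr \<nu> \<le> K * Im (D 1 x) \<and>
      x powr (8 * \<nu> + 4 * \<epsilon> + 4) \<le> K * (Im (V x))\<^sup>2"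
    and bd': "\<forall>R>0. \<exists>C. \<forall>x\<in>{0<..<R}. Im (V x) \<le> C"
    using derivative_chain_bounds[OF N H] by (elim exE conjE) (rule that)
  have Db: "cmod (D m x) \<le> K * cmod (V x) * x powr (real m * \<nu>)" if "x \<ge> x1" "m \<in> {1..N}" for x m
    using Db' that by blast
  have v1: "1 \<le> Im (V x)" and up: "Im (D 1 x) \<le> K * (Im (V x) * x powr \<nu>)"
    and lo: "Im (V x) * x powr \<nu> \<le> K * Im (D 1 x)"
    and grow: "x powr (8 * \<nu> + 4 * \<epsilon> + 4) \<le> K * (Im (V x))\<^sup>2" if "x \<ge> x1" for x
    using V1' that by blast+
  have bd: "\<exists>C. \<forall>x\<in>{0<..<R}. Im (V x) \<le> C" if "R > 0" for R using bd' that by blast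
  have Vc: "continuous_on {0<..} V" and lim: "filterlim (\<lambda>x. Im (V x)) at_top at_top" and \<epsilon>: "\<epsilon> > 0"
    using H unfolding half_line_assumption_def by blast+
  define v where "v = (\<lambda>x. Im (V x))"
  define v' where "v' = (\<lambda>x. Im (D 1 x))"
  have dv: "(v has_real_derivative v' x) (at x)" if "x \<ge> x1" for x
    unfolding v_def v'_def using Im_has_real_derivative[OF ch N] that x1 by simp
  have vge: "v x \<ge> 1" if "x \<ge> x1" for x using v1[OF that] by (simp add: v_def)
  have v'lo: "v x * x powr \<nu> \<le> K * v' x" if "x \<ge> x1" for x using lo[OF that] by (simp add: v_def v'_def)
  have v'up: "v' x \<le> K * (v x * x powr \<nu>)" if "x \<ge> x1" for x using up[OF that] by (simp add: v_def v'_def)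
  have v'pos: "v' x > 0" if x: "x \<ge> x1" for x
  proof -
    have "0 < v x * x powr \<nu>" using vge[OF x] x x1 by simp
    then have "0 < K * v' x" using v'lo[OF x] by linarith
    then show ?thesis using K by (simp add: zero_less_mult_iff)
  qed
  have mono: "v x < v y" if "x1 \<le> x" "x < y" for x y
    by (rule DERIV_pos_imp_increasing[OF that(2)]) (use dv v'pos that in \<open>meson order_trans\<close>)
  have dln: "((\<lambda>x. ln (v x)) has_real_derivative v' x / v x) (at x)" if "x \<ge> x1" for x
    using dv[OF that] vge[OF that] by (auto intro!: derivative_eq_intros)
  have ratio: "v' x / v x \<le> K * x powr \<nu>" if "x \<ge> x1" for x
    using v'up[OF that] vge[OF that] by (simp add: divide_le_eq mult_ac)
  \<comment> \<open>The logarithmic derivative is integrated after replacing \<open>\<nu>\<close> by an exponent \<open>\<sigma> - 1\<close> at least as large; taking it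
    strictly larger avoids the logarithm that would arise for \<open>\<nu> = - 1\<close>.\<close>
  have growth: "ln (v x) \<le> ln (v x1) + K * (x powr \<sigma> - x1 powr \<sigma>) / \<sigma>"
    if \<sigma>: "\<sigma> \<noteq> 0" "\<nu> \<le> \<sigma> - 1" and x: "x \<ge> x1" for \<sigma> x
  proof -
    have "ln (v x) - K * x powr \<sigma> / \<sigma> \<le> ln (v x1) - K * x1 powr \<sigma> / \<sigma>"
    proof (rule DERIV_nonpos_imp_nonincreasing[OF x])
      fix y assume y: "x1 \<le> y" "y \<le> x"
      have "((\<lambda>x. x powr \<sigma>) has_real_derivative \<sigma> * y powr (\<sigma> - 1)) (at y)"
        using y x1 by (intro has_real_derivative_powr) auto
      then have "((\<lambda>x. ln (v x) - K * x powr \<sigma> / \<sigma>) has_real_derivative v' y / v y - K * (\<sigma> * y powr (\<sigma> - 1)) / \<sigma>) (at y)"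
        using dln[OF y(1)] by (intro DERIV_diff DERIV_cdivide DERIV_cmult)
      moreover have "v' y / v y - K * (\<sigma> * y powr (\<sigma> - 1)) / \<sigma> \<le> 0"
      proof -
        have "K * y powr \<nu> \<le> K * y powr (\<sigma> - 1)"
          using K y x1 \<sigma>(2) by (intro mult_left_mono powr_mono) auto
        then show ?thesis using ratio[OF y(1)] \<sigma>(1) by simp
      qed
      ultimately show "\<exists>d. ((\<lambda>x. ln (v x) - K * x powr \<sigma> / \<sigma>) has_real_derivative d) (at y) \<and> d \<le> 0" by blast
    qed
    then show ?thesis by (simp add: diff_divide_distrib right_diff_distrib)
  qed
  have \<nu>: "\<nu> \<ge> -1"
  proof (rule ccontr)
    assume "\<not> \<nu> \<ge> -1"
    then have s: "\<nu> + 1 < 0" by simp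
    define M where "M = ln (v x1) - K * x1 powr (\<nu> + 1) / (\<nu> + 1)"
    have "v x \<le> exp M" if x: "x \<ge> x1" for x
    proof -
      have "ln (v x) \<le> ln (v x1) + K * (x powr (\<nu> + 1) - x1 powr (\<nu> + 1)) / (\<nu> + 1)"
        by (rule growth) (use s x in auto)
      also have "\<dots> = M + K * x powr (\<nu> + 1) / (\<nu> + 1)"
        unfolding M_def by (simp add: right_diff_distrib diff_divide_distrib)
      also have "K * x powr (\<nu> + 1) / (\<nu> + 1) \<le> 0" using s K by (intro divide_nonneg_neg) auto
      finally have "ln (v x) \<le> M" by simp
      then have "exp (ln (v x)) \<le> exp M" by simp
      then show ?thesis using vge[OF x] by simp
    qed
    moreover have "eventually (\<lambda>x. v x \<ge> exp M + 1 \<and> x \<ge> x1) at_top"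
      using lim eventually_ge_at_top[of x1] unfolding v_def filterlim_at_top by (auto intro: eventually_conj)
    then obtain x where "v x \<ge> exp M + 1" "x \<ge> x1" using eventually_happens'[OF trivial_limit_at_top_linorder] by blast
    ultimately show False by force
  qed
  define \<sigma> where "\<sigma> = \<nu> + 1 + \<epsilon> / 2"
  have \<sigma>: "\<sigma> > 0" using \<nu> \<epsilon> by (simp add: \<sigma>_def)
  define P where "P = 2 powr \<bar>\<nu>\<bar>"
  define P' where "P' = 2 powr (real N * \<bar>\<nu>\<bar>)"
  have P: "P \<ge> 1" "P' \<ge> 1" by (simp_all add: P_def P'_def ge_one_powr_ge_zero)
  define M where "M = K * P / 2"
  define K' where "K' = K * P' * exp M + K * P * exp M + exp M + K + ln (v x1) + K / \<sigma>"
  have M0: "M \<ge> 0" using K P by (simp add: M_def)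
  have eM: "exp M \<ge> 1" using M0 by simp
  have lnv: "ln (v x1) \<ge> 0" using vge[of x1] by simp
  have nonneg: "0 \<le> K * P' * exp M" "0 \<le> K * P * exp M" "0 \<le> exp M" "0 \<le> K" "0 \<le> K / \<sigma>" using K P \<sigma> by auto
  have K': "K \<le> K'" "K' \<ge> 1" "exp M \<le> K'" "K * P' * exp M \<le> K'" "K * P * exp M \<le> K'" "ln (v x1) + K / \<sigma> \<le> K'"
    using nonneg lnv K unfolding K'_def by linarith+
  have tp: "eventually (\<lambda>b. turning_point V b > R \<and> v (turning_point V b) = b) at_top" for R
    unfolding v_def
    by (rule turning_point_eventually[OF Vc _ bd lim, of x1]) (use mono x1 in \<open>auto simp: v_def\<close>)
  have tlim: "filterlim (turning_point V) at_top at_top"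
    unfolding filterlim_at_top
  proof
    fix R
    show "eventually (\<lambda>b. R \<le> turning_point V b) at_top" using tp[of R] by eventually_elim simp
  qed
  have main: "\<forall>\<^sub>F b in at_top. \<forall>X \<kappa> \<delta>. X = turning_point V b \<longrightarrow> \<kappa> = X powr \<nu> \<longrightarrow> \<delta> = 1 / (2 * \<kappa>) \<longrightarrow>
       1 \<le> X \<and> 1 \<le> b \<and> \<delta> \<le> X / 2 \<and> X powr (4 * \<nu> + 2 * \<epsilon> + 2) \<le> K' * b \<and>
       ln b \<le> K' * X powr (\<nu> + 1 + \<epsilon> / 2) \<and>
       (\<forall>t\<in>{X-\<delta>..X+\<delta>}. (\<forall>m\<in>{1..N}. cmod (D m t) \<le> K' * (b + \<bar>Re (V t)\<bar>) * \<kappa> ^ m) \<and>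
          Im (V t) \<le> K' * b \<and> 0 < Im (V t) \<and>
          (t \<ge> X \<longrightarrow> b * \<kappa> * (t - X) \<le> K' * (Im (V t) - b)) \<and>
          (t \<le> X \<longrightarrow> b * \<kappa> * (X - t) \<le> K' * (b - Im (V t))))"
    using tp[of "2 * x1"]
  proof eventually_elim
    case (elim b)
    define X where "X = turning_point V b"
    define \<kappa> where "\<kappa> = X powr \<nu>"
    define \<delta> where "\<delta> = 1 / (2 * \<kappa>)"
    have X: "X > 2 * x1" "v X = b" using elim by (auto simp: X_def)
    have X1: "X \<ge> 1" "X \<ge> x1" "X > 0" using X x1 by auto
    have b1: "b \<ge> 1" using vge[OF X1(2)] X by simp
    have \<kappa>0: "\<kappa> > 0" using X1 by (simp add: \<kappa>_def)
    have "1 \<le> X powr (\<nu> + 1)" using X1 \<nu> by (simp add: ge_one_powr_ge_zero)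
    also have "\<dots> = \<kappa> * X" using X1 by (simp add: powr_add \<kappa>_def)
    finally have d2: "\<delta> \<le> X / 2" using \<kappa>0 by (simp add: \<delta>_def divide_le_eq mult_ac)
    have \<delta>0: "\<delta> > 0" using \<kappa>0 by (simp add: \<delta>_def)
    have t1: "t \<ge> x1" "X / 2 \<le> t" "t \<le> 2 * X" if "t \<in> {X-\<delta>..X+\<delta>}" for t
      using that d2 X X1 by auto
    have tp1: "t powr \<nu> \<le> P * \<kappa>" if "t \<in> {X-\<delta>..X+\<delta>}" for t
      unfolding P_def \<kappa>_def by (rule powr_le_of_comparable) (use t1[OF that] X1 in auto)
    have tp2: "\<kappa> \<le> P * t powr \<nu>" if "t \<in> {X-\<delta>..X+\<delta>}" for t
      unfolding P_def \<kappa>_def by (rule powr_le_of_comparable) (use t1[OF that] x1 in auto)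
    \<comment> \<open>Across the window \<open>ln (Im V)\<close> varies by at most \<open>M\<close>, since the window has half-width \<open>1 / (2 \<kappa>)\<close>.\<close>
    have lnmono: "ln (v t) - ln (v s) \<le> K * P * \<kappa> * (t - s)"
      if st: "s \<le> t" "s \<in> {X-\<delta>..X+\<delta>}" "t \<in> {X-\<delta>..X+\<delta>}" for s t
    proof -
      have "ln (v t) - K * P * \<kappa> * t \<le> ln (v s) - K * P * \<kappa> * s"
      proof (rule DERIV_nonpos_imp_nonincreasing[OF st(1)])
        fix y assume y: "s \<le> y" "y \<le> t"
        then have yI: "y \<in> {X-\<delta>..X+\<delta>}" using st by auto
        have "((\<lambda>x. ln (v x) - K * P * \<kappa> * x) has_real_derivative v' y / v y - K * P * \<kappa> * 1) (at y)"
          by (intro DERIV_diff DERIV_cmult DERIV_ident dln t1(1) yI)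
        moreover have "v' y / v y - K * P * \<kappa> * 1 \<le> 0"
        proof -
          have "K * y powr \<nu> \<le> K * (P * \<kappa>)" using K by (intro mult_left_mono tp1[OF yI]) auto
          from order_trans[OF ratio[OF t1(1)[OF yI]] this] show ?thesis by (simp add: mult.assoc)
        qed
        ultimately show "\<exists>d. ((\<lambda>x. ln (v x) - K * P * \<kappa> * x) has_real_derivative d) (at y) \<and> d \<le> 0" by blast
      qed
      then show ?thesis by (simp add: right_diff_distrib)
    qed
    have KM: "K * P * \<kappa> * \<delta> = M" using \<kappa>0 by (simp add: \<delta>_def M_def)
    have XI: "X \<in> {X-\<delta>..X+\<delta>}" using \<delta>0 by auto
    have vup: "v t \<le> exp M * b" if t: "t \<in> {X-\<delta>..X+\<delta>}" for t
    proof (cases "t \<ge> X")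
      case True
      have "ln (v t) \<le> ln b + K * P * \<kappa> * (t - X)" using lnmono[OF True XI t] X by simp
      also have "\<dots> \<le> ln b + K * P * \<kappa> * \<delta>" using K P \<kappa>0 t by (intro add_left_mono mult_left_mono) auto
      finally have "ln (v t) \<le> ln b + M" by (simp only: KM)
      then have "exp (ln (v t)) \<le> exp (ln b + M)" by simp
      then show ?thesis using vge[OF t1(1)[OF t]] b1 by (simp add: exp_add mult.commute)
    next
      case False
      have "v t \<le> 1 * b" using mono[OF t1(1)[OF t], of X] False X by simp
      also have "\<dots> \<le> exp M * b" using b1 eM by (intro mult_right_mono) auto
      finally show ?thesis .
    qed
    have vlo: "b \<le> exp M * v t" if t: "t \<in> {X-\<delta>..X+\<delta>}" for t
    proof (cases "t \<le> X")
      case True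
      have "ln b \<le> ln (v t) + K * P * \<kappa> * (X - t)" using lnmono[OF True t XI] X by simp
      also have "\<dots> \<le> ln (v t) + K * P * \<kappa> * \<delta>" using K P \<kappa>0 t by (intro add_left_mono mult_left_mono) auto
      finally have "ln b \<le> ln (v t) + M" by (simp only: KM)
      then have "exp (ln b) \<le> exp (ln (v t) + M)" by simp
      then show ?thesis using vge[OF t1(1)[OF t]] b1 by (simp add: exp_add mult.commute)
    next
      case False
      have vt: "b \<le> 1 * v t" using mono[OF X1(2), of t] False X by simp
      also have "\<dots> \<le> exp M * v t" using b1 eM vt by (intro mult_right_mono) auto
      finally show ?thesis .
    qed
    have slope: "b * \<kappa> \<le> (K * P * exp M) * v' t" if t: "t \<in> {X-\<delta>..X+\<delta>}" for t
    proof -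
      have "b * \<kappa> \<le> (exp M * v t) * (P * t powr \<nu>)"
        using b1 \<kappa>0 vge[OF t1(1)[OF t]] by (intro mult_mono vlo[OF t] tp2[OF t]) auto
      also have "\<dots> = exp M * P * (v t * t powr \<nu>)" by simp
      also have "\<dots> \<le> exp M * P * (K * v' t)" using P by (intro mult_left_mono v'lo t1(1)[OF t]) auto
      finally show ?thesis by (simp add: mult_ac)
    qed
    have vinc: "b * \<kappa> * (t - s) \<le> K' * (v t - v s)"
      if st: "s \<le> t" "s \<in> {X-\<delta>..X+\<delta>}" "t \<in> {X-\<delta>..X+\<delta>}" for s t
    proof -
      have "K' * v s - b * \<kappa> * s \<le> K' * v t - b * \<kappa> * t"
      proof (rule DERIV_nonneg_imp_nondecreasing[OF st(1)])
        fix y assume y: "s \<le> y" "y \<le> t"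
        then have yI: "y \<in> {X-\<delta>..X+\<delta>}" using st by auto
        have "((\<lambda>x. K' * v x - b * \<kappa> * x) has_real_derivative K' * v' y - b * \<kappa> * 1) (at y)"
          by (intro DERIV_diff DERIV_cmult DERIV_ident dv t1(1) yI)
        moreover have "0 \<le> K' * v' y - b * \<kappa> * 1"
        proof -
          have "(K * P * exp M) * v' y \<le> K' * v' y"
            using v'pos[OF t1(1)[OF yI]] by (intro mult_right_mono K'(5)) auto
          then show ?thesis using slope[OF yI] by linarith
        qed
        ultimately show "\<exists>d. ((\<lambda>x. K' * v x - b * \<kappa> * x) has_real_derivative d) (at y) \<and> 0 \<le> d" by blast
      qed
      then show ?thesis by (simp add: right_diff_distrib)
    qed
    have g: "X powr (4 * \<nu> + 2 * \<epsilon> + 2) \<le> K' * b"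
    proof -
      have "(X powr (4 * \<nu> + 2 * \<epsilon> + 2))\<^sup>2 = X powr (8 * \<nu> + 4 * \<epsilon> + 4)"
        by (simp add: power2_eq_square powr_add[symmetric] add.assoc)
      also have "\<dots> \<le> K * b\<^sup>2" using grow[OF X1(2)] X by (simp add: v_def)
      also have "\<dots> \<le> K\<^sup>2 * b\<^sup>2" using K by (intro mult_right_mono) (auto simp: power2_eq_square)
      also have "\<dots> = (K * b)\<^sup>2" by (simp add: power_mult_distrib)
      finally have "X powr (4 * \<nu> + 2 * \<epsilon> + 2) \<le> K * b" using K b1 by (auto intro: power2_le_imp_le)
      also have "\<dots> \<le> K' * b" using K' b1 by (intro mult_right_mono) auto
      finally show ?thesis .
    qed
    have lnb: "ln b \<le> K' * X powr (\<nu> + 1 + \<epsilon> / 2)"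
    proof -
      have "ln b \<le> ln (v x1) + K * (X powr \<sigma> - x1 powr \<sigma>) / \<sigma>"
        using growth[of \<sigma> X] \<sigma> \<epsilon> X1 X by (auto simp: \<sigma>_def)
      also have "\<dots> \<le> ln (v x1) * X powr \<sigma> + K / \<sigma> * X powr \<sigma>"
      proof (intro add_mono)
        have "1 \<le> X powr \<sigma>" using X1 \<sigma> by (simp add: ge_one_powr_ge_zero)
        then show "ln (v x1) \<le> ln (v x1) * X powr \<sigma>" using lnv by (simp add: mult_le_cancel_left1)
        show "K * (X powr \<sigma> - x1 powr \<sigma>) / \<sigma> \<le> K / \<sigma> * X powr \<sigma>"
          using K \<sigma> by (simp add: divide_right_mono)
      qed
      also have "\<dots> = (ln (v x1) + K / \<sigma>) * X powr \<sigma>" by (simp add: distrib_right)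
      also have "\<dots> \<le> K' * X powr \<sigma>" by (intro mult_right_mono K') auto
      finally show ?thesis by (simp add: \<sigma>_def)
    qed
    have Dm: "cmod (D m t) \<le> K' * (b + \<bar>Re (V t)\<bar>) * \<kappa> ^ m"
      if t: "t \<in> {X-\<delta>..X+\<delta>}" and m: "m \<in> {1..N}" for t m
    proof -
      have "cmod (V t) \<le> \<bar>Re (V t)\<bar> + \<bar>Im (V t)\<bar>" by (rule cmod_le)
      also have "\<dots> \<le> exp M * \<bar>Re (V t)\<bar> + exp M * b"
      proof (intro add_mono)
        show "\<bar>Re (V t)\<bar> \<le> exp M * \<bar>Re (V t)\<bar>" using eM by (simp add: mult_le_cancel_right1)
        show "\<bar>Im (V t)\<bar> \<le> exp M * b" using vup[OF t] vge[OF t1(1)[OF t]] by (simp add: v_def)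
      qed
      finally have cV: "cmod (V t) \<le> exp M * (b + \<bar>Re (V t)\<bar>)" by (simp add: algebra_simps)
      have "t powr (real m * \<nu>) \<le> 2 powr \<bar>real m * \<nu>\<bar> * X powr (real m * \<nu>)"
        by (rule powr_le_of_comparable) (use t1[OF t] X1 in auto)
      also have "X powr (real m * \<nu>) = \<kappa> ^ m"
        using X1 by (simp add: \<kappa>_def powr_powr[symmetric] powr_realpow[symmetric] mult.commute)
      also have "2 powr \<bar>real m * \<nu>\<bar> * \<kappa> ^ m \<le> P' * \<kappa> ^ m"
        unfolding P'_def using m \<kappa>0 by (intro mult_right_mono powr_mono) (auto simp: abs_mult mult_right_mono)
      finally have tm: "t powr (real m * \<nu>) \<le> P' * \<kappa> ^ m" .
      have "cmod (D m t) \<le> K * cmod (V t) * t powr (real m * \<nu>)" by (rule Db[OF t1(1)[OF t] m])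
      also have "\<dots> \<le> K * (exp M * (b + \<bar>Re (V t)\<bar>)) * (P' * \<kappa> ^ m)"
        using K b1 by (intro mult_mono cV tm mult_nonneg_nonneg order_refl) auto
      also have "\<dots> = (K * P' * exp M) * ((b + \<bar>Re (V t)\<bar>) * \<kappa> ^ m)" by simp
      also have "\<dots> \<le> K' * ((b + \<bar>Re (V t)\<bar>) * \<kappa> ^ m)"
        using b1 \<kappa>0 by (intro mult_right_mono K') auto
      finally show ?thesis by (simp add: mult.assoc)
    qed
    have all: "(\<forall>m\<in>{1..N}. cmod (D m t) \<le> K' * (b + \<bar>Re (V t)\<bar>) * \<kappa> ^ m) \<and>
          Im (V t) \<le> K' * b \<and> 0 < Im (V t) \<and>
          (t \<ge> X \<longrightarrow> b * \<kappa> * (t - X) \<le> K' * (Im (V t) - b)) \<and>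
          (t \<le> X \<longrightarrow> b * \<kappa> * (X - t) \<le> K' * (b - Im (V t)))" if t: "t \<in> {X-\<delta>..X+\<delta>}" for t
    proof (intro conjI ballI impI)
      have "v t \<le> exp M * b" by (rule vup[OF t])
      also have "\<dots> \<le> K' * b" using b1 by (intro mult_right_mono K'(3)) auto
      finally show "Im (V t) \<le> K' * b" by (simp add: v_def)
      show "0 < Im (V t)" using vge[OF t1(1)[OF t]] by (simp add: v_def)
      show "b * \<kappa> * (t - X) \<le> K' * (Im (V t) - b)" if "t \<ge> X" using vinc[OF that XI t] X by (simp add: v_def)
      show "b * \<kappa> * (X - t) \<le> K' * (b - Im (V t))" if "t \<le> X" using vinc[OF that t XI] X by (simp add: v_def)
    qed (rule Dm[OF t])
    show ?case
      unfolding X_def[symmetric]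
      using X1(1) b1 d2 g lnb all unfolding \<delta>_def \<kappa>_def by blast
  qed
  show ?thesis by (rule that[OF ch K'(2) \<nu> \<epsilon> tlim main])
qed

section \<open>Comparison of the error terms\<close>

context wkb_window
begin

definition sup_term :: "nat \<Rightarrow> real \<Rightarrow> real" where
  "sup_term l s = (SUP x\<in>{X-\<delta><..<X+\<delta>}. (b + \<bar>Re (V x)\<bar>) ^ l / (a - Re (V x)) powr s)"

text \<open>The supremum is meaningful because the function is continuous on the compact closed window.\<close>

lemma le_sup_term:
  assumes "\<bar>x - X\<bar> < \<delta>"
  shows "(b + \<bar>Re (V x)\<bar>) ^ l / (a - Re (V x)) powr s \<le> sup_term l s"
  unfolding sup_term_def
proof (rule cSUP_upper)
  show "x \<in> {X-\<delta><..<X+\<delta>}" using assms by (auto simp: abs_less_iff)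
  have "continuous_on I (\<lambda>x. (b + \<bar>Re (V x)\<bar>) ^ l / (a - Re (V x)) powr s)"
  proof -
    have nz: "a - Re (V x) \<noteq> 0" if "x \<in> I" for x using gap_positive[OF that] by linarith
    show ?thesis
      by (intro continuous_on_divide continuous_on_power continuous_on_add continuous_on_const continuous_on_rabs
        continuous_on_powr continuous_on_diff continuous_on_Re V_continuous ballI)
        (use nz in \<open>simp_all only: powr_eq_0_iff not_False_eq_True\<close>)
  qed
  then have "bounded ((\<lambda>x. (b + \<bar>Re (V x)\<bar>) ^ l / (a - Re (V x)) powr s) ` I)"
    by (intro compact_imp_bounded compact_continuous_image) auto
  then show "bdd_above ((\<lambda>x. (b + \<bar>Re (V x)\<bar>) ^ l / (a - Re (V x)) powr s) ` {X-\<delta><..<X+\<delta>})"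
    by (intro bounded_imp_bdd_above) (rule bounded_subset, auto)
qed

lemma sup_term_nonneg: "0 \<le> sup_term l s"
proof -
  have "0 \<le> (b + \<bar>Re (V X)\<bar>) ^ l / (a - Re (V X)) powr s" using b by simp
  also have "\<dots> \<le> sup_term l s" by (rule le_sup_term) (use pos in auto)
  finally show ?thesis .
qed

lemma remainder_term_bound:
  assumes t: "\<bar>t - X\<bar> < \<delta>" and j: "j \<ge> 0"
  shows "\<kappa> ^ n * (1 / sqrt (cmod (W t))) ^ j * ((1 / sqrt (cmod (W t)))\<^sup>2 * (K * (b + \<bar>Re (V t)\<bar>))) ^ l
    \<le> K ^ l * (\<kappa> ^ n * sup_term l (real j / 2 + real l))"
proof -
  have tI: "t \<in> I" using t by auto
  define L where "L = cmod (W t)"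
  define A where "A = a - Re (V t)"
  have A: "0 < A" "A \<le> L" using gap_positive[OF tI] gap_le_W by (auto simp: A_def L_def)
  have L: "L > 0" using A by simp
  have "(1 / sqrt L) ^ j * ((1 / sqrt L)\<^sup>2) ^ l = L powr (- (real j / 2 + real l))"
  proof -
    have h: "1 / sqrt L = L powr (- (1 / 2))"
      unfolding powr_minus using L by (simp only: powr_half_sqrt inverse_eq_divide less_imp_le)
    have "(1 / sqrt L) ^ j * ((1 / sqrt L)\<^sup>2) ^ l = (L powr (- (1 / 2))) ^ (j + 2 * l)"
      unfolding h by (simp only: power_add power_mult)
    also have "\<dots> = (L powr (- (1 / 2))) powr real (j + 2 * l)" using L by (subst powr_realpow) auto
    also have "\<dots> = L powr (- (real j / 2 + real l))" unfolding powr_powr by (simp add: field_simps)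
    finally show ?thesis .
  qed
  also have "\<dots> \<le> A powr (- (real j / 2 + real l))"
    using A by (intro powr_mono2') auto
  finally have r: "(1 / sqrt L) ^ j * ((1 / sqrt L)\<^sup>2) ^ l \<le> 1 / A powr (real j / 2 + real l)"
    by (simp only: powr_minus_divide)
  have "\<kappa> ^ n * (1 / sqrt L) ^ j * ((1 / sqrt L)\<^sup>2 * (K * (b + \<bar>Re (V t)\<bar>))) ^ l
      = (\<kappa> ^ n * K ^ l * (b + \<bar>Re (V t)\<bar>) ^ l) * ((1 / sqrt L) ^ j * ((1 / sqrt L)\<^sup>2) ^ l)"
    by (simp add: power_mult_distrib)
  also have "\<dots> \<le> (\<kappa> ^ n * K ^ l * (b + \<bar>Re (V t)\<bar>) ^ l) * (1 / A powr (real j / 2 + real l))"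
    using \<kappa> K b by (intro mult_left_mono r) auto
  also have "\<dots> = K ^ l * (\<kappa> ^ n * ((b + \<bar>Re (V t)\<bar>) ^ l / (a - Re (V t)) powr (real j / 2 + real l)))"
    by (simp add: A_def)
  also have "\<dots> \<le> K ^ l * (\<kappa> ^ n * sup_term l (real j / 2 + real l))"
    using \<kappa> K by (intro mult_left_mono le_sup_term t) auto
  finally show ?thesis by (simp add: L_def)
qed

text \<open>The algebraic part of the bound claimed for the quotient.\<close>

definition main_bound :: real where
  "main_bound = \<kappa> ^ N * sup_term 1 (real N / 2)
    + (\<Sum>k=0..N-2. \<Sum>l=2..N+k. \<kappa> ^ (N + k) * sup_term l ((real N - 2 + real k) / 2 + real l))"

lemma main_bound_terms:
  shows "\<kappa> ^ N * sup_term 1 (real N / 2) \<le> main_bound"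
    and "k \<le> N - 2 \<Longrightarrow> l \<in> {2..N+k} \<Longrightarrow>
      \<kappa> ^ (N + k) * sup_term l ((real N - 2 + real k) / 2 + real l) \<le> main_bound"
    and "0 \<le> main_bound"
proof -
  have nn: "0 \<le> \<kappa> ^ n * sup_term l s" for n l s using \<kappa> sup_term_nonneg by simp
  let ?f = "\<lambda>k l. \<kappa> ^ (N + k) * sup_term l ((real N - 2 + real k) / 2 + real l)"
  have s0: "0 \<le> (\<Sum>k=0..N-2. \<Sum>l=2..N+k. ?f k l)" by (intro sum_nonneg nn)
  show "\<kappa> ^ N * sup_term 1 (real N / 2) \<le> main_bound" unfolding main_bound_def using s0 by simp
  show "0 \<le> main_bound" unfolding main_bound_def using s0 nn by (intro add_nonneg_nonneg) auto
  assume k: "k \<le> N - 2" and l: "l \<in> {2..N+k}"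
  have "?f k l \<le> (\<Sum>l=2..N+k. ?f k l)" by (rule member_le_sum[OF l nn]) auto
  also have "\<dots> \<le> (\<Sum>k=0..N-2. \<Sum>l=2..N+k. ?f k l)"
    using k by (intro member_le_sum sum_nonneg nn) auto
  finally show "?f k l \<le> main_bound" unfolding main_bound_def using nn[of N 1 "real N / 2"] by linarith
qed

lemma remainder_terms_le_main_bound:
  assumes t: "\<bar>t - X\<bar> < \<delta>"
  shows "\<kappa> ^ N * (1 / sqrt (cmod (W t))) ^ (N - 2) * ((1 / sqrt (cmod (W t)))\<^sup>2 * (K * (b + \<bar>Re (V t)\<bar>)))
      \<le> K ^ (2 * N) * main_bound"
    and "k \<le> N - 2 \<Longrightarrow> l \<in> {2..N+k} \<Longrightarrow>
      \<kappa> ^ (N + k) * (1 / sqrt (cmod (W t))) ^ (N - 2 + k) * ((1 / sqrt (cmod (W t)))\<^sup>2 * (K * (b + \<bar>Re (V t)\<bar>))) ^ l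
      \<le> K ^ (2 * N) * main_bound"
proof -
  have e1: "real (N - 2) / 2 + real 1 = real N / 2" using N by (simp add: of_nat_diff field_simps)
  have "\<kappa> ^ N * (1 / sqrt (cmod (W t))) ^ (N - 2) * ((1 / sqrt (cmod (W t)))\<^sup>2 * (K * (b + \<bar>Re (V t)\<bar>))) ^ 1
      \<le> K ^ 1 * (\<kappa> ^ N * sup_term 1 (real (N - 2) / 2 + real 1))"
    by (rule remainder_term_bound[OF t]) simp
  also have "\<dots> \<le> K ^ (2 * N) * main_bound"
    unfolding e1 using K N \<kappa> sup_term_nonneg by (intro mult_mono power_increasing main_bound_terms) auto
  finally show "\<kappa> ^ N * (1 / sqrt (cmod (W t))) ^ (N - 2) * ((1 / sqrt (cmod (W t)))\<^sup>2 * (K * (b + \<bar>Re (V t)\<bar>)))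
      \<le> K ^ (2 * N) * main_bound" by simp
  assume k: "k \<le> N - 2" and l: "l \<in> {2..N+k}"
  have e2: "real (N - 2 + k) / 2 + real l = (real N - 2 + real k) / 2 + real l" using N by (simp add: of_nat_diff)
  have "\<kappa> ^ (N + k) * (1 / sqrt (cmod (W t))) ^ (N - 2 + k) * ((1 / sqrt (cmod (W t)))\<^sup>2 * (K * (b + \<bar>Re (V t)\<bar>))) ^ l
      \<le> K ^ l * (\<kappa> ^ (N + k) * sup_term l (real (N - 2 + k) / 2 + real l))"
    by (rule remainder_term_bound[OF t]) simp
  also have "\<dots> \<le> K ^ (2 * N) * main_bound"
    unfolding e2 using K N k l \<kappa> sup_term_nonneg by (intro mult_mono power_increasing main_bound_terms) auto
  finally show "\<kappa> ^ (N + k) * (1 / sqrt (cmod (W t))) ^ (N - 2 + k) * ((1 / sqrt (cmod (W t)))\<^sup>2 * (K * (b + \<bar>Re (V t)\<bar>))) ^ l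
      \<le> K ^ (2 * N) * main_bound" .
qed

text \<open>The value at the turning point, with \<open>a - Re V \<le> K T\<^sup>2\<close>, already gives a lower bound that is polynomial in the
  parameters.\<close>

lemma main_bound_lower: "\<kappa> ^ N * (b / (K powr (real N / 2) * T ^ N)) \<le> main_bound"
proof -
  have XI: "X \<in> I" using pos by simp
  have "(a - Re (V X)) powr (real N / 2) \<le> (K * T\<^sup>2) powr (real N / 2)"
    using gap_positive[OF XI] gap_upper[OF XI] by (intro powr_mono2) auto
  also have "\<dots> = K powr (real N / 2) * T ^ N"
  proof -
    have "(T\<^sup>2) powr (real N / 2) = (T powr real 2) powr (real N / 2)" by (simp only: powr_realpow[OF T])
    also have "\<dots> = T powr (real N)" unfolding powr_powr by simp
    also have "\<dots> = T ^ N" using T by (simp add: powr_realpow)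
    finally show ?thesis using K T by (simp add: powr_mult)
  qed
  finally have g: "(a - Re (V X)) powr (real N / 2) \<le> K powr (real N / 2) * T ^ N" .
  have gp: "(a - Re (V X)) powr (real N / 2) > 0" using gap_positive[OF XI] by simp
  have "b / (K powr (real N / 2) * T ^ N) \<le> (b + \<bar>Re (V X)\<bar>) ^ 1 / (a - Re (V X)) powr (real N / 2)"
    using b g gp by (intro frac_le) auto
  also have "\<dots> \<le> sup_term 1 (real N / 2)" by (rule le_sup_term) (use pos in auto)
  finally have "\<kappa> ^ N * (b / (K powr (real N / 2) * T ^ N)) \<le> \<kappa> ^ N * sup_term 1 (real N / 2)"
    using \<kappa> by (intro mult_left_mono) auto
  then show ?thesis using main_bound_terms(1) by linarith
qed

text \<open>All parameters and their inverses are at most \<open>q\<close>. The edge terms carry a power of \<open>q\<close> with exponent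
  \<open>5 + 2 CC\<close>, the lower bound for \<open>main_bound\<close> loses another \<open>2 N\<close>, and the exponential decay outweighs both.\<close>

lemma edge_terms_bound:
  fixes C c q :: real
  defines "CC \<equiv> correction_const C"
  assumes C: "C \<ge> 0" and c: "c \<ge> 0" and q: "q \<ge> 1" "\<kappa> \<le> q" "1 / \<kappa> \<le> q" "T \<le> q" "1 / T \<le> q" "b / \<mu> \<le> q"
    and decay: "(5 + 2 * CC + 2 * real N) * ln q \<le> b / (128 * K\<^sup>2 * \<kappa> * T)"
  shows "2 * edge_bound C c * (2 + T / \<kappa>) * exp (2 * K + log_amplitude C)
    \<le> (6 * c * (4 * K + 4 * CC + 1) * exp (2 * K + 2 * CC) * 2 powr (2 * CC) * K powr (real N / 2)) * main_bound"
proof -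
  have CC: "CC \<ge> 0" using correction_const_nonneg[OF C] by (simp add: CC_def)
  define \<Lambda> where "\<Lambda> = b / (128 * K\<^sup>2 * \<kappa> * T)"
  have q0: "q > 0" using q by simp
  have rb: "rate_bound C \<le> (2 * K + 2 * CC) * q\<^sup>2"
  proof -
    have "T * 1 \<le> q * q" by (intro mult_mono) (use q T in auto)
    then have 1: "2 * K * T \<le> 2 * K * q\<^sup>2" using K by (simp add: power2_eq_square)
    have "\<kappa> * (1 + b / \<mu>) \<le> q * (q + q)" using q \<kappa> pos by (intro mult_mono add_mono) auto
    then have 2: "CC * (\<kappa> * (1 + b / \<mu>)) \<le> CC * (2 * q\<^sup>2)" using CC by (intro mult_left_mono) (auto simp: power2_eq_square)
    show ?thesis unfolding rate_bound_def CC_def[symmetric] using 1 2 by (simp add: algebra_simps)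
  qed
  have rb0: "0 \<le> rate_bound C"
    unfolding rate_bound_def CC_def[symmetric] using pos T CC \<kappa>
    by (intro add_nonneg_nonneg mult_nonneg_nonneg) auto
  have e1: "2 * c * \<kappa> * rate_bound C + c * \<kappa>\<^sup>2 \<le> c * (4 * K + 4 * CC + 1) * q ^ 3"
  proof -
    have "c * (\<kappa> * rate_bound C) \<le> c * (q * ((2 * K + 2 * CC) * q\<^sup>2))"
      using q \<kappa> rb rb0 by (intro mult_left_mono[OF _ c] mult_mono) auto
    moreover have "c * \<kappa>\<^sup>2 \<le> c * q ^ 3"
    proof (rule mult_left_mono[OF _ c])
      have "\<kappa>\<^sup>2 \<le> q\<^sup>2" using q \<kappa> by (intro power_mono) auto
      also have "\<dots> \<le> q ^ 3" using q by (intro power_increasing) auto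
      finally show "\<kappa>\<^sup>2 \<le> q ^ 3" .
    qed
    ultimately show ?thesis by (simp add: power2_eq_square power3_eq_cube algebra_simps)
  qed
  have e2: "2 + T / \<kappa> \<le> 3 * q\<^sup>2"
  proof -
    have "T * (1 / \<kappa>) \<le> q * q" using q T \<kappa> by (intro mult_mono) auto
    moreover have "1 \<le> q * q" using q mult_mono[of 1 q 1 q] by simp
    ultimately show ?thesis by (simp add: power2_eq_square)
  qed
  have e3: "exp (2 * log_amplitude C) \<le> exp (2 * CC) * 2 powr (2 * CC) * q powr (2 * CC)"
  proof -
    have bm: "0 < 1 + b / \<mu>" using pos by (simp add: add_pos_pos)
    have "ln (1 + b / \<mu>) \<le> ln (2 * q)" using bm q by (intro ln_mono) auto
    then have "exp (2 * CC * ln (1 + b / \<mu>)) \<le> exp (2 * CC * ln (2 * q))" using CC by (simp add: mult_left_mono)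
    also have "\<dots> = (2 * q) powr (2 * CC)" using q0 by (simp add: powr_def)
    also have "\<dots> = 2 powr (2 * CC) * q powr (2 * CC)" using q0 by (simp add: powr_mult)
    finally show ?thesis unfolding log_amplitude_def CC_def[symmetric]
      by (simp add: distrib_left exp_add mult.assoc)
  qed
  have e4: "exp (- \<Lambda>) \<le> q powr (- (5 + 2 * CC + 2 * real N))"
    using decay q0 unfolding \<Lambda>_def[symmetric] by (simp add: powr_def algebra_simps)
  have "2 * edge_bound C c * (2 + T / \<kappa>) * exp (2 * K + log_amplitude C)
      = 2 * (2 * c * \<kappa> * rate_bound C + c * \<kappa>\<^sup>2) * (2 + T / \<kappa>) * (exp (2 * K) * exp (2 * log_amplitude C) * exp (- \<Lambda>))"
  proof -
    have "exp (log_amplitude C - \<Lambda>) * exp (2 * K + log_amplitude C) = exp (2 * K) * exp (2 * log_amplitude C) * exp (- \<Lambda>)"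
      by (simp add: mult_exp_exp)
    moreover have "2 * (p * x) * w * y = 2 * p * w * (x * y)" for p x w y :: real by simp
    ultimately show ?thesis unfolding edge_bound_def \<Lambda>_def by (simp only:)
  qed
  also have "\<dots> \<le> 2 * (c * (4 * K + 4 * CC + 1) * q ^ 3) * (3 * q\<^sup>2) *
      (exp (2 * K) * (exp (2 * CC) * 2 powr (2 * CC) * q powr (2 * CC)) * q powr (- (5 + 2 * CC + 2 * real N)))"
    using c K CC \<kappa> T q rb0 by (intro mult_mono e1 e2 e3 e4 order_refl mult_nonneg_nonneg add_nonneg_nonneg) auto
  also have "\<dots> = 6 * c * (4 * K + 4 * CC + 1) * exp (2 * K + 2 * CC) * 2 powr (2 * CC) *
      (q ^ 3 * q\<^sup>2 * q powr (2 * CC) * q powr (- (5 + 2 * CC + 2 * real N)))"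
    by (simp add: exp_add mult_ac)
  also have "q ^ 3 * q\<^sup>2 * q powr (2 * CC) * q powr (- (5 + 2 * CC + 2 * real N)) = 1 / (q ^ N * q ^ N)"
  proof -
    have "q ^ 3 * q\<^sup>2 = q ^ 5" by (simp flip: power_add)
    also have "\<dots> = q powr real 5" by (rule powr_realpow[OF q0, symmetric])
    finally have 1: "q ^ 3 * q\<^sup>2 = q powr 5" by simp
    have "q ^ N * q ^ N = q ^ (N + N)" by (simp only: power_add)
    also have "\<dots> = q powr real (N + N)" by (rule powr_realpow[OF q0, symmetric])
    finally have 2: "q ^ N * q ^ N = q powr (2 * real N)" by simp
    have "q powr 5 * q powr (2 * CC) * q powr (- (5 + 2 * CC + 2 * real N)) = q powr (- (2 * real N))"
      by (simp add: powr_add[symmetric])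
    then show ?thesis unfolding 1 2 by (simp only: powr_minus_divide)
  qed
  also have "6 * c * (4 * K + 4 * CC + 1) * exp (2 * K + 2 * CC) * 2 powr (2 * CC) * (1 / (q ^ N * q ^ N))
     \<le> 6 * c * (4 * K + 4 * CC + 1) * exp (2 * K + 2 * CC) * 2 powr (2 * CC) * (K powr (real N / 2) * main_bound)"
  proof (rule mult_left_mono)
    have "1 / q \<le> \<kappa>" using q(3) q0 \<kappa> by (simp add: divide_le_eq mult.commute)
    then have k1: "(1 / q) ^ N \<le> \<kappa> ^ N" using q0 by (intro power_mono) auto
    have "1 / q \<le> 1 / T" using q(4) T by (intro divide_left_mono) auto
    then have t1: "(1 / q) ^ N \<le> (1 / T) ^ N" using q0 by (intro power_mono) auto
    have "1 / (q ^ N * q ^ N) = (1 / q) ^ N * (1 * (1 / q) ^ N)" by (simp add: power_divide)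
    also have "\<dots> \<le> \<kappa> ^ N * (b * (1 / T) ^ N)"
      using k1 t1 q0 b \<kappa> by (intro mult_mono) auto
    also have "\<dots> = K powr (real N / 2) * (\<kappa> ^ N * (b / (K powr (real N / 2) * T ^ N)))"
      using pos T by (simp add: power_divide)
    also have "\<dots> \<le> K powr (real N / 2) * main_bound" by (intro mult_left_mono main_bound_lower) simp
    finally show "1 / (q ^ N * q ^ N) \<le> K powr (real N / 2) * main_bound" .
  qed (use c K CC in auto)
  finally show ?thesis by (simp add: mult.assoc)
qed

end

lemma le_on_closed_interval:
  fixes h :: "real \<Rightarrow> real"
  assumes "continuous_on {p..q} h" "p < q" "\<And>x. x \<in> {p<..<q} \<Longrightarrow> h x \<le> c" "x \<in> {p..q}"
  shows "h x \<le> c"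
  by (rule continuous_le_on_closure[of "{p<..<q}"]) (use assms in auto)

lemma monomial_le_power_product:
  fixes b X i j p :: real
  assumes "1 \<le> b" "1 \<le> X" "i \<le> p" "j \<le> p"
  shows "b powr i * X powr j \<le> (b * X) powr p"
proof -
  have "b powr i * X powr j \<le> b powr p * X powr p"
    using assms by (intro mult_mono powr_mono) auto
  then show ?thesis using assms by (simp add: powr_mult)
qed

text \<open>The choice \<open>T = b X^(-2\<nu>-1-\<epsilon>)\<close> leaves a factor \<open>X^(-2\<epsilon>)\<close> of the upper admissibility condition aside, so
  that \<open>b \<le> K T\<^sup>2\<close> holds too; it makes the decay exponent \<open>b / (\<kappa> T)\<close> equal to \<open>X^(\<nu>+1+\<epsilon>)\<close>. Admissibility on the open window
  extends to the closed one by continuity.\<close>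

lemma window_at_turning_point:
  fixes V :: "real \<Rightarrow> complex" and a :: "real \<Rightarrow> real"
  assumes N: "N \<ge> 2" and ch: "derivative_chain N V D" and K0: "K0 \<ge> 1" and \<nu>: "\<nu> \<ge> -1" and \<epsilon>: "\<epsilon> > 0"
    and C: "C1 > 0" "C2 > 0" "C3 > 0"
    and X: "X = turning_point V b" and \<kappa>: "\<kappa> = X powr \<nu>" and \<delta>: "\<delta> = 1 / (2 * \<kappa>)"
    and T: "T = b * X powr (- 2 * \<nu> - 1 - \<epsilon>)" and \<mu>: "\<mu> = (b * \<kappa>) powr (2 / 3)"
    and K: "K = K0 + C1 * C2 + C2 + 1 + C3"
    and tp: "1 \<le> X" "1 \<le> b" "\<delta> \<le> X / 2" "X powr (4 * \<nu> + 2 * \<epsilon> + 2) \<le> K0 * b"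
    and loc: "\<And>t. t \<in> {X-\<delta>..X+\<delta>} \<Longrightarrow> (\<forall>m\<in>{1..N}. cmod (D m t) \<le> K0 * (b + \<bar>Re (V t)\<bar>) * \<kappa> ^ m) \<and>
          Im (V t) \<le> K0 * b \<and> 0 < Im (V t) \<and>
          (t \<ge> X \<longrightarrow> b * \<kappa> * (t - X) \<le> K0 * (Im (V t) - b)) \<and>
          (t \<le> X \<longrightarrow> b * \<kappa> * (X - t) \<le> K0 * (b - Im (V t)))"
    and adm: "\<And>x. x \<in> {X-\<delta><..<X+\<delta>} \<Longrightarrow>
        b powr (2/3) * X powr (2 * \<nu> / 3) \<le> C1 * \<bar>a b\<bar> \<and> \<bar>a b\<bar> \<le> C2 * (a b - Re (V x)) \<and>
        a b - Re (V x) \<le> C3 * (b\<^sup>2 * X powr (- 4 * \<nu> - 4 * \<epsilon> - 2))"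
  shows "wkb_window N V D (a b) b X \<kappa> \<delta> K T \<mu>"
proof -
  have X0: "X > 0" and b0: "b > 0" using tp by auto
  have \<kappa>0: "\<kappa> > 0" using X0 by (simp add: \<kappa>)
  have \<delta>0: "\<delta> > 0" using \<kappa>0 by (simp add: \<delta>)
  have KK: "1 \<le> K" "K0 \<le> K" "C1 * C2 \<le> K" "C2 + 1 \<le> K" "C3 \<le> K" using K0 C unfolding K by auto
  have T0: "T > 0" using b0 X0 by (simp add: T)
  have T2: "T\<^sup>2 = b\<^sup>2 * X powr (- 4 * \<nu> - 2 * \<epsilon> - 2)"
  proof -
    have "X powr (- 2 * \<nu> - 1 - \<epsilon>) * X powr (- 2 * \<nu> - 1 - \<epsilon>) = X powr (- 4 * \<nu> - 2 * \<epsilon> - 2)"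
      unfolding powr_add[symmetric] by (rule arg_cong[where f="\<lambda>y. X powr y"]) simp
    then show ?thesis by (simp only: T power2_eq_square mult.assoc mult.left_commute)
  qed
  have Vc: "continuous_on {X-\<delta>..X+\<delta>} V"
  proof -
    have "{X-\<delta>..X+\<delta>} \<subseteq> {0<..}" using tp X0 by auto
    then show ?thesis
      using derivative_chain_continuous_on[OF ch, of 0 "{X-\<delta>..X+\<delta>}"] ch N by (simp add: derivative_chain_def)
  qed
  have lt: "X - \<delta> < X + \<delta>" using \<delta>0 by simp
  have \<mu>a: "\<mu> \<le> C1 * \<bar>a b\<bar>"
  proof -
    have "\<mu> = b powr (2/3) * X powr (2 * \<nu> / 3)"
      using b0 X0 by (simp add: \<mu> \<kappa> powr_mult powr_powr mult.commute)
    then show ?thesis using adm[of X] \<delta>0 by simp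
  qed
  have ga: "\<bar>a b\<bar> \<le> C2 * (a b - Re (V t))" if t: "t \<in> {X-\<delta>..X+\<delta>}" for t
  proof -
    have "C2 * Re (V t) \<le> C2 * a b - \<bar>a b\<bar>"
    proof (rule le_on_closed_interval[OF _ lt _ t])
      show "continuous_on {X-\<delta>..X+\<delta>} (\<lambda>x. C2 * Re (V x))" by (intro continuous_intros Vc)
      show "C2 * Re (V x) \<le> C2 * a b - \<bar>a b\<bar>" if "x \<in> {X-\<delta><..<X+\<delta>}" for x
        using adm[OF that] by (simp add: algebra_simps)
    qed
    then show ?thesis by (simp add: algebra_simps)
  qed
  have gu: "a b - Re (V t) \<le> C3 * (b\<^sup>2 * X powr (- 4 * \<nu> - 4 * \<epsilon> - 2))" if t: "t \<in> {X-\<delta>..X+\<delta>}" for t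
  proof (rule le_on_closed_interval[OF _ lt _ t])
    show "continuous_on {X-\<delta>..X+\<delta>} (\<lambda>x. a b - Re (V x))" by (intro continuous_intros Vc)
  qed (use adm in blast)
  have \<mu>0: "\<mu> > 0" using b0 \<kappa>0 by (simp add: \<mu>)
  have gl: "\<mu> \<le> (C1 * C2) * (a b - Re (V t))" if t: "t \<in> {X-\<delta>..X+\<delta>}" for t
  proof -
    have "C1 * \<bar>a b\<bar> \<le> C1 * (C2 * (a b - Re (V t)))" using C by (intro mult_left_mono ga t) auto
    then show ?thesis using \<mu>a by simp
  qed
  have gp: "a b - Re (V t) > 0" if t: "t \<in> {X-\<delta>..X+\<delta>}" for t
  proof -
    have "0 < (C1 * C2) * (a b - Re (V t))" using gl[OF t] \<mu>0 by linarith
    then show ?thesis by (rule zero_less_mult_pos) (use C in simp)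
  qed
  show ?thesis
  proof
    show "2 \<le> N" by (rule N)
    show "derivative_chain N V D" by (rule ch)
    show "1 \<le> K" by (rule KK)
    show "1 \<le> b" by (rule tp)
    show "0 < \<kappa>" by (rule \<kappa>0)
    show "\<delta> = 1 / (2 * \<kappa>)" by (rule \<delta>)
    show "0 < X - \<delta>" using tp X0 by simp
    show "0 < T" by (rule T0)
    show "turning_point V b = X" by (simp add: X)
    show "\<mu> = (b * \<kappa>) powr (2 / 3)" by (rule \<mu>)
    fix t assume t: "t \<in> {X-\<delta>..X+\<delta>}"
    note L = loc[OF t]
    show "cmod (D m t) \<le> K * (b + \<bar>Re (V t)\<bar>) * \<kappa> ^ m" if "m \<in> {1..N}" for m
    proof -
      have "cmod (D m t) \<le> K0 * ((b + \<bar>Re (V t)\<bar>) * \<kappa> ^ m)" using L that by (simp add: mult.assoc)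
      also have "\<dots> \<le> K * ((b + \<bar>Re (V t)\<bar>) * \<kappa> ^ m)" using b0 \<kappa>0 by (intro mult_right_mono KK) auto
      finally show ?thesis by (simp add: mult.assoc)
    qed
    show "b * \<kappa> * (t - X) \<le> K * (Im (V t) - b)" if "X \<le> t"
    proof -
      have 1: "b * \<kappa> * (t - X) \<le> K0 * (Im (V t) - b)" using L that by blast
      have "0 \<le> b * \<kappa> * (t - X)" using b0 \<kappa>0 that by simp
      then have "0 \<le> K0 * (Im (V t) - b)" using 1 by linarith
      then have "0 \<le> Im (V t) - b" using K0 by (simp add: zero_le_mult_iff)
      then have "K0 * (Im (V t) - b) \<le> K * (Im (V t) - b)" by (intro mult_right_mono KK)
      then show ?thesis using 1 by linarith
    qed
    show "b * \<kappa> * (X - t) \<le> K * (b - Im (V t))" if "t \<le> X"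
    proof -
      have 1: "b * \<kappa> * (X - t) \<le> K0 * (b - Im (V t))" using L that by blast
      have "0 \<le> b * \<kappa> * (X - t)" using b0 \<kappa>0 that by simp
      then have "0 \<le> K0 * (b - Im (V t))" using 1 by linarith
      then have "0 \<le> b - Im (V t)" using K0 by (simp add: zero_le_mult_iff)
      then have "K0 * (b - Im (V t)) \<le> K * (b - Im (V t))" by (intro mult_right_mono KK)
      then show ?thesis using 1 by linarith
    qed
    have "K0 * b \<le> K * b" using b0 by (intro mult_right_mono KK) auto
    then show "0 < Im (V t) \<and> Im (V t) \<le> K * b" using L by linarith
    have g0: "0 \<le> a b - Re (V t)" using gp[OF t] by simp
    show "\<mu> \<le> K * (a b - Re (V t))"
      using gl[OF t] mult_right_mono[OF KK(3) g0] by linarith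
    show "\<bar>Re (V t)\<bar> \<le> K * (a b - Re (V t))"
    proof -
      have "\<bar>Re (V t)\<bar> \<le> \<bar>a b\<bar> + (a b - Re (V t))" using g0 by linarith
      also have "\<dots> \<le> (C2 + 1) * (a b - Re (V t))" using ga[OF t] by (simp add: algebra_simps)
      also have "\<dots> \<le> K * (a b - Re (V t))" by (rule mult_right_mono[OF KK(4) g0])
      finally show ?thesis .
    qed
    show "a b - Re (V t) \<le> K * T\<^sup>2"
    proof -
      have "a b - Re (V t) \<le> C3 * (b\<^sup>2 * X powr (- 4 * \<nu> - 4 * \<epsilon> - 2))" by (rule gu[OF t])
      also have "\<dots> \<le> K * (b\<^sup>2 * X powr (- 4 * \<nu> - 2 * \<epsilon> - 2))"
        using KK C tp(1) \<epsilon> by (intro mult_mono mult_left_mono powr_mono) auto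
      finally show ?thesis by (simp only: T2)
    qed
  next
    show "b \<le> K * T\<^sup>2"
    proof -
      have "b = b * (X powr (4 * \<nu> + 2 * \<epsilon> + 2) * X powr (- 4 * \<nu> - 2 * \<epsilon> - 2))"
        using X0 by (simp add: powr_add[symmetric] algebra_simps)
      also have "\<dots> \<le> b * ((K0 * b) * X powr (- 4 * \<nu> - 2 * \<epsilon> - 2))"
        using b0 by (intro mult_left_mono mult_right_mono tp) auto
      also have "\<dots> = K0 * T\<^sup>2" by (simp only: T2 power2_eq_square[of b] mult_ac)
      also have "\<dots> \<le> K * T\<^sup>2" by (intro mult_right_mono KK) auto
      finally show ?thesis .
    qed
    show "\<kappa>\<^sup>2 \<le> K * b"
    proof -
      have "\<kappa>\<^sup>2 = X powr (2 * \<nu>)" by (simp add: \<kappa> power2_eq_square powr_add[symmetric])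
      also have "\<dots> \<le> X powr (4 * \<nu> + 2 * \<epsilon> + 2)" using tp(1) \<nu> \<epsilon> by (intro powr_mono) auto
      also have "\<dots> \<le> K0 * b" by (rule tp)
      also have "\<dots> \<le> K * b" using b0 by (intro mult_right_mono KK) auto
      finally show ?thesis .
    qed
  qed
qed

lemma polynomial_parameters:
  fixes b X \<nu> \<epsilon> :: real
  assumes "1 \<le> b" "1 \<le> X" "\<epsilon> > 0"
  defines "q \<equiv> (b * X) powr (2 * \<bar>\<nu>\<bar> + 2 + \<epsilon>)" and "\<kappa> \<equiv> X powr \<nu>" and "T \<equiv> b * X powr (- 2 * \<nu> - 1 - \<epsilon>)"
  shows "1 \<le> q" "\<kappa> \<le> q" "1 / \<kappa> \<le> q" "T \<le> q" "1 / T \<le> q" "b / (b * \<kappa>) powr (2 / 3) \<le> q"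
proof -
  define p where "p = 2 * \<bar>\<nu>\<bar> + 2 + \<epsilon>"
  have p: "0 \<le> p" "1 \<le> p" "\<bar>\<nu>\<bar> \<le> p" "- 2 * \<nu> - 1 - \<epsilon> \<le> p" "2 * \<nu> + 1 + \<epsilon> \<le> p" "- (2 * \<nu> / 3) \<le> p"
    using assms(3) unfolding p_def by (auto simp: abs_if)
  note M = monomial_le_power_product[OF assms(1,2), where p=p]
  have q: "q = (b * X) powr p" by (simp add: q_def p_def)
  have pos: "b > 0" "X > 0" using assms by auto
  show "1 \<le> q" using M[of 0 0] p pos by (simp add: q)
  show "\<kappa> \<le> q" using M[of 0 \<nu>] p pos by (simp add: q \<kappa>_def)
  show "1 / \<kappa> \<le> q" using M[of 0 "- \<nu>"] p pos by (simp add: q \<kappa>_def powr_minus_divide)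
  show "T \<le> q" using M[of 1 "- 2 * \<nu> - 1 - \<epsilon>"] p pos by (simp add: q T_def)
  have "1 / T = b powr (- 1) * X powr (2 * \<nu> + 1 + \<epsilon>)"
  proof -
    have "X powr (- 2 * \<nu> - 1 - \<epsilon>) = 1 / X powr (2 * \<nu> + 1 + \<epsilon>)"
      using powr_minus_divide[of X "2 * \<nu> + 1 + \<epsilon>"] by simp
    then show ?thesis using pos by (simp add: T_def powr_minus_divide)
  qed
  then show "1 / T \<le> q" using M[of "-1" "2 * \<nu> + 1 + \<epsilon>"] p by (simp add: q)
  have "b / (b * \<kappa>) powr (2 / 3) = b powr (1 / 3) * X powr (- (2 * \<nu> / 3))"
  proof -
    have "b powr (1 / 3) * b powr (2 / 3) = b" using pos by (simp add: powr_add[symmetric])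
    moreover have "(b * \<kappa>) powr (2 / 3) = b powr (2 / 3) * X powr (2 * \<nu> / 3)"
      using pos by (simp add: powr_mult \<kappa>_def powr_powr mult.commute)
    ultimately have "b / (b * \<kappa>) powr (2 / 3) = b powr (1 / 3) * b powr (2 / 3) / (b powr (2 / 3) * X powr (2 * \<nu> / 3))"
      by simp
    then show ?thesis using pos by (simp add: powr_minus_divide)
  qed
  then show "b / (b * \<kappa>) powr (2 / 3) \<le> q" using M[of "1/3" "- (2 * \<nu> / 3)"] p by (simp add: q)
qed

text \<open>Since \<open>ln b\<close> is at most of the order \<open>X^(\<nu>+1+\<epsilon>/2)\<close>, so is the logarithm of any power of \<open>b X\<close>, and the remaining
  factor \<open>X^(\<epsilon>/2)\<close> beats every constant.\<close>

lemma decay_beats_polynomials: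
  fixes \<nu> \<epsilon> A B K0 :: real and X :: "real \<Rightarrow> real"
  assumes \<nu>: "\<nu> \<ge> - 1" and \<epsilon>: "\<epsilon> > 0" and A: "A \<ge> 0" and B: "B > 0" and K0: "K0 \<ge> 0"
    and X: "filterlim X at_top at_top"
  shows "\<forall>\<^sub>F b in at_top. ln b \<le> K0 * X b powr (\<nu> + 1 + \<epsilon> / 2) \<longrightarrow> 1 \<le> b \<longrightarrow>
    A * ln ((b * X b) powr (2 * \<bar>\<nu>\<bar> + 2 + \<epsilon>)) \<le> X b powr (\<nu> + 1 + \<epsilon>) / B"
proof -
  define \<sigma> where "\<sigma> = \<nu> + 1 + \<epsilon> / 2"
  define p where "p = 2 * \<bar>\<nu>\<bar> + 2 + \<epsilon>"
  have \<sigma>: "\<sigma> > 0" using \<nu> \<epsilon> by (simp add: \<sigma>_def)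
  have p: "p \<ge> 0" using \<epsilon> by (simp add: p_def)
  define R where "R = B * (A * p * (K0 + 1 / \<sigma>))"
  have "filterlim (\<lambda>x::real. x powr (\<epsilon> / 2)) at_top at_top" by (rule real_powr_at_top) (use \<epsilon> in simp)
  then have "\<forall>\<^sub>F b in at_top. R \<le> X b powr (\<epsilon> / 2)"
    using filterlim_compose[OF _ X, of "\<lambda>x. x powr (\<epsilon> / 2)" at_top] unfolding filterlim_at_top by blast
  moreover have "\<forall>\<^sub>F b in at_top. 1 \<le> X b" using X by (simp add: filterlim_at_top)
  ultimately show ?thesis
  proof eventually_elim
    case (elim b)
    show ?case
    proof (intro impI)
      assume lnb: "ln b \<le> K0 * X b powr (\<nu> + 1 + \<epsilon> / 2)" and b: "1 \<le> b"
      have "ln ((b * X b) powr p) = p * (ln b + ln (X b))" using b elim by (simp add: ln_powr ln_mult_pos)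
      also have "\<dots> \<le> p * (K0 * X b powr \<sigma> + X b powr \<sigma> / \<sigma>)"
        using lnb ln_powr_bound[OF elim(2) \<sigma>] p by (intro mult_left_mono add_mono) (auto simp: \<sigma>_def)
      finally have "A * ln ((b * X b) powr p) \<le> A * (p * (K0 * X b powr \<sigma> + X b powr \<sigma> / \<sigma>))"
        using A by (intro mult_left_mono)
      also have "\<dots> = R * X b powr \<sigma> / B" using B by (simp add: R_def field_simps)
      also have "\<dots> \<le> X b powr (\<epsilon> / 2) * X b powr \<sigma> / B"
        using B elim(1) by (intro divide_right_mono mult_right_mono) auto
      also have "X b powr (\<epsilon> / 2) * X b powr \<sigma> = X b powr (\<nu> + 1 + \<epsilon>)"
        by (simp add: powr_add[symmetric] \<sigma>_def add_ac)
      finally show "A * ln ((b * X b) powr (2 * \<bar>\<nu>\<bar> + 2 + \<epsilon>)) \<le> X b powr (\<nu> + 1 + \<epsilon>) / B"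
        by (simp add: p_def)
    qed
  qed
qed

section \<open>The estimate for the pseudomodes\<close>

theorem theorem5p2:
  fixes N :: nat and V :: "real \<Rightarrow> complex" and \<nu> \<epsilon>1 :: real
    and a :: "real \<Rightarrow> real" and \<xi> :: "real \<Rightarrow> real \<Rightarrow> real"
  assumes "N > 1"
    and "half_line_assumption N V \<nu> \<epsilon>1"
    and "cutoff_family V \<nu> \<xi>"
    and "admissible V \<nu> \<epsilon>1 a"
  shows "(\<forall>\<^sub>F b in at_top.
            let f = pseudomode (N - 1) V \<xi> (Complex (a b) b) in
              in_L2 f \<and> (\<exists>h. has_weak_deriv {0<..} 2 f h) \<and>
              in_L2 (residual V (Complex (a b) b) f) \<and> L2_norm_half f \<noteq> 0)
    \<and> (\<exists>c>0.
        (\<lambda>b. let f = pseudomode (N - 1) V \<xi> (Complex (a b) b) in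
              L2_norm_half (residual V (Complex (a b) b) f) / L2_norm_half f)
        \<in> O[at_top](\<lambda>b.
            exp (- c * turning_point V b powr (\<nu> + 1 + 2 * \<epsilon>1))
            + turning_point V b powr (real N * \<nu>) *
                (SUP x\<in>nbhd V \<nu> b. (b + \<bar>Re (V x)\<bar>) / (a b - Re (V x)) powr (real N / 2))
            + (\<Sum>k=0..N-2. \<Sum>l=2..N+k. turning_point V b powr (real (N + k) * \<nu>) *
                (SUP x\<in>nbhd V \<nu> b. (b + \<bar>Re (V x)\<bar>) ^ l
                   / (a b - Re (V x)) powr ((real N - 2 + real k) / 2 + real l)))))"
proof -
  have N: "N \<ge> 2" using assms(1) by simp
  obtain D K0 where D: "derivative_chain N V D" "K0 \<ge> 1" "\<nu> \<ge> - 1" "\<epsilon>1 > 0"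
    "filterlim (turning_point V) at_top at_top" and
    loc: "\<forall>\<^sub>F b in at_top. \<forall>X \<kappa> \<delta>. X = turning_point V b \<longrightarrow> \<kappa> = X powr \<nu> \<longrightarrow> \<delta> = 1 / (2 * \<kappa>) \<longrightarrow>
       1 \<le> X \<and> 1 \<le> b \<and> \<delta> \<le> X / 2 \<and> X powr (4 * \<nu> + 2 * \<epsilon>1 + 2) \<le> K0 * b \<and>
       ln b \<le> K0 * X powr (\<nu> + 1 + \<epsilon>1 / 2) \<and>
       (\<forall>t\<in>{X-\<delta>..X+\<delta>}. (\<forall>m\<in>{1..N}. cmod (D m t) \<le> K0 * (b + \<bar>Re (V t)\<bar>) * \<kappa> ^ m) \<and>
          Im (V t) \<le> K0 * b \<and> 0 < Im (V t) \<and>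
          (t \<ge> X \<longrightarrow> b * \<kappa> * (t - X) \<le> K0 * (Im (V t) - b)) \<and>
          (t \<le> X \<longrightarrow> b * \<kappa> * (X - t) \<le> K0 * (b - Im (V t))))"
    by (rule potential_near_turning_point[OF N assms(2)])
  obtain C where C: "C \<ge> 0" and
    hier: "\<forall>V (z :: complex) D. derivative_chain N V D \<longrightarrow> z \<noteq> 0 \<longrightarrow> (\<exists>P'. wkb_hierarchy N C V z D P')"
    using wkb_hierarchy_exists[OF N] by (elim exE conjE)
  obtain Cc where Cc: "Cc > 0" and cut: "\<forall>\<^sub>F b in at_top. test_function {0<..} (\<xi> b) \<and>
        (\<forall>x. 0 \<le> \<xi> b x \<and> \<xi> b x \<le> 1) \<and> (\<forall>x\<in>inner_nbhd V \<nu> b. \<xi> b x = 1) \<and>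
        (\<forall>x. x \<notin> nbhd V \<nu> b \<longrightarrow> \<xi> b x = 0) \<and>
        (\<forall>j\<in>{1, 2}. \<forall>x. \<bar>(deriv ^^ j) (\<xi> b) x\<bar> \<le> Cc * margin V \<nu> b powr (- real j))"
    using assms(3) unfolding cutoff_family_def by (elim exE conjE)
  obtain C1 C2 C3 where C123: "C1 > 0" "C2 > 0" "C3 > 0" and
    adm: "\<forall>\<^sub>F b in at_top. \<forall>x\<in>nbhd V \<nu> b.
        b powr (2/3) * turning_point V b powr (2 * \<nu> / 3) \<le> C1 * \<bar>a b\<bar> \<and>
        \<bar>a b\<bar> \<le> C2 * (a b - Re (V x)) \<and>
        a b - Re (V x) \<le> C3 * (b\<^sup>2 * turning_point V b powr (- 4 * \<nu> - 4 * \<epsilon>1 - 2))"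
    using assms(4) unfolding admissible_def by (elim exE conjE)
  define K where "K = K0 + C1 * C2 + C2 + 1 + C3"
  have K: "K \<ge> 1" using D(2) C123 by (simp add: K_def)
  \<comment> \<open>The value of \<open>correction_const C\<close>, written out because it must be available before \<open>b\<close> is chosen.\<close>
  define CC where "CC = 2 * K * (C * real N ^ 2 * (2 * K ^ 4) ^ N * K\<^sup>2)"
  have CC: "CC \<ge> 0" using C K by (simp add: CC_def)
  \<comment> \<open>The margin of the cut-off is \<open>1 / (8 \<kappa>)\<close>, and its square gives the larger factor \<open>64\<close>.\<close>
  define c where "c = 64 * Cc"
  have c: "c \<ge> 0" using Cc by (simp add: c_def)
  define M where "M = 2 * (C * real N + C\<^sup>2 * real N ^ 4) * K ^ (2 * N)
    + 6 * c * (4 * K + 4 * CC + 1) * exp (2 * K + 2 * CC) * 2 powr (2 * CC) * K powr (real N / 2)"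
  define F where "F b = pseudomode (N - 1) V \<xi> (Complex (a b) b)" for b
  define R where "R b = L2_norm_half (residual V (Complex (a b) b) (F b)) / L2_norm_half (F b)" for b
  define B where "B b = turning_point V b powr (real N * \<nu>) *
                (SUP x\<in>nbhd V \<nu> b. (b + \<bar>Re (V x)\<bar>) / (a b - Re (V x)) powr (real N / 2))
            + (\<Sum>k=0..N-2. \<Sum>l=2..N+k. turning_point V b powr (real (N + k) * \<nu>) *
                (SUP x\<in>nbhd V \<nu> b. (b + \<bar>Re (V x)\<bar>) ^ l
                   / (a b - Re (V x)) powr ((real N - 2 + real k) / 2 + real l)))" for b
  have decay: "\<forall>\<^sub>F b in at_top. ln b \<le> K0 * turning_point V b powr (\<nu> + 1 + \<epsilon>1 / 2) \<longrightarrow> 1 \<le> b \<longrightarrow>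
    (5 + 2 * CC + 2 * real N) * ln ((b * turning_point V b) powr (2 * \<bar>\<nu>\<bar> + 2 + \<epsilon>1))
      \<le> turning_point V b powr (\<nu> + 1 + \<epsilon>1) / (128 * K\<^sup>2)"
    by (rule decay_beats_polynomials) (use D K CC in auto)
  have main: "\<forall>\<^sub>F b in at_top. in_L2 (F b) \<and> (\<exists>h. has_weak_deriv {0<..} 2 (F b) h) \<and>
              in_L2 (residual V (Complex (a b) b) (F b)) \<and> L2_norm_half (F b) > 0 \<and> 0 \<le> B b \<and> R b \<le> M * B b"
    using loc cut adm decay
  proof eventually_elim
    case (elim b)
    define X where "X = turning_point V b"
    define \<kappa> where "\<kappa> = X powr \<nu>"
    define \<delta> where "\<delta> = 1 / (2 * \<kappa>)"
    define T where "T = b * X powr (- 2 * \<nu> - 1 - \<epsilon>1)"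
    define \<mu> where "\<mu> = (b * \<kappa>) powr (2 / 3)"
    define q where "q = (b * X) powr (2 * \<bar>\<nu>\<bar> + 2 + \<epsilon>1)"
    have E: "1 \<le> X \<and> 1 \<le> b \<and> \<delta> \<le> X / 2 \<and> X powr (4 * \<nu> + 2 * \<epsilon>1 + 2) \<le> K0 * b \<and>
       ln b \<le> K0 * X powr (\<nu> + 1 + \<epsilon>1 / 2) \<and>
       (\<forall>t\<in>{X-\<delta>..X+\<delta>}. (\<forall>m\<in>{1..N}. cmod (D m t) \<le> K0 * (b + \<bar>Re (V t)\<bar>) * \<kappa> ^ m) \<and>
          Im (V t) \<le> K0 * b \<and> 0 < Im (V t) \<and>
          (t \<ge> X \<longrightarrow> b * \<kappa> * (t - X) \<le> K0 * (Im (V t) - b)) \<and>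
          (t \<le> X \<longrightarrow> b * \<kappa> * (X - t) \<le> K0 * (b - Im (V t))))"
      by (rule elim(1)[rule_format, OF X_def \<kappa>_def \<delta>_def])
    have \<kappa>0: "\<kappa> > 0" using E by (simp add: \<kappa>_def)
    have w: "width V \<nu> b = \<delta>" by (simp add: width_def \<delta>_def \<kappa>_def X_def powr_minus_divide)
    have m: "margin V \<nu> b = 1 / (8 * \<kappa>)" by (simp add: margin_def w \<delta>_def)
    have nb: "nbhd V \<nu> b = {X-\<delta><..<X+\<delta>}" by (simp add: nbhd_def w X_def)
    have inb: "inner_nbhd V \<nu> b = {X-\<delta>+\<delta>/4<..<X+\<delta>-\<delta>/4}" by (simp add: inner_nbhd_def margin_def w X_def)
    interpret W: wkb_window N V D "a b" b X \<kappa> \<delta> K T \<mu>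
    proof (rule window_at_turning_point[OF N D(1-4) C123 X_def \<kappa>_def \<delta>_def T_def \<mu>_def K_def])
      show "b powr (2/3) * X powr (2 * \<nu> / 3) \<le> C1 * \<bar>a b\<bar> \<and> \<bar>a b\<bar> \<le> C2 * (a b - Re (V x)) \<and>
        a b - Re (V x) \<le> C3 * (b\<^sup>2 * X powr (- 4 * \<nu> - 4 * \<epsilon>1 - 2))" if "x \<in> {X-\<delta><..<X+\<delta>}" for x
        using elim(3) that unfolding nb X_def[symmetric] by (rule bspec)
    qed (use E in blast)+
    have z: "W.z = Complex (a b) b" by (rule W.z_def)
    have CCW: "W.correction_const C = CC" by (simp only: W.correction_const_def CC_def)
    obtain P' where P': "wkb_hierarchy N C V W.z D P'"
      using hier[rule_format, OF D(1) W.z_nonzero] by (elim exE)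
    have d1: "\<bar>deriv (\<xi> b) x\<bar> \<le> c * \<kappa>" for x
    proof -
      have "\<bar>(deriv ^^ 1) (\<xi> b) x\<bar> \<le> Cc * margin V \<nu> b powr (- real 1)" using elim(2) by blast
      also have "margin V \<nu> b powr (- real 1) = 8 * \<kappa>" using \<kappa>0 by (simp add: m powr_minus_divide)
      also have "Cc * (8 * \<kappa>) \<le> c * \<kappa>" using Cc \<kappa>0 by (simp add: c_def)
      finally show ?thesis by simp
    qed
    have d2: "\<bar>deriv (deriv (\<xi> b)) x\<bar> \<le> c * \<kappa>\<^sup>2" for x
    proof -
      have "\<bar>(deriv ^^ 2) (\<xi> b) x\<bar> \<le> Cc * margin V \<nu> b powr (- real 2)" using elim(2) by blast
      also have "margin V \<nu> b powr (- real 2) = 64 * \<kappa>\<^sup>2"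
      proof -
        have "margin V \<nu> b powr real 2 = (1 / (8 * \<kappa>))\<^sup>2" unfolding m using \<kappa>0 by (intro powr_realpow) simp
        then show ?thesis unfolding powr_minus using \<kappa>0 by (simp add: power2_eq_square)
      qed
      finally show ?thesis by (simp add: c_def numeral_2_eq_2)
    qed
    have test: "test_function {0<..} (\<xi> b)" and rng: "\<And>x. 0 \<le> \<xi> b x \<and> \<xi> b x \<le> 1" using elim(2) by blast+
    have one: "\<xi> b x = 1" if "\<bar>x - X\<bar> < 3 * \<delta> / 4" for x
    proof -
      have "x \<in> inner_nbhd V \<nu> b" unfolding inb greaterThanLessThan_iff using that by linarith
      then show ?thesis using elim(2) by blast
    qed
    have zero: "\<xi> b x = 0" if "\<delta> \<le> \<bar>x - X\<bar>" for x
    proof -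
      have "x \<notin> nbhd V \<nu> b" unfolding nb using that by (auto simp: abs_if split: if_splits)
      then show ?thesis using elim(2) by blast
    qed
    have Z: "K ^ (2 * N) * W.main_bound \<ge> 0" using K W.main_bound_terms(3) by simp
    note rb = W.residual_ratio_bound[where \<Xi>=\<xi>, OF C P' test rng one zero c d1 d2 Z
        W.remainder_terms_le_main_bound(1) W.remainder_terms_le_main_bound(2), folded z, unfolded z, folded F_def]
    have dec: "(5 + 2 * W.correction_const C + 2 * real N) * ln q \<le> b / (128 * K\<^sup>2 * \<kappa> * T)"
    proof -
      have "b / (128 * K\<^sup>2 * \<kappa> * T) = X powr (\<nu> + 1 + \<epsilon>1) / (128 * K\<^sup>2)"
      proof -
        have "\<kappa> * X powr (- 2 * \<nu> - 1 - \<epsilon>1) * X powr (\<nu> + 1 + \<epsilon>1) = X powr 0"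
          unfolding \<kappa>_def powr_add[symmetric] by (rule arg_cong[where f="\<lambda>y. X powr y"]) simp
        then have "\<kappa> * X powr (- 2 * \<nu> - 1 - \<epsilon>1) * X powr (\<nu> + 1 + \<epsilon>1) = 1" using E by simp
        then show ?thesis using E K \<kappa>0 by (simp add: T_def field_simps)
      qed
      then show ?thesis using elim(4) E unfolding CCW q_def X_def[symmetric] by simp
    qed
    have EX: "1 \<le> b" "1 \<le> X" using E by blast+
    note edge = W.edge_terms_bound[OF C c polynomial_parameters[OF EX D(4), where \<nu>=\<nu>,
          folded \<kappa>_def T_def q_def, folded \<mu>_def] dec, unfolded CCW]
    have pw: "X powr (real n * \<nu>) = \<kappa> ^ n" for n
      using \<kappa>0 by (simp add: \<kappa>_def powr_powr[symmetric] powr_realpow[symmetric] mult.commute)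
    have B: "B b = W.main_bound"
      unfolding B_def W.main_bound_def W.sup_term_def nb X_def[symmetric] pw by simp
    have "R b \<le> M * W.main_bound"
      using rb(5) edge unfolding R_def M_def by (simp add: algebra_simps)
    then show ?case using rb(1-4) W.main_bound_terms(3) unfolding B by blast
  qed
  have part1: "\<forall>\<^sub>F b in at_top. in_L2 (F b) \<and> (\<exists>h. has_weak_deriv {0<..} 2 (F b) h) \<and>
              in_L2 (residual V (Complex (a b) b) (F b)) \<and> L2_norm_half (F b) \<noteq> 0"
    using main by eventually_elim auto
  have part2: "R \<in> O[at_top](\<lambda>b. exp (- 1 * turning_point V b powr (\<nu> + 1 + 2 * \<epsilon>1)) + B b)"
  proof (rule bigoI)
    have M0: "0 \<le> M" using C c K CC by (simp add: M_def)
    have "0 \<le> R b" for b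
      unfolding R_def L2_norm_half_def set_lebesgue_integral_def by (simp add: integral_nonneg)
    show "\<forall>\<^sub>F b in at_top. norm (R b) \<le> M * norm (exp (- 1 * turning_point V b powr (\<nu> + 1 + 2 * \<epsilon>1)) + B b)"
      using main
    proof eventually_elim
      case (elim b)
      have "B b \<le> norm (exp (- 1 * turning_point V b powr (\<nu> + 1 + 2 * \<epsilon>1)) + B b)" using elim by simp
      then have "M * B b \<le> M * norm (exp (- 1 * turning_point V b powr (\<nu> + 1 + 2 * \<epsilon>1)) + B b)"
        using M0 by (rule mult_left_mono)
      then show ?case using elim \<open>0 \<le> R b\<close> by simp
    qed
  qed
  show ?thesis
    using part1 part2 unfolding Let_def F_def R_def B_def
    by (intro conjI exI[of _ 1]) (auto simp: add.assoc)
qed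

end
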